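(* Let $\phi_{\rm se}$ be the sum-exp dual described in the context, $F=\phi_{\rm se}-\phi_{\rm se}^\star$, let $\mathcal B$ be a partition of the $m$ coordinates with finite $\kappa_B,\nu_B\ge0$ such that $0\preceq\nabla^2_{BB}\phi_{\rm se}(u)\preceq(\kappa_B+\nu_BF(u))I_B$ for all $u$ and $B$, and assume $C_0=\sum_B\sqrt{\kappa_B}>0$, $\bar\Delta\ge F(z)$, $r\ge\|z-u^\star\|_2$ for some minimizer $u^\star$ of $\phi_{\rm se}$, and $0<\varepsilon<\bar\Delta$. Run $$J_{\rm rep}:=\Bigl\lceil\frac{\log(2\bar\Delta/\varepsilon)}{\log 3}\Bigr\rceil$$ independent copies of the accelerated block coordinate algorithm described in the context with $f=\phi_{\rm se}$, all from the same anchor $z$ (with the same $r$ and $\bar\Delta$), each with failure level $1/3$ and target $\varepsilon/2$, and return the point $\widehat u$ of smallest objective among $z$ and the outputs. Then $$\mathbb E\,F(\widehat u)\le\varepsilon,$$ and with $C_1=\sum_B\sqrt{\nu_B}$, $S_0=\sum_Bd_B\sqrt{\kappa_B}$, $S_1=\sum_Bd_B\sqrt{\nu_B}$, $d_B=|B|+\operatorname{nnz}(A_{B:})$, and $\chi:=\min\{\sqrt{2\bar\Delta}/C_0,\,1/C_1\}$ for $C_1>0$, $\chi:=0$ otherwise, $$\mathbb E\,W_{\rm opt}=\widetilde O\!\left(\frac{S_0}{C_0}+\frac{rS_0}{\sqrt\varepsilon}+rS_1+\chi S_1\right),$$ where $W_{\rm opt}$ is the arithmetic work of all repetitions, including phase-end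 comparisons, best-candidate storage and resets; this is on top of $W_{\rm init}=O(\operatorname{nnz}(A)+m+n)$ operations for anchor projections, constants and alias tables, and again $O(\operatorname{nnz}(A)+m+n)$ operations if a full primal response is output.
   Context: Setting. $A\in\mathbb R^{m\times n}$ with columns $a_1,\dots,a_n$, $b\in\mathbb R^m$, $c\in\mathbb R^n$, $\gamma>0$. Standing assumption: there is $q\in\mathbb R^m$ with $A^\top q=\mathbf 1$, $\langle q,b\rangle=1$, and there is $\bar x>0$ with $A\bar x=b$. $\phi_{\rm se}(\lambda)=-\langle b,\lambda\rangle+\gamma\sum_{j}\exp((a_j^\top\lambda-c_j)/\gamma)$; its minimum $\phi^\star_{\rm se}$ is attained. $A_{B:}$ is the submatrix of rows in $B$, $\operatorname{nnz}$ the number of nonzeros. $U_B:\mathbb R^{|B|}\to\mathbb R^m$ is zero-padding, $\nabla_B$ the block gradient. $\widetilde O$ suppresses absolute constants and factors logarithmic in the problem parameters. Arithmetic is exact real arithmetic. Algorithm (one copy, one phase), with inputs $z,\bar\Delta,r$, failure level $\delta$, target $\varepsilon'$, and distributions $\pi^{(0)}_B=\sqrt{\kappa_B}/C_0$ and, if $C_1>0$, $\pi^{(1)}_B=\sqrt{\nu_B}/C_1$ stored as alias tables ($O(1)$ expected sampling). (1) If $C_0=0$, $r=0$, $\bar\Delta=0$ or $\varepsilon'\ge\bar\Delta$, return $z$. (2) $T_0=r^2/(2\bar\Delta)$, $u_0=v_0=z$, $\Pi=r^2/\delta$. (3) For $k=0,1,\dots$: $\Delta_k=\Pi/T_k$;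 $M_k=C_0+\sqrt{5\Delta_k}\,C_1$; choose $a_{k+1}>0$ with $M_k^2a_{k+1}^2=T_k+a_{k+1}$; $T_{k+1}=T_k+a_{k+1}$; $y_k=(T_ku_k+a_{k+1}v_k)/T_{k+1}$; with probability $C_0/M_k$ draw $B_k\sim\pi^{(0)}$, else $B_k\sim\pi^{(1)}$; $\sqrt{\bar L_{k,B_k}}=\sqrt{\kappa_{B_k}}+\sqrt{5\nu_{B_k}\Delta_k}$, $p_{k,B_k}=\sqrt{\bar L_{k,B_k}}/M_k$; $g=\nabla_{B_k}f(y_k)$; pick $u_{k+1}\in y_k+\operatorname{range}U_{B_k}$ with $f(u_{k+1})\le f(y_k-U_{B_k}g/\bar L_{k,B_k})$; $v_{k+1}=v_k-(a_{k+1}/p_{k,B_k})U_{B_k}g$; if $T_{k+1}\ge\Pi/\varepsilon'$, return $u_{k+1}$. Sparse (lazy) implementation used for counting work. Store $\tilde v_k=v_k-z$, $w_k=T_k(u_k-v_k)$ and the projections $\zeta^0=A^\top z$, $\zeta^v_k=A^\top\tilde v_k$, $\zeta^w_k=A^\top w_k$. Then $y_k=z+\tilde v_k+w_k/T_{k+1}$, and with $\xi=a_{k+1}/p_{k,B_k}$ and $\eta_k=u_{k+1}-y_k$ (supported on $B_k$), $\tilde v_{k+1}=\tilde v_k-\xi U_{B_k}g$ and $w_{k+1}=w_k+T_{k+1}(\xi U_{B_k}g+\eta_k)$, with the same recurrences composed with $A^\top$ for $\zeta^v,\zeta^w$. The gradient entry $i\in B_k$ is $-b_i+\sum_{j:A_{ij}\ne0}A_{ij}\exp((\zeta^0_j+\zeta^v_{k,j}+\zeta^w_{k,j}/T_{k+1}-c_j)/\gamma)$.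 An iteration that samples block $B$ is charged $O(d_B)$ operations. At the end of a phase, the objective difference between the output and $z$, the storage of the best candidate and the reset are done using only the visited dual coordinates $I$ and the incident columns $J=\bigcup_{i\in I}\operatorname{supp}(A_{i:})$. *)

theory Defs
  imports "HOL-Probability.Probability" "Jordan_Normal_Form.Matrix"
begin

hide_type (open) Finite_Cartesian_Product.vec
hide_const (open) Finite_Cartesian_Product.vec
unbundle no vec_syntax
unbundle no inner_syntax

section \<open>The sum-exp dual, block Hessians and sparsity\<close>

definition sumexp :: "real mat \<Rightarrow> real vec \<Rightarrow> real vec \<Rightarrow> real \<Rightarrow> real vec \<Rightarrow> real" where
  "sumexp A b c \<gamma> u =
     - (b \<bullet> u) + \<gamma> * (\<Sum>j<dim_col A. exp ((col A j \<bullet> u - c $ j) / \<gamma>))"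

definition gap :: "nat \<Rightarrow> (real vec \<Rightarrow> real) \<Rightarrow> real vec \<Rightarrow> real" where
  "gap m f u = f u - (INF x\<in>carrier_vec m. f x)"

definition norm2 :: "real vec \<Rightarrow> real" where
  "norm2 x = sqrt (x \<bullet> x)"

definition partial_deriv :: "(real vec \<Rightarrow> real) \<Rightarrow> real vec \<Rightarrow> nat \<Rightarrow> real" where
  "partial_deriv f u i = deriv (\<lambda>t. f (u + t \<cdot>\<^sub>v unit_vec (dim_vec u) i)) 0"

definition hessian :: "(real vec \<Rightarrow> real) \<Rightarrow> real vec \<Rightarrow> nat \<Rightarrow> nat \<Rightarrow> real" where
  "hessian f u i j = partial_deriv (\<lambda>x. partial_deriv f x j) u i"

text \<open>The block gradient is already zero-padded: this is $U_B \nabla_B f(u)$.\<close>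

definition block_grad :: "(real vec \<Rightarrow> real) \<Rightarrow> nat set \<Rightarrow> real vec \<Rightarrow> real vec" where
  "block_grad f B u = vec (dim_vec u) (\<lambda>i. if i \<in> B then partial_deriv f u i else 0)"

text \<open>Loewner order of the \<open>B \<times> B\<close> submatrices of \<open>X\<close> and \<open>Y\<close>; indexing by the
  elements of \<open>B\<close> stands for the coordinates of $R^{|B|}$.\<close>

definition loewner_on ::
  "nat set \<Rightarrow> (nat \<Rightarrow> nat \<Rightarrow> real) \<Rightarrow> (nat \<Rightarrow> nat \<Rightarrow> real) \<Rightarrow> bool" where
  "loewner_on B X Y \<longleftrightarrow>
     (\<forall>i\<in>B. \<forall>j\<in>B. Y i j - X i j = Y j i - X j i) \<and>
     (\<forall>h. 0 \<le> (\<Sum>i\<in>B. \<Sum>j\<in>B. h i * (Y i j - X i j) * h j))"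

definition nnz_rows :: "real mat \<Rightarrow> nat set \<Rightarrow> nat" where
  "nnz_rows A B = card {(i, j). i \<in> B \<and> i < dim_row A \<and> j < dim_col A \<and> A $$ (i, j) \<noteq> 0}"

abbreviation nnz :: "real mat \<Rightarrow> nat" where
  "nnz A \<equiv> nnz_rows A {..<dim_row A}"

definition block_cost :: "real mat \<Rightarrow> nat set \<Rightarrow> nat" where
  "block_cost A B = card B + nnz_rows A B"


section \<open>The accelerated block coordinate algorithm\<close>

record phase_input =
  blocks :: "nat set list"
  kappa :: "nat set \<Rightarrow> real"
  nu :: "nat set \<Rightarrow> real"
  anchor :: "real vec"
  gap_bound :: real
  radius :: real
  level :: real
  target :: real

definition root_sum :: "nat set list \<Rightarrow> (nat set \<Rightarrow> real) \<Rightarrow> real" where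
  "root_sum bs w = (\<Sum>B\<in>set bs. sqrt (w B))"

abbreviation C0 :: "phase_input \<Rightarrow> real" where "C0 P \<equiv> root_sum (blocks P) (kappa P)"
abbreviation C1 :: "phase_input \<Rightarrow> real" where "C1 P \<equiv> root_sum (blocks P) (nu P)"

definition Pi_budget :: "phase_input \<Rightarrow> real" where
  "Pi_budget P = (radius P)\<^sup>2 / level P"

definition T_init :: "phase_input \<Rightarrow> real" where
  "T_init P = (radius P)\<^sup>2 / (2 * gap_bound P)"

text \<open>The scalars $\Delta_k$, $M_k$, $a_{k+1}$ depend on \<open>k\<close> only through $T = T_k$.\<close>

definition Delta_at :: "phase_input \<Rightarrow> real \<Rightarrow> real" where
  "Delta_at P T = Pi_budget P / T"

definition M_at :: "phase_input \<Rightarrow> real \<Rightarrow> real" where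
  "M_at P T = C0 P + sqrt (5 * Delta_at P T) * C1 P"

definition incr_at :: "phase_input \<Rightarrow> real \<Rightarrow> real" where
  "incr_at P T = (THE a. 0 < a \<and> (M_at P T)\<^sup>2 * a\<^sup>2 = T + a)"

fun T_seq :: "phase_input \<Rightarrow> nat \<Rightarrow> real" where
  "T_seq P 0 = T_init P"
| "T_seq P (Suc k) = T_seq P k + incr_at P (T_seq P k)"

definition root_L_at :: "phase_input \<Rightarrow> real \<Rightarrow> nat set \<Rightarrow> real" where
  "root_L_at P T B = sqrt (kappa P B) + sqrt (5 * nu P B * Delta_at P T)"

definition prob_at :: "phase_input \<Rightarrow> real \<Rightarrow> nat set \<Rightarrow> real" where
  "prob_at P T B = root_L_at P T B / M_at P T"

definition block_pmf :: "nat set list \<Rightarrow> (nat set \<Rightarrow> real) \<Rightarrow> nat set pmf" where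
  "block_pmf bs w = embed_pmf (\<lambda>B. if B \<in> set bs then sqrt (w B) / root_sum bs w else 0)"

definition draw_block :: "phase_input \<Rightarrow> real \<Rightarrow> nat set pmf" where
  "draw_block P T = do {
     c \<leftarrow> bernoulli_pmf (C0 P / M_at P T);
     if c then block_pmf (blocks P) (kappa P) else block_pmf (blocks P) (nu P) }"

text \<open>The choice of $u_{k+1}$ is an arbitrary rule. It sees the blocks \<open>h\<close> drawn in the
  phase so far (which determine all earlier iterates, and \<open>k = length h\<close>), the point
  $y_k$ and the new block.\<close>

type_synonym rule = "nat set list \<Rightarrow> real vec \<Rightarrow> nat set \<Rightarrow> real vec"

definition admissible_rule :: "(real vec \<Rightarrow> real) \<Rightarrow> phase_input \<Rightarrow> rule \<Rightarrow> bool" where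
  "admissible_rule f P rule \<longleftrightarrow>
     (\<forall>h B y. B \<in> set (blocks P) \<longrightarrow> y \<in> carrier_vec (dim_vec (anchor P)) \<longrightarrow>
        rule h y B \<in> carrier_vec (dim_vec (anchor P)) \<and>
        (\<forall>i<dim_vec (anchor P). i \<notin> B \<longrightarrow> rule h y B $ i = y $ i) \<and>
        f (rule h y B) \<le>
          f (y - (1 / (root_L_at P (T_seq P (length h)) B)\<^sup>2) \<cdot>\<^sub>v block_grad f B y))"

definition bcd_step ::
  "(real vec \<Rightarrow> real) \<Rightarrow> phase_input \<Rightarrow> rule \<Rightarrow>
    real vec \<times> real vec \<times> nat set list \<Rightarrow> (real vec \<times> real vec \<times> nat set list) pmf" where
  "bcd_step f P rule = (\<lambda>(u, v, h).
     let T = T_seq P (length h); a = incr_at P T;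
         y = (1 / (T + a)) \<cdot>\<^sub>v (T \<cdot>\<^sub>v u + a \<cdot>\<^sub>v v)
     in do {
       B \<leftarrow> draw_block P T;
       return_pmf (rule h y B, v - (a / prob_at P T B) \<cdot>\<^sub>v block_grad f B y, h @ [B]) })"

fun bcd_iterate ::
  "(real vec \<Rightarrow> real) \<Rightarrow> phase_input \<Rightarrow> rule \<Rightarrow> nat \<Rightarrow>
    (real vec \<times> real vec \<times> nat set list) pmf" where
  "bcd_iterate f P rule 0 = return_pmf (anchor P, anchor P, [])"
| "bcd_iterate f P rule (Suc k) = bcd_iterate f P rule k \<bind> bcd_step f P rule"

definition returns_anchor :: "phase_input \<Rightarrow> bool" where
  "returns_anchor P \<longleftrightarrow>
     C0 P = 0 \<or> radius P = 0 \<or> gap_bound P = 0 \<or> gap_bound P \<le> target P"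

text \<open>The stopping test involves only the deterministic $T_{k+1}$, so the number of
  iterations is deterministic; lemma \<open>phase_halts\<close> below shows that it is well defined.\<close>

definition n_iter :: "phase_input \<Rightarrow> nat" where
  "n_iter P = (LEAST N. 1 \<le> N \<and> Pi_budget P / target P \<le> T_seq P N)"

definition bcd_phase :: "(real vec \<Rightarrow> real) \<Rightarrow> phase_input \<Rightarrow> rule \<Rightarrow> real vec pmf" where
  "bcd_phase f P rule =
     (if returns_anchor P then return_pmf (anchor P)
      else map_pmf fst (bcd_iterate f P rule (n_iter P)))"

text \<open>Ties for the smallest objective go to the earliest candidate.\<close>

definition best_of :: "(real vec \<Rightarrow> real) \<Rightarrow> real vec \<Rightarrow> real vec list \<Rightarrow> real vec" where
  "best_of f z us = fold (\<lambda>u best. if f u < f best then u else best) us z"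

definition bcd_restarts ::
  "(real vec \<Rightarrow> real) \<Rightarrow> phase_input \<Rightarrow> rule \<Rightarrow> nat \<Rightarrow> real vec pmf" where
  "bcd_restarts f P rule J = map_pmf (best_of f (anchor P)) (replicate_pmf J (bcd_phase f P rule))"

lemma root_sum_nonneg: "(\<And>B. B \<in> set bs \<Longrightarrow> 0 \<le> w B) \<Longrightarrow> 0 \<le> root_sum bs w"
  unfolding root_sum_def by (intro sum_nonneg) auto

lemma incr_at_eq:
  assumes M: "0 < M_at P T" and T: "0 \<le> T"
  shows "incr_at P T = (1 + sqrt (1 + 4 * (M_at P T)\<^sup>2 * T)) / (2 * (M_at P T)\<^sup>2)"
    and "0 < incr_at P T"
    and "(M_at P T)\<^sup>2 * (incr_at P T)\<^sup>2 = T + incr_at P T"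
proof -
  define N where "N = (M_at P T)\<^sup>2"
  define s where "s = sqrt (1 + 4 * N * T)"
  define a where "a = (1 + s) / (2 * N)"
  have N: "0 < N" using M by (simp add: N_def)
  have s: "s * s = 1 + 4 * N * T" "0 \<le> s" using T N by (simp_all add: s_def)
  have pos: "0 < a" using s(2) N by (simp add: a_def)
  have Na: "2 * N * a = 1 + s" using N by (simp add: a_def)
  have sq: "4 * N * (N * x\<^sup>2 - (T + x)) = (2 * N * x - 1) * (2 * N * x - 1) - s * s" for x
    unfolding s(1) by (simp add: power2_eq_square algebra_simps)
  have "4 * N * (N * a\<^sup>2 - (T + a)) = 0"
    unfolding sq Na by simp
  then have eq: "N * a\<^sup>2 = T + a" using N by simp
  have uniq: "x = a" if x: "0 < x" "N * x\<^sup>2 = T + x" for x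
  proof -
    have "(N * x) * x = T + x" using x(2) by (simp only: power2_eq_square mult.assoc)
    then have "1 * x \<le> (N * x) * x" using T by linarith
    then have ge: "1 \<le> N * x" using x(1) by (rule mult_right_le_imp_le)
    have "(2 * N * x - 1) * (2 * N * x - 1) = s * s" using sq[of x] x(2) by simp
    then have "2 * N * x - 1 = s \<or> 2 * N * x - 1 = - s" by (simp only: square_eq_iff)
    then have "2 * N * x = 2 * N * a" using ge s(2) Na by linarith
    then show ?thesis using N by simp
  qed
  have *: "incr_at P T = a"
    unfolding incr_at_def N_def[symmetric]
    by (rule the_equality) (use pos eq in simp, use uniq in blast)
  show "incr_at P T = (1 + sqrt (1 + 4 * (M_at P T)\<^sup>2 * T)) / (2 * (M_at P T)\<^sup>2)"
    unfolding * a_def s_def N_def ..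
  show "0 < incr_at P T" unfolding * by (rule pos)
  show "(M_at P T)\<^sup>2 * (incr_at P T)\<^sup>2 = T + incr_at P T"
    unfolding * N_def[symmetric] by (rule eq)
qed

lemma phase_halts:
  assumes "\<And>B. B \<in> set (blocks P) \<Longrightarrow> 0 \<le> kappa P B" "\<And>B. B \<in> set (blocks P) \<Longrightarrow> 0 \<le> nu P B"
    and "0 < C0 P" "0 < radius P" "0 < gap_bound P" "0 < level P"
  shows "\<exists>N\<ge>1. X \<le> T_seq P N"
proof -
  have C1: "0 \<le> C1 P" using assms(2) by (rule root_sum_nonneg)
  have Pi: "0 < Pi_budget P" and T0: "0 < T_init P"
    using assms by (auto simp: Pi_budget_def T_init_def)
  define D where "D = M_at P (T_init P)"
  have M: "0 < M_at P T" "M_at P T \<le> D" if "T_init P \<le> T" for T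
  proof -
    have "Delta_at P T \<le> Delta_at P (T_init P)" "0 \<le> Delta_at P T"
      using that T0 Pi by (auto simp: Delta_at_def intro!: divide_left_mono mult_pos_pos)
    then show "0 < M_at P T" "M_at P T \<le> D"
      using C1 assms(3) by (auto simp: M_at_def D_def intro!: add_pos_nonneg mult_right_mono)
  qed
  have D: "0 < D" using M(1)[of "T_init P"] by (simp add: D_def)
  have inc: "1 / D\<^sup>2 \<le> incr_at P T" if "T_init P \<le> T" for T
  proof -
    have T: "0 \<le> T" using that T0 by simp
    note i = incr_at_eq(2,3)[OF M(1)[OF that] T]
    have "((M_at P T)\<^sup>2 * incr_at P T) * incr_at P T = T + incr_at P T"
      unfolding i(2)[symmetric] power2_eq_square by (simp only: mult.assoc)
    then have "1 * incr_at P T \<le> ((M_at P T)\<^sup>2 * incr_at P T) * incr_at P T"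
      using T by linarith
    then have "1 \<le> (M_at P T)\<^sup>2 * incr_at P T"
      using i(1) by (rule mult_right_le_imp_le)
    also have "\<dots> \<le> D\<^sup>2 * incr_at P T"
      using i(1) M[OF that] by (intro mult_right_mono power_mono) auto
    finally show ?thesis using D by (simp add: field_simps)
  qed
  have grow: "T_init P + real k / D\<^sup>2 \<le> T_seq P k" for k
  proof (induction k)
    case (Suc k)
    have "0 \<le> real k / D\<^sup>2" by simp
    then have "T_init P \<le> T_seq P k" using Suc by linarith
    from inc[OF this] Suc show ?case by (simp add: add_divide_distrib)
  qed simp
  obtain k :: nat where k: "X * D\<^sup>2 \<le> real k" using real_arch_simple by blast
  have "X * D\<^sup>2 \<le> real (Suc k)" using k by simp
  then have "X \<le> real (Suc k) / D\<^sup>2" using D by (simp add: field_simps)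
  also have "\<dots> \<le> T_seq P (Suc k)" using grow[of "Suc k"] T0 by linarith
  finally have "X \<le> T_seq P (Suc k)" .
  moreover have "1 \<le> Suc k" by simp
  ultimately show ?thesis by blast
qed


section \<open>Operation counts and the initialization\<close>

text \<open>Computations are pairs of a result and a counter. The counter advances by one for
  every executed straight-line fragment, that is, for a bounded number of exact real
  operations (arithmetic, exp, sqrt, comparison, random bit), array accesses and list
  operations. Arrays are functions on \<open>nat\<close>.\<close>

fun for_each :: "('a \<Rightarrow> 's \<Rightarrow> 's \<times> nat) \<Rightarrow> 'a list \<Rightarrow> 's \<Rightarrow> 's \<times> nat" where
  "for_each body [] s = (s, 0)"
| "for_each body (x # xs) s =
     (let (s1, k1) = body x s; (s2, k2) = for_each body xs s1 in (s2, 1 + k1 + k2))"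

text \<open>Row \<open>i\<close> of the sparse matrix as stored: its nonzero entries with their columns.\<close>

definition nz_row :: "real mat \<Rightarrow> nat \<Rightarrow> (nat \<times> real) list" where
  "nz_row A i = map (\<lambda>j. (j, A $$ (i, j))) (filter (\<lambda>j. A $$ (i, j) \<noteq> 0) [0..<dim_col A])"

text \<open>$A^T x$; allocating the zero array of length \<open>n\<close> costs \<open>n\<close>.\<close>

definition transpose_apply :: "real mat \<Rightarrow> (nat \<Rightarrow> real) \<Rightarrow> (nat \<Rightarrow> real) \<times> nat" where
  "transpose_apply A x =
     (let (s, k) = for_each
        (\<lambda>i. for_each (\<lambda>(j, a) s. (s(j := s j + a * x i), 0)) (nz_row A i))
        [0..<dim_row A] (\<lambda>_. 0)
      in (s, dim_col A + k))"

text \<open>Alias tables by Vose's method: slot \<open>l\<close> is kept with probability \<open>fst tab l\<close> and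
  otherwise redirected to \<open>snd tab l\<close>. The work lists hold the slots whose remaining
  weight (the mean being 1) is below 1 and at least 1, respectively.\<close>

type_synonym alias_table = "(nat \<Rightarrow> real) \<times> (nat \<Rightarrow> nat)"

function vose :: "(nat \<times> real) list \<Rightarrow> (nat \<times> real) list \<Rightarrow> alias_table \<Rightarrow> alias_table \<times> nat" where
  "vose ((i, p) # S) ((j, q) # L) tab =
     (let q' = q - (1 - p); tab' = ((fst tab)(i := p), (snd tab)(i := j));
          (t, k) = (if q' < 1 then vose ((j, q') # S) L tab' else vose S ((j, q') # L) tab')
      in (t, 1 + k))"
| "vose [] L tab = (tab, 0)"
| "vose (x # S) [] tab = (tab, 0)"
  by pat_completeness auto
termination by (relation "Wellfounded.measure (\<lambda>(S, L, _). length S + length L)") simp_all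

definition alias_build :: "nat set list \<Rightarrow> (nat set \<Rightarrow> real) \<Rightarrow> real \<Rightarrow> alias_table \<times> nat" where
  "alias_build bs w C =
     (let N = length bs;
          xs = map (\<lambda>l. (l, real N * (sqrt (w (bs ! l)) / C))) [0..<N];
          (t, k) = vose (filter (\<lambda>(l, p). p < 1) xs) (filter (\<lambda>(l, p). \<not> p < 1) xs)
                        (\<lambda>_. 1, \<lambda>l. l)
      in (t, N + k))"

definition alias_sample :: "nat \<Rightarrow> alias_table \<Rightarrow> nat pmf" where
  "alias_sample N tab = do {
     l \<leftarrow> pmf_of_set {..<N};
     keep \<leftarrow> bernoulli_pmf (fst tab l);
     return_pmf (if keep then l else snd tab l) }"

record init_data =
  su_zeta :: "nat \<Rightarrow> real"
  su_C0 :: real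
  su_C1 :: real
  su_tab0 :: alias_table
  su_tab1 :: alias_table

text \<open>The last summand is the allocation of the zeroed working arrays of the phases
  (two real and one Boolean array of each of the lengths \<open>m\<close> and \<open>n\<close>), the one before it
  pays for the remaining scalar constants.\<close>

definition initialize :: "real mat \<Rightarrow> phase_input \<Rightarrow> init_data \<times> nat" where
  "initialize A P =
     (let (\<zeta>, k0) = transpose_apply A (\<lambda>i. anchor P $ i);
          (c0, k1) = for_each (\<lambda>B s. (s + sqrt (kappa P B), 0)) (blocks P) 0;
          (c1, k2) = for_each (\<lambda>B s. (s + sqrt (nu P B), 0)) (blocks P) 0;
          (t0, k3) = alias_build (blocks P) (kappa P) c0;
          (t1, k4) = (if 0 < c1 then alias_build (blocks P) (nu P) c1 else ((\<lambda>_. 1, \<lambda>l. l), 0))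
      in (\<lparr>su_zeta = \<zeta>, su_C0 = c0, su_C1 = c1, su_tab0 = t0, su_tab1 = t1\<rparr>,
          k0 + k1 + k2 + k3 + k4 + 1 + 3 * (dim_row A + dim_col A)))"

text \<open>The full primal response $x_j(u) = \exp((a_j^T u - c_j)/\gamma)$.\<close>

definition primal_response ::
  "real mat \<Rightarrow> real vec \<Rightarrow> real \<Rightarrow> real vec \<Rightarrow> (nat \<Rightarrow> real) \<times> nat" where
  "primal_response A c \<gamma> u =
     (let (\<zeta>, k0) = transpose_apply A (\<lambda>i. u $ i);
          (x, k1) = for_each (\<lambda>j x. (x(j := exp ((\<zeta> j - c $ j) / \<gamma>)), 0)) [0..<dim_col A] (\<lambda>_. 0)
      in (x, k0 + dim_col A + k1))"


section \<open>The sparse implementation and its work\<close>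

text \<open>\<open>ls_v\<close>, \<open>ls_w\<close>, \<open>ls_zv\<close>, \<open>ls_zw\<close> hold $\tilde v_k$, $w_k$, $\zeta^v_k$, $\zeta^w_k$;
  \<open>ls_I\<close> and \<open>ls_J\<close> list the visited dual coordinates and the incident columns without
  repetition, using the flags \<open>ls_seenI\<close> and \<open>ls_seenJ\<close>. \<open>ls_hist\<close> is only the argument of
  the selection rule and is not charged.\<close>

record lazy_state =
  ls_v :: "nat \<Rightarrow> real"
  ls_w :: "nat \<Rightarrow> real"
  ls_zv :: "nat \<Rightarrow> real"
  ls_zw :: "nat \<Rightarrow> real"
  ls_seenI :: "nat \<Rightarrow> bool"
  ls_seenJ :: "nat \<Rightarrow> bool"
  ls_I :: "nat list"
  ls_J :: "nat list"
  ls_T :: real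
  ls_hist :: "nat set list"

definition lazy_init :: "phase_input \<Rightarrow> lazy_state" where
  "lazy_init P = \<lparr>ls_v = \<lambda>_. 0, ls_w = \<lambda>_. 0, ls_zv = \<lambda>_. 0, ls_zw = \<lambda>_. 0,
     ls_seenI = \<lambda>_. False, ls_seenJ = \<lambda>_. False, ls_I = [], ls_J = [],
     ls_T = T_init P, ls_hist = []\<rparr>"

text \<open>Gradient entries on the block, at $y_k = z + \tilde v_k + w_k / T_{k+1}$.\<close>

definition lazy_grad ::
  "real mat \<Rightarrow> real vec \<Rightarrow> real vec \<Rightarrow> real \<Rightarrow> (nat \<Rightarrow> real) \<Rightarrow> real \<Rightarrow> nat list \<Rightarrow> lazy_state
    \<Rightarrow> (nat \<Rightarrow> real) \<times> nat" where
  "lazy_grad A b c \<gamma> \<zeta> T' Bs st = for_each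
     (\<lambda>i g. for_each
        (\<lambda>(j, a) g. (g(i := g i + a * exp ((\<zeta> j + ls_zv st j + ls_zw st j / T' - c $ j) / \<gamma>)), 0))
        (nz_row A i) (g(i := - b $ i)))
     Bs (\<lambda>_. 0)"

text \<open>Adds \<open>x\<close> to $\tilde v$ and \<open>y\<close> to \<open>w\<close> in coordinate \<open>i\<close>, with the projections.\<close>

definition push_coord ::
  "real mat \<Rightarrow> nat \<Rightarrow> real \<Rightarrow> real \<Rightarrow> lazy_state \<Rightarrow> lazy_state \<times> nat" where
  "push_coord A i x y st = for_each
     (\<lambda>(j, a) st. (st\<lparr>
        ls_zv := (ls_zv st)(j := ls_zv st j + a * x),
        ls_zw := (ls_zw st)(j := ls_zw st j + a * y),
        ls_seenJ := (ls_seenJ st)(j := True),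
        ls_J := (if ls_seenJ st j then ls_J st else j # ls_J st)\<rparr>, 0))
     (nz_row A i)
     (st\<lparr>ls_v := (ls_v st)(i := ls_v st i + x),
         ls_w := (ls_w st)(i := ls_w st i + y),
         ls_seenI := (ls_seenI st)(i := True),
         ls_I := (if ls_seenI st i then ls_I st else i # ls_I st)\<rparr>)"

text \<open>One iteration after the block \<open>B\<close> has been drawn. The rule for $u_{k+1}$ is an
  oracle: it is handed the point represented by the state, which is not formed explicitly,
  only the values of $\eta_k$ on \<open>B\<close> are read off, and \<open>pc h B\<close> operations are charged.\<close>

definition lazy_update ::
  "real mat \<Rightarrow> real vec \<Rightarrow> real vec \<Rightarrow> real \<Rightarrow> phase_input \<Rightarrow> rule \<Rightarrow>
    (nat set list \<Rightarrow> nat set \<Rightarrow> nat) \<Rightarrow> init_data \<Rightarrow> lazy_state \<Rightarrow> nat set \<Rightarrow> lazy_state \<times> nat" where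
  "lazy_update A b c \<gamma> P rule pc su st B =
     (let T = ls_T st; \<Delta> = Pi_budget P / T;
          M = su_C0 su + sqrt (5 * \<Delta>) * su_C1 su;
          a = (1 + sqrt (1 + 4 * M\<^sup>2 * T)) / (2 * M\<^sup>2);
          T' = T + a;
          \<xi> = a / ((sqrt (kappa P B) + sqrt (5 * nu P B * \<Delta>)) / M);
          Bs = sorted_list_of_set B;
          (g, k1) = lazy_grad A b c \<gamma> (su_zeta su) T' Bs st;
          y = vec (dim_vec (anchor P)) (\<lambda>i. anchor P $ i + ls_v st i + ls_w st i / T');
          u = rule (ls_hist st) y B;
          (st', k2) = for_each
            (\<lambda>i. push_coord A i (- \<xi> * g i) (T' * (\<xi> * g i + (u $ i - y $ i)))) Bs st
      in (st'\<lparr>ls_T := T', ls_hist := ls_hist st @ [B]\<rparr>, 1 + k1 + pc (ls_hist st) B + k2))"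

definition lazy_step ::
  "real mat \<Rightarrow> real vec \<Rightarrow> real vec \<Rightarrow> real \<Rightarrow> phase_input \<Rightarrow> rule \<Rightarrow>
    (nat set list \<Rightarrow> nat set \<Rightarrow> nat) \<Rightarrow> init_data \<Rightarrow> lazy_state \<times> nat \<Rightarrow> (lazy_state \<times> nat) pmf" where
  "lazy_step A b c \<gamma> P rule pc su = (\<lambda>(st, W). do {
     coin \<leftarrow> bernoulli_pmf
       (su_C0 su / (su_C0 su + sqrt (5 * (Pi_budget P / ls_T st)) * su_C1 su));
     l \<leftarrow> alias_sample (length (blocks P)) (if coin then su_tab0 su else su_tab1 su);
     let (st', k) = lazy_update A b c \<gamma> P rule pc su st (blocks P ! l) in
     return_pmf (st', W + 1 + k) })"

fun lazy_iterate ::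
  "real mat \<Rightarrow> real vec \<Rightarrow> real vec \<Rightarrow> real \<Rightarrow> phase_input \<Rightarrow> rule \<Rightarrow>
    (nat set list \<Rightarrow> nat set \<Rightarrow> nat) \<Rightarrow> init_data \<Rightarrow> nat \<Rightarrow> lazy_state \<times> nat \<Rightarrow>
    (lazy_state \<times> nat) pmf" where
  "lazy_iterate A b c \<gamma> P rule pc su 0 s = return_pmf s"
| "lazy_iterate A b c \<gamma> P rule pc su (Suc k) s =
     lazy_iterate A b c \<gamma> P rule pc su k s \<bind> lazy_step A b c \<gamma> P rule pc su"

text \<open>Stored best candidate: objective minus that of the anchor, and the increments of the
  point and of its projection over the anchor's. The anchor itself is \<open>(0, [], [])\<close>.\<close>

type_synonym candidate = "real \<times> (nat \<times> real) list \<times> (nat \<times> real) list"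

text \<open>Comparison with the best candidate, storage and reset. The output of the phase is
  $u = z + \tilde v + w/T$.\<close>

definition phase_end ::
  "real vec \<Rightarrow> real vec \<Rightarrow> real \<Rightarrow> phase_input \<Rightarrow> init_data \<Rightarrow> lazy_state \<Rightarrow> candidate \<Rightarrow>
    (lazy_state \<times> candidate) \<times> nat" where
  "phase_end b c \<gamma> P su st best =
     (let T = ls_T st;
          du = (\<lambda>i. ls_v st i + ls_w st i / T);
          dz = (\<lambda>j. ls_zv st j + ls_zw st j / T);
          (s1, k1) = for_each (\<lambda>i s. (s - b $ i * du i, 0)) (ls_I st) 0;
          (s2, k2) = for_each
            (\<lambda>j s. (s + \<gamma> * (exp ((su_zeta su j + dz j - c $ j) / \<gamma>)
                             - exp ((su_zeta su j - c $ j) / \<gamma>)), 0)) (ls_J st) s1;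
          (best', k3) =
            (if s2 < fst best then
               (let (xs, k) = for_each (\<lambda>i xs. ((i, du i) # xs, 0)) (ls_I st) [];
                    (ys, k') = for_each (\<lambda>j ys. ((j, dz j) # ys, 0)) (ls_J st) []
                in ((s2, xs, ys), k + k'))
             else (best, 0));
          (st1, k4) = for_each
            (\<lambda>i st. (st\<lparr>ls_v := (ls_v st)(i := 0), ls_w := (ls_w st)(i := 0),
                       ls_seenI := (ls_seenI st)(i := False)\<rparr>, 0)) (ls_I st) st;
          (st2, k5) = for_each
            (\<lambda>j st. (st\<lparr>ls_zv := (ls_zv st)(j := 0), ls_zw := (ls_zw st)(j := 0),
                       ls_seenJ := (ls_seenJ st)(j := False)\<rparr>, 0)) (ls_J st) st1
      in ((st2\<lparr>ls_I := [], ls_J := [], ls_T := T_init P, ls_hist := []\<rparr>, best'),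
          1 + k1 + k2 + k3 + k4 + k5))"

text \<open>\<open>J\<close> repetitions, reusing the working arrays; the last component is the work spent
  after the initialization.\<close>

fun lazy_restarts ::
  "real mat \<Rightarrow> real vec \<Rightarrow> real vec \<Rightarrow> real \<Rightarrow> phase_input \<Rightarrow> rule \<Rightarrow>
    (nat set list \<Rightarrow> nat set \<Rightarrow> nat) \<Rightarrow> init_data \<Rightarrow> nat \<Rightarrow> (lazy_state \<times> candidate \<times> nat) pmf" where
  "lazy_restarts A b c \<gamma> P rule pc su 0 = return_pmf (lazy_init P, (0, [], []), 0)"
| "lazy_restarts A b c \<gamma> P rule pc su (Suc J) = do {
     (st, best, W) \<leftarrow> lazy_restarts A b c \<gamma> P rule pc su J;
     (st', W') \<leftarrow> (if returns_anchor P then return_pmf (st, W + 1)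
                   else lazy_iterate A b c \<gamma> P rule pc su (n_iter P) (st, W + 1));
     let ((st'', best'), k) = phase_end b c \<gamma> P su st' best in
     return_pmf (st'', best', W' + k) }"

definition candidate_point :: "real vec \<Rightarrow> candidate \<Rightarrow> real vec" where
  "candidate_point z best = vec (dim_vec z)
     (\<lambda>i. case map_of (fst (snd best)) i of None \<Rightarrow> z $ i | Some d \<Rightarrow> z $ i + d)"

text \<open>Joint law of the returned point and of the work \<open>W_opt\<close>.\<close>

definition lazy_run ::
  "real mat \<Rightarrow> real vec \<Rightarrow> real vec \<Rightarrow> real \<Rightarrow> phase_input \<Rightarrow> rule \<Rightarrow>
    (nat set list \<Rightarrow> nat set \<Rightarrow> nat) \<Rightarrow> nat \<Rightarrow> (real vec \<times> nat) pmf" where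
  "lazy_run A b c \<gamma> P rule pc J =
     map_pmf (\<lambda>(st, best, W). (candidate_point (anchor P) best, W))
       (lazy_restarts A b c \<gamma> P rule pc (fst (initialize A P)) J)"

end

theory Submission
  imports Defs
begin

text \<open>Accuracy. Let $V_k = T_k F(u_k) + \frac12 \lVert v_k - u^\star \rVert^2$ and
  $\Pi = r^2/\delta$. The usual estimate-sequence argument gives
  $\mathrm E[V_{k+1} \mid \mathcal F_k] \le V_k$ as long as the block smoothness constants used by
  the step are valid at $y_k$, that is, as long as $F(y_k) \le 5 \Delta_k$ with
  $\Delta_k = \Pi / T_k$. This holds whenever $V_k \le \Pi$ (\<open>gap_mix_le\<close>): the same convex
  combination of $u_k$ and $u^\star$ has value at most $\Pi / T_{k+1}$, and moving from it to
  $y_k$ costs only a constant factor because the full Hessian is controlled by the square of the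
  sum of the block roots (\<open>curvature_le_blocks\<close>) and because the sublevel set on which the
  curvature bounds hold is not left within a unit step (\<open>unit_step\<close>). So $\min(1, V_k / \Pi)$ is a supermartingale without
  any stopping argument: above the budget it already has its maximal value (\<open>risk_step\<close>). At the
  stopping time an output worse than the target forces $V_k > \Pi$, so a phase fails with
  probability at most $V_0 / \Pi \le \delta$ (\<open>phase_failure\<close>). All $J$ copies fail with
  probability at most $3^{-J} \le \varepsilon / (2 \bar\Delta)$, and the anchor limits the loss in
  that event to $\bar\Delta$ (\<open>restarts_gap\<close>).

  Law of the implementation. Vose's tables sample exactly the prescribed weights
  (\<open>alias_build_correct\<close>), and the lazily stored increments represent $u_k$ and $v_k$ exactly
  (\<open>update_correct\<close>), so an implemented iteration has the law of a step of the algorithm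
  (\<open>lstep_represented\<close>). The objective differences of the stored candidates are exact and the
  reset restores the initial state (\<open>phase_end_correct\<close>), so the repetitions are independent
  copies (\<open>restarts_best\<close>).

  Work. Up to constants an iteration costs $d_B$, including the later treatment of the entries
  that it makes visible, and $\mathrm E\, d_{B_k} = (S_0 + \sqrt{5 \Delta_k}\, S_1) / M_k$
  (\<open>mean_cost_eq\<close>). From $M_k^2 a_{k+1}^2 = T_{k+1}$ the terms $1 / M_k$ are Riemann terms of
  $\int dT / \sqrt T$, whose sum is $O(r / \sqrt\varepsilon)$ up to the last step
  (\<open>sum_inverse_M\<close>). The terms $\sqrt{5 \Delta_k} / M_k$ are comparable to $r\, dT / T$ unless
  $T$ at least doubles in the step; in that case they are at most a multiple of $\chi$, and
  doubling happens $O(\log (\bar\Delta / \varepsilon))$ times (\<open>local_share_step\<close>). With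
  $J = O(1 + \log (\bar\Delta / \varepsilon))$ copies this gives the square of the
  logarithmic factor.\<close>
section \<open>Convex functions of one variable with curvature bounded on a sublevel set\<close>

locale smooth_line =
  fixes g g' g'' :: "real \<Rightarrow> real"
  assumes g: "\<And>t. (g has_real_derivative g' t) (at t)"
    and g': "\<And>t. (g' has_real_derivative g'' t) (at t)"
begin

lemma taylor_upper:
  assumes t: "0 \<le> t" and L: "\<And>s. 0 \<le> s \<Longrightarrow> s \<le> t \<Longrightarrow> g'' s \<le> L"
  shows "g t \<le> g 0 + g' 0 * t + L / 2 * t\<^sup>2"
proof -
  have slope: "g' s \<le> g' 0 + L * s" if s: "0 \<le> s" "s \<le> t" for s
  proof -
    have "(\<lambda>x. L * x - g' x) 0 \<le> (\<lambda>x. L * x - g' x) s"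
    proof (rule DERIV_nonneg_imp_nondecreasing[OF s(1)])
      fix x assume x: "0 \<le> x" "x \<le> s"
      have "((\<lambda>x. L * x - g' x) has_real_derivative L - g'' x) (at x)"
        by (auto intro!: derivative_eq_intros g')
      then show "\<exists>y. ((\<lambda>x. L * x - g' x) has_real_derivative y) (at x) \<and> 0 \<le> y"
        using L[of x] x s by auto
    qed
    then show ?thesis by simp
  qed
  have "(\<lambda>x. g' 0 * x + L / 2 * x\<^sup>2 - g x) 0 \<le> (\<lambda>x. g' 0 * x + L / 2 * x\<^sup>2 - g x) t"
  proof (rule DERIV_nonneg_imp_nondecreasing[OF t])
    fix x assume x: "0 \<le> x" "x \<le> t"
    have "((\<lambda>x. g' 0 * x + L / 2 * x\<^sup>2 - g x) has_real_derivative g' 0 + L * x - g' x) (at x)"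
      by (auto intro!: derivative_eq_intros g)
    then show "\<exists>y. ((\<lambda>x. g' 0 * x + L / 2 * x\<^sup>2 - g x) has_real_derivative y) (at x) \<and> 0 \<le> y"
      using slope[of x] x by auto
  qed
  then show ?thesis by simp
qed

lemma continuous_line: "continuous_on S g"
  using g by (meson DERIV_isCont continuous_at_imp_continuous_on)

end

locale convex_line = smooth_line +
  assumes g''_nonneg: "\<And>t. 0 \<le> g'' t"
begin

lemma tangent_below: "g 0 + g' 0 \<le> g 1"
proof -
  interpret neg: smooth_line "\<lambda>t. - g t" "\<lambda>t. - g' t" "\<lambda>t. - g'' t"
    by unfold_locales (auto intro!: derivative_eq_intros g g')
  show ?thesis using neg.taylor_upper[of 1 0] g''_nonneg by simp
qed

lemma le_max_ends:
  assumes "0 \<le> s" "s \<le> t"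
  shows "g s \<le> max (g 0) (g t)"
proof -
  have "convex_on UNIV g"
    by (rule f''_ge0_imp_convex[where f' = g' and f'' = g'']) (auto intro: g g' g''_nonneg)
  then have "convex_on {0..t} g" by (rule convex_on_subset) auto
  then show ?thesis using assms by (intro convex_on_le_max) auto
qed

text \<open>A step against the slope cannot leave the sublevel set of its starting point before
  time $-g'(0)/L$: at the first return the quadratic upper model would still lie strictly
  below $g(0)$. Hence the curvature bound of the sublevel set applies on the whole step.\<close>

lemma descent:
  assumes cap: "\<And>s. g s \<le> G \<Longrightarrow> g'' s \<le> L" and G: "g 0 \<le> G" and L: "0 < L"
    and t: "0 \<le> t" "L * t \<le> - g' 0"
  shows "g t \<le> g 0 + g' 0 * t + L / 2 * t\<^sup>2"
proof -
  have model: "g s \<le> g 0 + g' 0 * s + L / 2 * s\<^sup>2" if s: "0 \<le> s" "g s \<le> g 0" for s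
  proof (rule taylor_upper[OF s(1)])
    fix x assume "0 \<le> x" "x \<le> s"
    then have "g x \<le> G" using le_max_ends[of x s] s G by auto
    then show "g'' x \<le> L" by (rule cap)
  qed
  have stay: "g t \<le> g 0"
  proof (rule ccontr)
    assume up: "\<not> g t \<le> g 0"
    then have t0: "0 < t" using t(1) by (cases "t = 0") auto
    then have neg: "g' 0 < 0" using L t(2) mult_pos_pos[OF L t0] by linarith
    obtain d where d: "0 < d" "\<And>h. 0 < h \<Longrightarrow> h < d \<Longrightarrow> g (0 + h) < g 0"
      using DERIV_neg_dec_right[OF g neg] by auto
    define h where "h = min (d / 2) (t / 2)"
    have h: "0 < h" "h < t" "g h < g 0" using d t0 d(2)[of h] by (auto simp: h_def)
    obtain x where x: "h \<le> x" "x \<le> t" "g x = g 0"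
      using IVT'[of g h "g 0" t] h up continuous_line by auto
    then have x': "0 < x" "x < t" using h up by (auto simp: less_le)
    have "0 \<le> x * (g' 0 + L / 2 * x)"
      using model[of x] x x' by (simp add: algebra_simps power2_eq_square)
    then have "0 \<le> g' 0 + L / 2 * x" using x' by (simp add: zero_le_mult_iff)
    moreover have "L * x < L * t" using L x' by simp
    ultimately show False using t(2) neg by linarith
  qed
  show ?thesis by (rule model[OF t(1) stay])
qed

end

text \<open>For nonnegative \<open>g\<close>, minimizing the quadratic model over a step in the descending
  direction bounds the slope by the value.\<close>

locale nonneg_convex_line = convex_line +
  assumes g_nonneg: "\<And>t. 0 \<le> g t"
begin

lemma slope_sq_le:
  assumes cap: "\<And>s. g s \<le> G \<Longrightarrow> g'' s \<le> L" and G: "g 0 \<le> G" and L: "0 < L"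
  shows "(g' 0)\<^sup>2 \<le> 2 * L * g 0"
proof -
  have *: "(h' 0)\<^sup>2 \<le> 2 * L * h 0"
    if "nonneg_convex_line h h' h''" "\<And>s. h s \<le> G \<Longrightarrow> h'' s \<le> L" "h 0 \<le> G" "h' 0 \<le> 0"
    for h h' h'' :: "real \<Rightarrow> real"
  proof -
    interpret h: nonneg_convex_line h h' h'' by fact
    have "0 \<le> h (- h' 0 / L)" by (rule h.g_nonneg)
    also have "\<dots> \<le> h 0 + h' 0 * (- h' 0 / L) + L / 2 * (- h' 0 / L)\<^sup>2"
      by (rule h.descent[of G]) (use that L in \<open>auto simp: divide_nonpos_pos\<close>)
    also have "\<dots> = h 0 - (h' 0)\<^sup>2 / (2 * L)"
      using L by (simp add: power2_eq_square field_simps)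
    finally show ?thesis using L by (simp add: field_simps)
  qed
  show ?thesis
  proof (cases "g' 0 \<le> 0")
    case True
    show ?thesis by (rule *[OF nonneg_convex_line_axioms]) (use cap G True in auto)
  next
    case False
    have "((\<lambda>t. g (- t)) has_real_derivative - g' (- t)) (at t)"
      "((\<lambda>t. - g' (- t)) has_real_derivative g'' (- t)) (at t)" for t
      using DERIV_mirror[of g "g' (- t)" t] DERIV_mirror[of g' "g'' (- t)" t] g g'
      by (auto intro!: derivative_eq_intros)
    then have "nonneg_convex_line (\<lambda>t. g (- t)) (\<lambda>t. - g' (- t)) (\<lambda>t. g'' (- t))"
      by unfold_locales (auto intro: g''_nonneg g_nonneg)
    from *[OF this] cap G False show ?thesis by auto
  qed
qed

text \<open>If the value after the unit step exceeded $2 L$, some level between $2 L$ and \<open>G\<close> would be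
  reached on the way. Up to that point the curvature bound holds and the slope at 0 is at most
  \<open>L\<close>, so the value is at most $L/2 + L + L/2$.\<close>

lemma unit_step:
  assumes cap: "\<And>s. g s \<le> G \<Longrightarrow> g'' s \<le> L" and L: "0 < L" and g0: "g 0 \<le> L / 2"
    and G: "2 * L < G"
  shows "g 1 \<le> 2 * L"
proof (rule ccontr)
  assume up: "\<not> g 1 \<le> 2 * L"
  define c where "c = min G (g 1)"
  have c: "2 * L < c" "c \<le> G" "c \<le> g 1" using up G by (auto simp: c_def)
  obtain x where x: "0 \<le> x" "x \<le> 1" "g x = c"
    using IVT'[of g 0 c 1] c g0 L continuous_line by auto
  have g0G: "g 0 \<le> G" using g0 G L by simp
  have "g x \<le> g 0 + g' 0 * x + L / 2 * x\<^sup>2"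
  proof (rule taylor_upper[OF x(1)])
    fix s assume "0 \<le> s" "s \<le> x"
    then have "g s \<le> G" using le_max_ends[of s x] x c g0G by auto
    then show "g'' s \<le> L" by (rule cap)
  qed
  moreover have "g' 0 \<le> L"
  proof (rule power2_le_imp_le)
    have "(g' 0)\<^sup>2 \<le> 2 * L * g 0" by (rule slope_sq_le[OF cap g0G L])
    also have "\<dots> \<le> 2 * L * (L / 2)" using g0 L by (intro mult_left_mono) auto
    finally show "(g' 0)\<^sup>2 \<le> L\<^sup>2" by (simp add: power2_eq_square)
  qed (use L in simp)
  then have "g' 0 * x \<le> L * 1"
    using x L by (metis (no_types) mult_right_mono order_trans mult_left_mono less_imp_le)
  moreover have "L / 2 * x\<^sup>2 \<le> L / 2" using x L by (simp add: power_le_one)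
  ultimately show False using x c g0 by linarith
qed

end

section \<open>Calculus of the sum-exp dual\<close>

lemma sum_partition_on:
  fixes h :: "nat \<Rightarrow> real"
  assumes P: "partition_on {..<m} Bs"
  shows "(\<Sum>i<m. h i) = (\<Sum>B\<in>Bs. \<Sum>i\<in>B. h i)"
proof -
  have un: "\<Union>Bs = {..<m}" and disj: "disjoint Bs" using P by (auto simp: partition_on_def)
  have "\<forall>B\<in>Bs. finite B"
  proof
    fix B assume "B \<in> Bs"
    then have "B \<subseteq> {..<m}" using un by blast
    then show "finite B" by (rule finite_subset) simp
  qed
  then show ?thesis
    using sum.Union_disjoint[of Bs h] disj un by (auto simp: disjoint_def)
qed

locale sumexp_dual =
  fixes A :: "real mat" and b c :: "real vec" and \<gamma> :: real and m n :: nat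
  assumes A: "A \<in> carrier_mat m n" and b: "b \<in> carrier_vec m" and c: "c \<in> carrier_vec n"
    and \<gamma>: "0 < \<gamma>"
begin

abbreviation "f \<equiv> sumexp A b c \<gamma>"

definition response :: "real vec \<Rightarrow> nat \<Rightarrow> real" where
  "response u j = exp ((col A j \<bullet> u - c $ j) / \<gamma>)"

definition gradient :: "real vec \<Rightarrow> nat \<Rightarrow> real" where
  "gradient u i = - b $ i + (\<Sum>j<n. A $$ (i, j) * response u j)"

text \<open>The first and second derivatives of \<open>f\<close> at \<open>u\<close> in the direction \<open>d\<close>.\<close>
definition slope :: "real vec \<Rightarrow> real vec \<Rightarrow> real" where
  "slope u d = - (b \<bullet> d) + (\<Sum>j<n. (col A j \<bullet> d) * response u j)"

definition curvature :: "real vec \<Rightarrow> real vec \<Rightarrow> real" where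
  "curvature u d = (\<Sum>j<n. (col A j \<bullet> d)\<^sup>2 * response u j) / \<gamma>"

lemma response_pos: "0 < response u j"
  by (simp add: response_def)

lemma curvature_nonneg: "0 \<le> curvature u d"
  unfolding curvature_def using \<gamma> response_pos
  by (intro divide_nonneg_pos sum_nonneg mult_nonneg_nonneg) (auto simp: less_imp_le)

lemma dims [simp]: "dim_col A = n" "dim_row A = m" "dim_vec b = m" "dim_vec c = n"
  using A b c by auto

lemma col_carrier: "col A j \<in> carrier_vec m"
  using A by (simp add: carrier_vecI)

lemma col_line:
  assumes "u \<in> carrier_vec m" "d \<in> carrier_vec m"
  shows "col A j \<bullet> (u + t \<cdot>\<^sub>v d) = col A j \<bullet> u + t * (col A j \<bullet> d)"
  using assms col_carrier[of j] by (simp add: scalar_prod_add_distrib[of _ m])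

lemma response_line:
  assumes "u \<in> carrier_vec m" "d \<in> carrier_vec m"
  shows "((\<lambda>t. response (u + t \<cdot>\<^sub>v d) j) has_real_derivative
    (col A j \<bullet> d) * response (u + t \<cdot>\<^sub>v d) j / \<gamma>) (at t)"
  unfolding response_def col_line[OF assms]
  by (auto intro!: derivative_eq_intros simp: \<gamma> \<gamma>[THEN less_imp_neq, symmetric])

lemma smooth_line:
  assumes u: "u \<in> carrier_vec m" and d: "d \<in> carrier_vec m"
  shows "smooth_line (\<lambda>t. f (u + t \<cdot>\<^sub>v d) - C) (\<lambda>t. slope (u + t \<cdot>\<^sub>v d) d)
    (\<lambda>t. curvature (u + t \<cdot>\<^sub>v d) d)"
proof
  fix t
  have f: "f (u + t \<cdot>\<^sub>v d) = - (b \<bullet> u) - t * (b \<bullet> d) + \<gamma> * (\<Sum>j<n. response (u + t \<cdot>\<^sub>v d) j)" for t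
    unfolding sumexp_def response_def using u d b
    by (simp add: scalar_prod_add_distrib[of _ m])
  show "((\<lambda>t. f (u + t \<cdot>\<^sub>v d) - C) has_real_derivative slope (u + t \<cdot>\<^sub>v d) d) (at t)"
    unfolding f slope_def
    by (rule derivative_eq_intros response_line[OF u d] refl)+
      (use \<gamma> in \<open>simp add: sum_divide_distrib[symmetric]\<close>)
  show "((\<lambda>t. slope (u + t \<cdot>\<^sub>v d) d) has_real_derivative curvature (u + t \<cdot>\<^sub>v d) d) (at t)"
    unfolding slope_def curvature_def
    by (rule derivative_eq_intros response_line[OF u d] refl)+
      (simp add: sum_divide_distrib power2_eq_square mult_ac)
qed

lemma convex_line:
  assumes "u \<in> carrier_vec m" "d \<in> carrier_vec m"
  shows "convex_line (\<lambda>t. f (u + t \<cdot>\<^sub>v d) - C) (\<lambda>t. slope (u + t \<cdot>\<^sub>v d) d)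
    (\<lambda>t. curvature (u + t \<cdot>\<^sub>v d) d)"
  using smooth_line[OF assms] curvature_nonneg
  by (simp add: convex_line_def convex_line_axioms_def)

lemma at_zero [simp]:
  fixes u d :: "real vec"
  shows "u \<in> carrier_vec m \<Longrightarrow> d \<in> carrier_vec m \<Longrightarrow> u + 0 \<cdot>\<^sub>v d = u"
    and "u \<in> carrier_vec m \<Longrightarrow> d \<in> carrier_vec m \<Longrightarrow> u + 1 \<cdot>\<^sub>v d = u + d"
  by (auto intro!: eq_vecI)

lemma tangent_below:
  assumes u: "u \<in> carrier_vec m" and x: "x \<in> carrier_vec m"
  shows "f u + slope u (x - u) \<le> f x"
proof -
  have d: "x - u \<in> carrier_vec m" and e: "u + (x - u) = x"
    using u x by (auto intro!: eq_vecI)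
  show ?thesis
    using convex_line.tangent_below[OF convex_line[OF u d, of 0]] u d by (simp add: e)
qed

lemma unit_products:
  assumes i: "i < m"
  shows "b \<bullet> unit_vec m i = b $ i" "j < n \<Longrightarrow> col A j \<bullet> unit_vec m i = A $$ (i, j)"
  using i A b col_carrier[of j] by (simp_all add: scalar_prod_right_unit)

lemma gradient_eq_slope: "i < m \<Longrightarrow> gradient u i = slope u (unit_vec m i)"
  unfolding gradient_def slope_def by (simp add: unit_products)

lemma col_sum:
  "d \<in> carrier_vec m \<Longrightarrow> j < n \<Longrightarrow> col A j \<bullet> d = (\<Sum>i<m. A $$ (i, j) * d $ i)"
  using A by (auto simp: scalar_prod_def lessThan_atLeast0 intro!: sum.cong)

lemma slope_eq_sum:
  assumes d: "d \<in> carrier_vec m"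
  shows "slope u d = (\<Sum>i<m. d $ i * gradient u i)"
proof -
  have "(\<Sum>j<n. (col A j \<bullet> d) * response u j) =
        (\<Sum>j<n. \<Sum>i<m. d $ i * (A $$ (i, j) * response u j))"
    by (intro sum.cong refl) (simp add: col_sum[OF d] sum_distrib_left mult_ac)
  also have "\<dots> = (\<Sum>i<m. d $ i * (\<Sum>j<n. A $$ (i, j) * response u j))"
    by (subst sum.swap) (simp add: sum_distrib_left)
  finally have "slope u d = - (\<Sum>i<m. b $ i * d $ i) +
      (\<Sum>i<m. d $ i * (\<Sum>j<n. A $$ (i, j) * response u j))"
    using d by (simp add: slope_def scalar_prod_def lessThan_atLeast0)
  also have "\<dots> = (\<Sum>i<m. d $ i * gradient u i)"
    by (simp add: gradient_def sum_negf[symmetric] sum.distrib[symmetric] right_diff_distrib mult_ac)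
  finally show ?thesis .
qed

lemma partial_deriv_eq:
  assumes u: "u \<in> carrier_vec m" and i: "i < m"
  shows "partial_deriv f u i = gradient u i"
proof -
  have e: "unit_vec m i \<in> carrier_vec m" by simp
  interpret smooth_line "\<lambda>t. f (u + t \<cdot>\<^sub>v unit_vec m i) - 0" "\<lambda>t. slope (u + t \<cdot>\<^sub>v unit_vec m i) (unit_vec m i)"
    "\<lambda>t. curvature (u + t \<cdot>\<^sub>v unit_vec m i) (unit_vec m i)"
    by (rule smooth_line[OF u e])
  show ?thesis
    using DERIV_imp_deriv[OF g[of 0]] u i by (simp add: partial_deriv_def gradient_eq_slope)
qed

lemma hessian_eq:
  assumes u: "u \<in> carrier_vec m" and i: "i < m" and k: "k < m"
  shows "hessian f u i k = (\<Sum>j<n. A $$ (i, j) * A $$ (k, j) * response u j) / \<gamma>"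
proof -
  have e: "unit_vec m i \<in> carrier_vec m" by simp
  have eq: "partial_deriv f (u + t \<cdot>\<^sub>v unit_vec m i) k = gradient (u + t \<cdot>\<^sub>v unit_vec m i) k" for t
    using u k by (intro partial_deriv_eq) auto
  have "((\<lambda>t. gradient (u + t \<cdot>\<^sub>v unit_vec m i) k) has_real_derivative
    (\<Sum>j<n. A $$ (k, j) * ((col A j \<bullet> unit_vec m i) * response (u + 0 \<cdot>\<^sub>v unit_vec m i) j / \<gamma>))) (at 0)"
    unfolding gradient_def
    by (rule derivative_eq_intros response_line[OF u e] refl)+ (simp add: mult_ac)
  from DERIV_imp_deriv[OF this] show ?thesis
    using u i unfolding hessian_def partial_deriv_def[of "\<lambda>x. partial_deriv f x k"]
    by (simp add: eq unit_products sum_divide_distrib mult_ac)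
qed

definition restrict_vec :: "nat set \<Rightarrow> real vec \<Rightarrow> real vec" where
  "restrict_vec B d = vec m (\<lambda>i. if i \<in> B then d $ i else 0)"

lemma restrict_carrier [simp]: "restrict_vec B d \<in> carrier_vec m"
  by (simp add: restrict_vec_def)

lemma col_restrict:
  assumes "B \<subseteq> {..<m}" "j < n"
  shows "col A j \<bullet> restrict_vec B d = (\<Sum>i\<in>B. A $$ (i, j) * d $ i)"
proof -
  have "col A j \<bullet> restrict_vec B d = (\<Sum>i<m. if i \<in> B then A $$ (i, j) * d $ i else 0)"
    using assms A by (auto simp: scalar_prod_def restrict_vec_def lessThan_atLeast0 intro!: sum.cong)
  also have "\<dots> = (\<Sum>i\<in>B. A $$ (i, j) * d $ i)"
    using assms by (simp add: sum.inter_restrict[symmetric] Int_absorb1)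
  finally show ?thesis .
qed

lemma curvature_block:
  assumes u: "u \<in> carrier_vec m" and B: "B \<subseteq> {..<m}"
    and up: "loewner_on B (hessian f u) (\<lambda>i j. if i = j then L else 0)"
  shows "curvature u (restrict_vec B d) \<le> L * (\<Sum>i\<in>B. (d $ i)\<^sup>2)"
proof -
  have fin: "finite B" using B finite_subset by blast
  have sq: "(\<Sum>i\<in>B. x i * d $ i)\<^sup>2 * w / \<gamma> = (\<Sum>i\<in>B. \<Sum>k\<in>B. d $ i * (x i * x k * w / \<gamma>) * d $ k)"
    for x w
    unfolding power2_eq_square sum_product
    unfolding sum_distrib_right sum_divide_distrib
    by (intro sum.cong refl) (simp add: mult_ac)
  have "curvature u (restrict_vec B d) =
    (\<Sum>j<n. \<Sum>i\<in>B. \<Sum>k\<in>B. d $ i * (A $$ (i, j) * A $$ (k, j) * response u j / \<gamma>) * d $ k)"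
    unfolding curvature_def sum_divide_distrib using B
    by (intro sum.cong refl) (simp add: col_restrict sq)
  also have "\<dots> = (\<Sum>i\<in>B. \<Sum>k\<in>B. \<Sum>j<n. d $ i * (A $$ (i, j) * A $$ (k, j) * response u j / \<gamma>) * d $ k)"
    by (subst sum.swap, intro sum.cong[OF refl], rule sum.swap)
  also have "\<dots> = (\<Sum>i\<in>B. \<Sum>k\<in>B. d $ i * hessian f u i k * d $ k)"
  proof (intro sum.cong refl)
    fix i k assume "i \<in> B" "k \<in> B"
    then have "i < m" "k < m" using B by auto
    then show "(\<Sum>j<n. d $ i * (A $$ (i, j) * A $$ (k, j) * response u j / \<gamma>) * d $ k) =
        d $ i * hessian f u i k * d $ k"
      using u by (simp add: hessian_eq sum_divide_distrib sum_distrib_left sum_distrib_right)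
  qed
  finally have *: "curvature u (restrict_vec B d) = (\<Sum>i\<in>B. \<Sum>k\<in>B. d $ i * hessian f u i k * d $ k)" .
  have "0 \<le> (\<Sum>i\<in>B. \<Sum>k\<in>B. d $ i * ((if i = k then L else 0) - hessian f u i k) * d $ k)"
    using up unfolding loewner_on_def by blast
  also have "\<dots> = (\<Sum>i\<in>B. \<Sum>k\<in>B. d $ i * (if i = k then L else 0) * d $ k)
      - curvature u (restrict_vec B d)"
    unfolding * by (simp add: right_diff_distrib left_diff_distrib sum_subtractf)
  also have "(\<Sum>i\<in>B. \<Sum>k\<in>B. d $ i * (if i = k then L else 0) * d $ k) =
      (\<Sum>i\<in>B. \<Sum>k\<in>B. if i = k then L * (d $ i)\<^sup>2 else 0)"
    by (intro sum.cong refl) (auto simp: power2_eq_square)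
  also have "\<dots> = L * (\<Sum>i\<in>B. (d $ i)\<^sup>2)"
    using fin by (simp add: sum.delta sum_distrib_left)
  finally show ?thesis by simp
qed

text \<open>A positive semidefinite matrix is controlled by its diagonal blocks: writing the form as
  a sum of squares, Cauchy--Schwarz with weights $s_B$ gives
  $(\sum_B x_B)^2 \le (\sum_B s_B) \sum_B x_B^2 / s_B$, so the square roots of the block
  constants add up. A block with $s_B = 0$ contributes nothing because its form vanishes.\<close>

lemma curvature_le_blocks:
  assumes P: "partition_on {..<m} Bs" and s: "\<And>B. B \<in> Bs \<Longrightarrow> 0 \<le> s B"
    and d: "d \<in> carrier_vec m"
    and block: "\<And>B. B \<in> Bs \<Longrightarrow> curvature u (restrict_vec B d) \<le> (s B)\<^sup>2 * (\<Sum>i\<in>B. (d $ i)\<^sup>2)"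
  shows "curvature u d \<le> (\<Sum>B\<in>Bs. s B)\<^sup>2 * (d \<bullet> d)"
proof -
  have un: "\<Union>Bs = {..<m}" using P by (auto simp: partition_on_def)
  have fin: "finite Bs" using P finite_elements by blast
  have sub: "B \<subseteq> {..<m}" if "B \<in> Bs" for B using that un by blast
  note split = sum_partition_on[OF P]
  define M where "M = (\<Sum>B\<in>Bs. s B)"
  define x where "x B j = col A j \<bullet> restrict_vec B d" for B j
  have M: "0 \<le> M" using s by (auto simp: M_def sum_nonneg)
  have sM: "s B \<le> M" if "B \<in> Bs" for B
    unfolding M_def using that fin s by (intro member_le_sum) auto
  have x: "col A j \<bullet> d = (\<Sum>B\<in>Bs. x B j)" if "j < n" for j
  proof -
    have "col A j \<bullet> d = (\<Sum>i<m. A $$ (i, j) * d $ i)" by (rule col_sum[OF d that])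
    then show ?thesis unfolding split using sub that by (simp add: x_def col_restrict)
  qed
  have zero: "x B j = 0" if B: "B \<in> Bs" "s B = 0" and j: "j < n" for B j
  proof -
    have "curvature u (restrict_vec B d) \<le> 0" using block[OF B(1)] B(2) by simp
    then have "(\<Sum>j<n. (x B j)\<^sup>2 * response u j) \<le> 0"
      using \<gamma> by (simp add: curvature_def x_def divide_le_0_iff)
    moreover have "0 \<le> (\<Sum>j<n. (x B j)\<^sup>2 * response u j)"
      by (intro sum_nonneg mult_nonneg_nonneg) (auto simp: response_pos less_imp_le)
    ultimately have "(\<Sum>j<n. (x B j)\<^sup>2 * response u j) = 0" by linarith
    then have "(x B j)\<^sup>2 * response u j = 0"
      using j by (subst (asm) sum_nonneg_eq_0_iff) (auto intro!: mult_nonneg_nonneg simp: response_pos less_imp_le)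
    then show ?thesis using response_pos[of u j] by auto
  qed
  have cs: "(\<Sum>B\<in>Bs. x B j)\<^sup>2 \<le> M * (\<Sum>B\<in>Bs. (x B j)\<^sup>2 / s B)" if j: "j < n" for j
  proof -
    have "(\<Sum>B\<in>Bs. sqrt (s B) * (x B j / sqrt (s B)))\<^sup>2 \<le>
        (\<Sum>B\<in>Bs. (sqrt (s B))\<^sup>2) * (\<Sum>B\<in>Bs. (x B j / sqrt (s B))\<^sup>2)"
      by (rule Cauchy_Schwarz_ineq_sum)
    also have "(\<Sum>B\<in>Bs. sqrt (s B) * (x B j / sqrt (s B))) = (\<Sum>B\<in>Bs. x B j)"
      using zero j by (intro sum.cong) auto
    also have "(\<Sum>B\<in>Bs. (sqrt (s B))\<^sup>2) = M" using s by (simp add: M_def)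
    also have "(\<Sum>B\<in>Bs. (x B j / sqrt (s B))\<^sup>2) = (\<Sum>B\<in>Bs. (x B j)\<^sup>2 / s B)"
      using s by (intro sum.cong) (auto simp: power_divide)
    finally show ?thesis .
  qed
  have "curvature u d \<le> (\<Sum>j<n. M * (\<Sum>B\<in>Bs. (x B j)\<^sup>2 / s B) * response u j) / \<gamma>"
    unfolding curvature_def using cs x \<gamma>
    by (intro divide_right_mono sum_mono mult_right_mono) (auto simp: response_pos less_imp_le)
  also have "\<dots> = (\<Sum>j<n. \<Sum>B\<in>Bs. M * ((x B j)\<^sup>2 * response u j / \<gamma> / s B))"
    unfolding sum_divide_distrib sum_distrib_left sum_distrib_right
    by (intro sum.cong refl) (simp add: mult_ac)
  also have "\<dots> = M * (\<Sum>B\<in>Bs. curvature u (restrict_vec B d) / s B)"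
    unfolding curvature_def x_def sum_divide_distrib sum_distrib_left by (rule sum.swap)
  also have "\<dots> \<le> M * (\<Sum>B\<in>Bs. M * (\<Sum>i\<in>B. (d $ i)\<^sup>2))"
  proof (intro mult_left_mono sum_mono M)
    fix B assume B: "B \<in> Bs"
    have n: "0 \<le> (\<Sum>i\<in>B. (d $ i)\<^sup>2)" by (simp add: sum_nonneg)
    show "curvature u (restrict_vec B d) / s B \<le> M * (\<Sum>i\<in>B. (d $ i)\<^sup>2)"
    proof (cases "s B = 0")
      case True
      then show ?thesis using M n by simp
    next
      case False
      then have pos: "0 < s B" using s[OF B] by simp
      have "curvature u (restrict_vec B d) / s B \<le> s B * (\<Sum>i\<in>B. (d $ i)\<^sup>2)"
        using block[OF B] pos by (simp add: field_simps power2_eq_square)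
      also have "\<dots> \<le> M * (\<Sum>i\<in>B. (d $ i)\<^sup>2)" using sM[OF B] n by (rule mult_right_mono)
      finally show ?thesis .
    qed
  qed
  also have "\<dots> = M\<^sup>2 * (\<Sum>i<m. (d $ i)\<^sup>2)"
    unfolding split by (simp add: sum_distrib_left[symmetric] power2_eq_square mult.assoc)
  also have "(\<Sum>i<m. (d $ i)\<^sup>2) = d \<bullet> d"
    using d by (simp add: scalar_prod_def lessThan_atLeast0 power2_eq_square)
  finally show ?thesis by (simp add: M_def)
qed

end

section \<open>Finitely supported distributions and block sampling\<close>

lemma expectation_bind_finite:
  fixes h :: "'b \<Rightarrow> real"
  assumes "finite (set_pmf p)" "\<And>x. x \<in> set_pmf p \<Longrightarrow> finite (set_pmf (k x))"
  shows "measure_pmf.expectation (p \<bind> k) h =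
    measure_pmf.expectation p (\<lambda>x. measure_pmf.expectation (k x) h)"
  using assms
  by (subst pmf_expectation_bind[of "set_pmf p"]) (auto simp: integral_measure_pmf[of "set_pmf p"])

lemma expectation_mono_finite:
  fixes g h :: "'a \<Rightarrow> real"
  assumes "finite (set_pmf p)" "\<And>x. x \<in> set_pmf p \<Longrightarrow> g x \<le> h x"
  shows "measure_pmf.expectation p g \<le> measure_pmf.expectation p h"
  using assms by (intro integral_mono_AE) (auto simp: AE_measure_pmf_iff integrable_measure_pmf_finite)

lemma expectation_add_finite:
  fixes g h :: "'a \<Rightarrow> real"
  assumes "finite (set_pmf p)"
  shows "measure_pmf.expectation p (\<lambda>x. g x + h x) =
    measure_pmf.expectation p g + measure_pmf.expectation p h"
  using assms by (intro Bochner_Integration.integral_add integrable_measure_pmf_finite)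

lemma pmf_block_pmf:
  assumes w: "\<And>B. B \<in> set bs \<Longrightarrow> 0 \<le> w B" and pos: "0 < root_sum bs w"
  shows "pmf (block_pmf bs w) B = (if B \<in> set bs then sqrt (w B) / root_sum bs w else 0)"
  unfolding block_pmf_def
proof (rule pmf_embed_pmf)
  show "0 \<le> (if B \<in> set bs then sqrt (w B) / root_sum bs w else 0)" for B
    using w pos by simp
  have "(\<integral>\<^sup>+ B. ennreal (if B \<in> set bs then sqrt (w B) / root_sum bs w else 0) \<partial>count_space UNIV)
    = (\<Sum>B\<in>set bs. ennreal (if B \<in> set bs then sqrt (w B) / root_sum bs w else 0))"
    by (rule nn_integral_count_space') auto
  also have "\<dots> = ennreal (\<Sum>B\<in>set bs. sqrt (w B) / root_sum bs w)"
    using w pos by (subst sum_ennreal[symmetric]) (auto intro!: sum.cong)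
  also have "\<dots> = 1"
    using pos by (simp add: sum_divide_distrib[symmetric] root_sum_def[symmetric])
  finally show "(\<integral>\<^sup>+ B. ennreal (if B \<in> set bs then sqrt (w B) / root_sum bs w else 0)
      \<partial>count_space UNIV) = 1" .
qed

section \<open>The scalars of a phase\<close>

locale phase =
  fixes P :: phase_input
  assumes kappa: "\<And>B. B \<in> set (blocks P) \<Longrightarrow> 0 \<le> kappa P B"
    and nu: "\<And>B. B \<in> set (blocks P) \<Longrightarrow> 0 \<le> nu P B"
    and C0: "0 < C0 P" and radius: "0 < radius P" and gap_bound: "0 < gap_bound P"
    and level: "0 < level P"
begin

lemma C1: "0 \<le> C1 P"
  using nu by (rule root_sum_nonneg)

lemma Pi_pos: "0 < Pi_budget P"
  using radius level by (simp add: Pi_budget_def)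

lemma Delta_pos: "0 < T \<Longrightarrow> 0 < Delta_at P T"
  using Pi_pos by (simp add: Delta_at_def)

lemma M_ge_C0: "0 < T \<Longrightarrow> C0 P \<le> M_at P T"
  using C1 Delta_pos[of T] by (simp add: M_at_def)

lemma M_pos: "0 < T \<Longrightarrow> 0 < M_at P T"
  using M_ge_C0 C0 by (meson less_le_trans)

lemma incr:
  assumes "0 < T"
  shows "0 < incr_at P T" "(M_at P T)\<^sup>2 * (incr_at P T)\<^sup>2 = T + incr_at P T"
  using incr_at_eq(2,3)[OF M_pos[OF assms]] assms by auto

lemma T_seq_pos: "0 < T_seq P k"
proof (induction k)
  case 0
  show ?case using radius gap_bound by (simp add: T_init_def)
next
  case (Suc k)
  then show ?case using incr(1)[OF Suc] by simp
qed

lemma root_L_nonneg: "0 < T \<Longrightarrow> B \<in> set (blocks P) \<Longrightarrow> 0 \<le> root_L_at P T B"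
  using kappa nu Delta_pos[of T] by (simp add: root_L_at_def)

lemma sum_root_L: "0 < T \<Longrightarrow> (\<Sum>B\<in>set (blocks P). root_L_at P T B) = M_at P T"
  unfolding root_L_at_def M_at_def root_sum_def
  by (simp add: sum.distrib real_sqrt_mult sum_distrib_left sum_distrib_right algebra_simps)

lemma pmf_draw_block:
  assumes T: "0 < T"
  shows "pmf (draw_block P T) B = (if B \<in> set (blocks P) then prob_at P T B else 0)"
proof -
  define M where "M = M_at P T"
  define s where "s = sqrt (5 * Delta_at P T)"
  have M: "0 < M" "C0 P \<le> M" "M = C0 P + s * C1 P"
    using M_pos[OF T] M_ge_C0[OF T] by (auto simp: M_def s_def M_at_def)
  have p: "0 \<le> C0 P / M" "C0 P / M \<le> 1" using M C0 by auto
  have "pmf (draw_block P T) B = C0 P / M * pmf (block_pmf (blocks P) (kappa P)) B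
      + (1 - C0 P / M) * pmf (block_pmf (blocks P) (nu P)) B"
    unfolding draw_block_def M_def[symmetric] pmf_bind
    using p by (subst integral_bernoulli_pmf) auto
  also have "1 - C0 P / M = s * C1 P / M"
    using M by (simp add: field_simps)
  also have "s * C1 P / M * pmf (block_pmf (blocks P) (nu P)) B =
      (if B \<in> set (blocks P) then s * sqrt (nu P B) / M else 0)"
  proof (cases "C1 P = 0")
    case True
    then have "\<forall>B\<in>set (blocks P). sqrt (nu P B) = 0"
      unfolding root_sum_def using nu by (subst (asm) sum_nonneg_eq_0_iff) auto
    then show ?thesis using True by simp
  next
    case False
    then have "0 < C1 P" using C1 by simp
    then show ?thesis using pmf_block_pmf[OF nu] by simp
  qed
  also have "C0 P / M * pmf (block_pmf (blocks P) (kappa P)) B =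
      (if B \<in> set (blocks P) then sqrt (kappa P B) / M else 0)"
    using pmf_block_pmf[OF kappa] C0 by simp
  also have "(if B \<in> set (blocks P) then sqrt (kappa P B) / M else 0) +
      (if B \<in> set (blocks P) then s * sqrt (nu P B) / M else 0) =
      (if B \<in> set (blocks P) then prob_at P T B else 0)"
    by (simp add: prob_at_def root_L_at_def M_def[symmetric] s_def add_divide_distrib
        real_sqrt_mult algebra_simps)
  finally show ?thesis .
qed

lemma set_draw_block:
  assumes "0 < T" "B \<in> set_pmf (draw_block P T)"
  shows "B \<in> set (blocks P)" "0 < prob_at P T B"
  using assms pmf_draw_block[OF assms(1), of B] pmf_positive[OF assms(2)]
  by (auto split: if_splits)

lemma finite_draw_block: "0 < T \<Longrightarrow> finite (set_pmf (draw_block P T))"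
  using set_draw_block(1) by (meson List.finite_set finite_subset subsetI)

lemma expectation_draw_block:
  fixes h :: "nat set \<Rightarrow> real"
  assumes "0 < T"
  shows "measure_pmf.expectation (draw_block P T) h = (\<Sum>B\<in>set (blocks P). prob_at P T B * h B)"
  using set_draw_block(1)[OF assms]
  by (subst integral_measure_pmf[of "set (blocks P)"])
    (auto simp: pmf_draw_block[OF assms] intro!: sum.cong)

end

section \<open>The potential of one accelerated step\<close>

lemma gap_eq_diff:
  assumes "is_arg_min f (\<lambda>u. u \<in> carrier_vec m) us"
  shows "gap m f u = f u - f us"
proof -
  have "(INF x\<in>carrier_vec m. f x) = f us"
    using assms by (intro cInf_eq_minimum) (auto simp: is_arg_min_def not_less)
  then show ?thesis by (simp add: gap_def)
qed

locale sumexp_phase = sumexp_dual A b c \<gamma> m n + phase P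
  for A b c \<gamma> m n and P :: phase_input +
  fixes us :: "real vec" and rule :: rule
  assumes partition: "partition_on {..<m} (set (blocks P))"
    and smooth: "\<And>u B. u \<in> carrier_vec m \<Longrightarrow> B \<in> set (blocks P) \<Longrightarrow>
      loewner_on B (hessian f u) (\<lambda>i j. if i = j then kappa P B + nu P B * gap m f u else 0)"
    and anchor: "anchor P \<in> carrier_vec m" and anchor_gap: "gap m f (anchor P) \<le> gap_bound P"
    and us: "is_arg_min f (\<lambda>u. u \<in> carrier_vec m) us"
    and near: "norm2 (anchor P - us) \<le> radius P"
    and rule: "admissible_rule f P rule"
begin

abbreviation "F \<equiv> gap m f"

lemma us_carrier: "us \<in> carrier_vec m"
  using us by (simp add: is_arg_min_def)

lemma gap_eq: "F u = f u - f us"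
  by (rule gap_eq_diff[OF us])

lemma gap_nonneg: "u \<in> carrier_vec m \<Longrightarrow> 0 \<le> F u"
  using us by (auto simp: gap_eq is_arg_min_def not_less)

lemma gap_line:
  assumes "u \<in> carrier_vec m" "d \<in> carrier_vec m"
  shows "nonneg_convex_line (\<lambda>t. F (u + t \<cdot>\<^sub>v d)) (\<lambda>t. slope (u + t \<cdot>\<^sub>v d) d)
    (\<lambda>t. curvature (u + t \<cdot>\<^sub>v d) d)"
  using convex_line[OF assms, of "f us"] assms
  by (simp add: nonneg_convex_line_def nonneg_convex_line_axioms_def gap_eq[symmetric] gap_nonneg)

lemma block_subset: "B \<in> set (blocks P) \<Longrightarrow> B \<subseteq> {..<m}"
  using partition by (auto simp: partition_on_def)

lemma block_grad_index:
  assumes "y \<in> carrier_vec m" "i < m"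
  shows "block_grad f B y $ i = (if i \<in> B then gradient y i else 0)"
  using assms by (simp add: block_grad_def partial_deriv_eq)

lemma block_grad_carrier: "y \<in> carrier_vec m \<Longrightarrow> block_grad f B y \<in> carrier_vec m"
  by (auto simp: block_grad_def)

definition grad_sq :: "real vec \<Rightarrow> nat set \<Rightarrow> real" where
  "grad_sq y B = (\<Sum>i\<in>B. (gradient y i)\<^sup>2)"

lemma grad_sq_nonneg: "0 \<le> grad_sq y B"
  by (simp add: grad_sq_def sum_nonneg)

lemma sum_block:
  fixes h :: "nat \<Rightarrow> real"
  assumes "B \<in> set (blocks P)"
  shows "(\<Sum>i<m. if i \<in> B then h i else 0) = (\<Sum>i\<in>B. h i)"
  using block_subset[OF assms] by (simp add: sum.inter_restrict[symmetric] Int_absorb1)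

lemma slope_block_grad:
  assumes y: "y \<in> carrier_vec m" and B: "B \<in> set (blocks P)"
  shows "slope y (s \<cdot>\<^sub>v block_grad f B y) = s * grad_sq y B"
proof -
  have d: "s \<cdot>\<^sub>v block_grad f B y \<in> carrier_vec m"
    using block_grad_carrier[OF y] by simp
  have "slope y (s \<cdot>\<^sub>v block_grad f B y) = (\<Sum>i<m. if i \<in> B then s * (gradient y i)\<^sup>2 else 0)"
    unfolding slope_eq_sum[OF d]
    using block_grad_carrier[OF y, of B]
    by (intro sum.cong refl) (auto simp: block_grad_index[OF y] power2_eq_square)
  then show ?thesis by (simp add: sum_block[OF B] grad_sq_def sum_distrib_left)
qed

lemma cap_le:
  assumes "0 < T" "B \<in> set (blocks P)" "F u \<le> 5 * Delta_at P T"
  shows "kappa P B + nu P B * F u \<le> (root_L_at P T B)\<^sup>2"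
proof -
  have n: "0 \<le> kappa P B" "0 \<le> nu P B" "0 \<le> nu P B * (5 * Delta_at P T)"
    using assms kappa nu Delta_pos[of T] by auto
  have "nu P B * F u \<le> nu P B * (5 * Delta_at P T)"
    using n assms by (intro mult_left_mono)
  moreover have "0 \<le> 2 * sqrt (kappa P B) * sqrt (nu P B * (5 * Delta_at P T))"
    using n by (intro mult_nonneg_nonneg) auto
  moreover have "5 * nu P B * Delta_at P T = nu P B * (5 * Delta_at P T)" by simp
  ultimately show ?thesis
    unfolding root_L_at_def power2_sum by (simp only: real_sqrt_pow2[OF n(1)] real_sqrt_pow2[OF n(3)])
qed

lemma curvature_grad_le:
  assumes T: "0 < T" and B: "B \<in> set (blocks P)" and x: "x \<in> carrier_vec m"
    and y: "y \<in> carrier_vec m" and low: "F x \<le> 5 * Delta_at P T"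
  shows "curvature x ((- 1) \<cdot>\<^sub>v block_grad f B y) \<le> (root_L_at P T B)\<^sup>2 * grad_sq y B"
proof -
  let ?d = "(- 1) \<cdot>\<^sub>v block_grad f B y"
  have d: "restrict_vec B ?d = ?d"
    using block_grad_carrier[OF y, of B] y
    by (auto simp: restrict_vec_def block_grad_index intro!: eq_vecI)
  have "curvature x (restrict_vec B ?d) \<le> (kappa P B + nu P B * F x) * (\<Sum>i\<in>B. (?d $ i)\<^sup>2)"
    by (rule curvature_block[OF x block_subset[OF B] smooth[OF x B]])
  also have "(\<Sum>i\<in>B. (?d $ i)\<^sup>2) = grad_sq y B"
    unfolding grad_sq_def using block_subset[OF B] block_grad_carrier[OF y, of B] y
    by (intro sum.cong refl) (auto simp: block_grad_index subset_iff)
  also have "(kappa P B + nu P B * F x) * grad_sq y B \<le> (root_L_at P T B)\<^sup>2 * grad_sq y B"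
    using cap_le[OF T B low] grad_sq_nonneg by (rule mult_right_mono)
  finally show ?thesis by (simp add: d)
qed

text \<open>Along the negative block gradient the slope is $-q$ and the curvature at most $\bar L_B q$,
  where $q$ is the squared norm of the block gradient, so the step $1 / \bar L_B$ is the longest
  one that \<open>descent\<close> covers.\<close>
lemma block_descent:
  assumes T: "0 < T" and B: "B \<in> set (blocks P)" and y: "y \<in> carrier_vec m"
    and low: "F y \<le> 5 * Delta_at P T" and L: "0 < root_L_at P T B"
  shows "F (y - (1 / (root_L_at P T B)\<^sup>2) \<cdot>\<^sub>v block_grad f B y)
    \<le> F y - grad_sq y B / (2 * (root_L_at P T B)\<^sup>2)"
proof -
  define L where "L = (root_L_at P T B)\<^sup>2"
  let ?d = "(- 1) \<cdot>\<^sub>v block_grad f B y"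
  have L0: "0 < L" using L by (simp add: L_def)
  have d: "?d \<in> carrier_vec m" using block_grad_carrier[OF y] by simp
  interpret nonneg_convex_line "\<lambda>t. F (y + t \<cdot>\<^sub>v ?d)" "\<lambda>t. slope (y + t \<cdot>\<^sub>v ?d) ?d"
    "\<lambda>t. curvature (y + t \<cdot>\<^sub>v ?d) ?d" by (rule gap_line[OF y d])
  have step: "y - (1 / L) \<cdot>\<^sub>v block_grad f B y = y + (1 / L) \<cdot>\<^sub>v ?d"
    using y block_grad_carrier[OF y, of B] by (intro eq_vecI) auto
  have slope0: "slope (y + 0 \<cdot>\<^sub>v ?d) ?d = - grad_sq y B"
    unfolding at_zero(1)[OF y d] slope_block_grad[OF y B] by simp
  have F0: "F (y + 0 \<cdot>\<^sub>v ?d) = F y" unfolding at_zero(1)[OF y d] ..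
  show ?thesis
  proof (cases "grad_sq y B = 0")
    case True
    then have "\<forall>i\<in>B. gradient y i = 0"
      using finite_subset[OF block_subset[OF B]]
      by (auto simp: grad_sq_def sum_nonneg_eq_0_iff)
    then have "y + (1 / L) \<cdot>\<^sub>v ?d = y"
      using y block_grad_carrier[OF y, of B] by (intro eq_vecI) (auto simp: block_grad_index)
    then show ?thesis using True by (simp add: step[unfolded L_def] L_def)
  next
    case False
    then have q: "0 < grad_sq y B" using grad_sq_nonneg[of y B] by simp
    have "F (y + (1 / L) \<cdot>\<^sub>v ?d) \<le> F (y + 0 \<cdot>\<^sub>v ?d) + slope (y + 0 \<cdot>\<^sub>v ?d) ?d * (1 / L)
        + L * grad_sq y B / 2 * (1 / L)\<^sup>2"
    proof (rule descent[where G = "5 * Delta_at P T"])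
      show "curvature (y + s \<cdot>\<^sub>v ?d) ?d \<le> L * grad_sq y B"
        if "F (y + s \<cdot>\<^sub>v ?d) \<le> 5 * Delta_at P T" for s
        unfolding L_def using that y d by (intro curvature_grad_le T B) auto
    qed (use L0 q low in \<open>auto simp: slope0 F0\<close>)
    also have "\<dots> = F y - grad_sq y B / (2 * L)"
      unfolding slope0 F0 using L0 by (simp add: power2_eq_square field_simps)
    finally show ?thesis by (simp add: step[unfolded L_def] L_def)
  qed
qed

text \<open>Blocks that are never drawn must not be missed: along such a block the function is affine
  on the sublevel set and bounded below, so its partial gradient vanishes.\<close>

lemma gradient_undrawn:
  assumes T: "0 < T" and B: "B \<in> set (blocks P)" and y: "y \<in> carrier_vec m"
    and low: "F y \<le> 5 * Delta_at P T" and L: "root_L_at P T B = 0" and i: "i \<in> B"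
  shows "gradient y i = 0"
proof -
  let ?d = "(- 1) \<cdot>\<^sub>v block_grad f B y"
  have d: "?d \<in> carrier_vec m" using block_grad_carrier[OF y] by simp
  interpret nonneg_convex_line "\<lambda>t. F (y + t \<cdot>\<^sub>v ?d)" "\<lambda>t. slope (y + t \<cdot>\<^sub>v ?d) ?d"
    "\<lambda>t. curvature (y + t \<cdot>\<^sub>v ?d) ?d" by (rule gap_line[OF y d])
  have *: "(grad_sq y B)\<^sup>2 \<le> 2 * e * F y" if e: "0 < e" for e
  proof -
    have "(slope (y + 0 \<cdot>\<^sub>v ?d) ?d)\<^sup>2 \<le> 2 * e * F (y + 0 \<cdot>\<^sub>v ?d)"
    proof (rule slope_sq_le[where G = "5 * Delta_at P T"])
      show "curvature (y + s \<cdot>\<^sub>v ?d) ?d \<le> e" if "F (y + s \<cdot>\<^sub>v ?d) \<le> 5 * Delta_at P T" for s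
        using curvature_grad_le[OF T B _ y that] y d L e by simp
    qed (use low e in \<open>auto simp only: at_zero(1)[OF y d]\<close>)
    then show ?thesis unfolding at_zero(1)[OF y d] slope_block_grad[OF y B] by simp
  qed
  have "(grad_sq y B)\<^sup>2 \<le> 0"
  proof (rule field_le_epsilon)
    fix e :: real assume e: "0 < e"
    have F: "0 \<le> F y" by (rule gap_nonneg[OF y])
    have "(grad_sq y B)\<^sup>2 \<le> 2 * (e / (2 * (F y + 1))) * F y" using e F by (intro *) simp
    also have "\<dots> \<le> 0 + e" using e F by (simp add: field_simps)
    finally show "(grad_sq y B)\<^sup>2 \<le> 0 + e" .
  qed
  then have "grad_sq y B = 0" by simp
  then show ?thesis
    using i finite_subset[OF block_subset[OF B]] by (auto simp: grad_sq_def sum_nonneg_eq_0_iff)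
qed

definition mix :: "real \<Rightarrow> real \<Rightarrow> real vec \<Rightarrow> real vec \<Rightarrow> real vec" where
  "mix T a u v = (1 / (T + a)) \<cdot>\<^sub>v (T \<cdot>\<^sub>v u + a \<cdot>\<^sub>v v)"

lemma mix_carrier: "u \<in> carrier_vec m \<Longrightarrow> v \<in> carrier_vec m \<Longrightarrow> mix T a u v \<in> carrier_vec m"
  by (simp add: mix_def)

lemma mix_index:
  "u \<in> carrier_vec m \<Longrightarrow> v \<in> carrier_vec m \<Longrightarrow> i < m \<Longrightarrow>
    mix T a u v $ i = (T * u $ i + a * v $ i) / (T + a)"
  by (simp add: mix_def)

text \<open>The estimate-sequence inequality: the two tangents at \<open>y\<close>, towards \<open>u\<close> and towards \<open>x\<close>,
  combine because $T (u - y) = - a (v - y)$.\<close>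

lemma mix_tangents:
  assumes u: "u \<in> carrier_vec m" and v: "v \<in> carrier_vec m" and x: "x \<in> carrier_vec m"
    and T: "0 < T" and a: "0 < a"
  defines "y \<equiv> mix T a u v"
  shows "(T + a) * F y - a * slope y (v - x) \<le> T * F u + a * F x"
proof -
  have y: "y \<in> carrier_vec m" using u v by (simp add: y_def mix_carrier)
  have "T * slope y (u - y) + a * slope y (x - y) + a * slope y (v - x) = 0"
  proof -
    have "T * (u $ i - y $ i) + a * (x $ i - y $ i) + a * (v $ i - x $ i) = 0" if "i < m" for i
    proof -
      have "(T + a) * y $ i = T * u $ i + a * v $ i"
        using that u v T a by (simp add: y_def mix_index)
      then show ?thesis by (simp add: algebra_simps)
    qed
    then have "(\<Sum>i<m. (T * (u $ i - y $ i) + a * (x $ i - y $ i) + a * (v $ i - x $ i))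
        * gradient y i) = 0" by simp
    then show ?thesis
      using u v x y
      by (simp add: slope_eq_sum minus_carrier_vec sum_distrib_left sum.distrib[symmetric]
          distrib_right mult.assoc)
  qed
  moreover have "T * (f y + slope y (u - y)) \<le> T * f u" "a * (f y + slope y (x - y)) \<le> a * f x"
    using tangent_below[OF y u] tangent_below[OF y x] T a by auto
  ultimately show ?thesis by (simp add: gap_eq algebra_simps)
qed

definition dist2 :: "real vec \<Rightarrow> real" where
  "dist2 v = (\<Sum>i<m. (v $ i - us $ i)\<^sup>2)"

definition potential :: "real \<Rightarrow> real vec \<Rightarrow> real vec \<Rightarrow> real" where
  "potential T u v = T * F u + dist2 v / 2"

lemma dist2_nonneg: "0 \<le> dist2 v"
  by (simp add: dist2_def sum_nonneg)

lemma potential_nonneg: "0 < T \<Longrightarrow> u \<in> carrier_vec m \<Longrightarrow> 0 \<le> potential T u v"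
  by (simp add: potential_def gap_nonneg dist2_nonneg)

text \<open>While the potential is within its budget, the extrapolated point stays in the sublevel
  set that defines the step sizes. It lies at distance
  $a\,\lVert v - u^\star\rVert / (T + a)$ from the same combination of \<open>u\<close> and
  $u^\star$, whose value is at most $D = \Pi / (T + a)$; the choice $M^2 a^2 = T + a$ makes
  the curvature of the connecting segment at most $2 D$, so a unit step reaches at most
  $4 D < 5 \Delta$.\<close>

lemma gap_mix_le:
  assumes T: "0 < T" and u: "u \<in> carrier_vec m" and v: "v \<in> carrier_vec m"
    and budget: "potential T u v \<le> Pi_budget P"
  shows "F (mix T (incr_at P T) u v) \<le> 5 * Delta_at P T"
proof -
  define a where "a = incr_at P T"
  define D where "D = Pi_budget P / (T + a)"
  define p where "p = mix T a u us"
  define d where "d = (a / (T + a)) \<cdot>\<^sub>v (v - us)"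
  have a: "0 < a" "(M_at P T)\<^sup>2 * a\<^sup>2 = T + a" using incr[OF T] by (auto simp: a_def)
  have p: "p \<in> carrier_vec m" and d: "d \<in> carrier_vec m"
    using u v us_carrier by (auto simp: p_def d_def mix_carrier)
  have D: "0 < D" using Pi_pos T a by (simp add: D_def)
  have DD: "D \<le> Delta_at P T"
    unfolding D_def Delta_at_def using Pi_pos T a by (intro divide_left_mono) auto
  have pd: "p + 1 \<cdot>\<^sub>v d = mix T a u v"
    using u v us_carrier T a p d
    by (intro eq_vecI) (auto simp: p_def d_def mix_index mix_def add_divide_distrib
        diff_divide_distrib right_diff_distrib distrib_left)
  interpret nonneg_convex_line "\<lambda>t. F (p + t \<cdot>\<^sub>v d)" "\<lambda>t. slope (p + t \<cdot>\<^sub>v d) d"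
    "\<lambda>t. curvature (p + t \<cdot>\<^sub>v d) d" by (rule gap_line[OF p d])
  have zero: "us - us = 0\<^sub>v m" using us_carrier by auto
  have "slope p (us - us) = 0"
    unfolding zero slope_eq_sum[OF zero_carrier_vec] by simp
  then have "(T + a) * F p \<le> T * F u"
    using mix_tangents[OF u us_carrier us_carrier T a(1)] by (simp add: p_def gap_eq[of us])
  also have "\<dots> \<le> Pi_budget P" using budget dist2_nonneg[of v] by (simp add: potential_def)
  finally have Fp: "F p \<le> D" using T a by (simp add: D_def field_simps)
  have d2: "d \<bullet> d = (a / (T + a))\<^sup>2 * dist2 v"
    using v us_carrier unfolding d_def dist2_def
    by (simp add: scalar_prod_def lessThan_atLeast0 sum_distrib_left power2_eq_square mult_ac)
  have cap: "curvature (p + s \<cdot>\<^sub>v d) d \<le> 2 * D" if low: "F (p + s \<cdot>\<^sub>v d) \<le> 5 * Delta_at P T" for s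
  proof -
    let ?x = "p + s \<cdot>\<^sub>v d"
    have x: "?x \<in> carrier_vec m" using p d by simp
    have "curvature ?x d \<le> (\<Sum>B\<in>set (blocks P). root_L_at P T B)\<^sup>2 * (d \<bullet> d)"
    proof (rule curvature_le_blocks[OF partition _ d])
      fix B assume B: "B \<in> set (blocks P)"
      show "0 \<le> root_L_at P T B" by (rule root_L_nonneg[OF T B])
      have "curvature ?x (restrict_vec B d) \<le> (kappa P B + nu P B * F ?x) * (\<Sum>i\<in>B. (d $ i)\<^sup>2)"
        by (rule curvature_block[OF x block_subset[OF B] smooth[OF x B]])
      also have "\<dots> \<le> (root_L_at P T B)\<^sup>2 * (\<Sum>i\<in>B. (d $ i)\<^sup>2)"
        using cap_le[OF T B low] by (intro mult_right_mono sum_nonneg) auto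
      finally show "curvature ?x (restrict_vec B d) \<le> (root_L_at P T B)\<^sup>2 * (\<Sum>i\<in>B. (d $ i)\<^sup>2)" .
    qed
    also have "\<dots> = ((M_at P T)\<^sup>2 * a\<^sup>2) / (T + a)\<^sup>2 * dist2 v"
      by (simp add: sum_root_L[OF T] d2 power_divide)
    also have "\<dots> = dist2 v / (T + a)" unfolding a(2) using T a by (simp add: power2_eq_square)
    also have "\<dots> \<le> 2 * Pi_budget P / (T + a)"
    proof (intro divide_right_mono)
      have "0 \<le> T * F u" using gap_nonneg[OF u] T by simp
      then show "dist2 v \<le> 2 * Pi_budget P" using budget unfolding potential_def by linarith
    qed (use T a in simp)
    finally show ?thesis by (simp add: D_def)
  qed
  have "F (p + 1 \<cdot>\<^sub>v d) \<le> 2 * (2 * D)"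
  proof (rule unit_step[where G = "5 * Delta_at P T"])
    show "F (p + 0 \<cdot>\<^sub>v d) \<le> 2 * D / 2" using Fp unfolding at_zero(1)[OF p d] by simp
    show "2 * (2 * D) < 5 * Delta_at P T" using D DD by simp
  qed (use cap D in auto)
  also have "\<dots> \<le> 5 * Delta_at P T" using D DD by simp
  finally show ?thesis unfolding pd a_def .
qed

end

section \<open>Success probability of a phase and of its repetitions\<close>

lemma best_of_le:
  shows "f (best_of f z us) \<le> f z" and "u \<in> set us \<Longrightarrow> f (best_of f z us) \<le> f u"
  unfolding best_of_def by (induction us rule: rev_induct) (auto intro: order_trans)

lemma finite_replicate_pmf: "finite (set_pmf p) \<Longrightarrow> finite (set_pmf (replicate_pmf J p))"
  by (induction J) auto

lemma expectation_prod_replicate: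
  fixes h :: "'a \<Rightarrow> real"
  assumes "finite (set_pmf p)"
  shows "measure_pmf.expectation (replicate_pmf J p) (\<lambda>xs. prod_list (map h xs)) =
    measure_pmf.expectation p h ^ J"
proof (induction J)
  case (Suc J)
  have fin: "finite (set_pmf (replicate_pmf J p))" by (rule finite_replicate_pmf[OF assms])
  have "measure_pmf.expectation (replicate_pmf (Suc J) p) (\<lambda>xs. prod_list (map h xs)) =
    measure_pmf.expectation p (\<lambda>x. measure_pmf.expectation (replicate_pmf J p)
      (\<lambda>xs. h x * prod_list (map h xs)))"
    by (simp add: expectation_bind_finite assms fin)
  then show ?case by (simp add: Suc.IH)
qed simp

context sumexp_phase
begin

lemma dist2_step:
  assumes v: "v \<in> carrier_vec m" and y: "y \<in> carrier_vec m" and B: "B \<in> set (blocks P)"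
  shows "dist2 (v - s \<cdot>\<^sub>v block_grad f B y) =
    dist2 v - 2 * s * (\<Sum>i\<in>B. (v $ i - us $ i) * gradient y i) + s\<^sup>2 * grad_sq y B"
proof -
  have "dist2 (v - s \<cdot>\<^sub>v block_grad f B y) =
    (\<Sum>i<m. (v $ i - us $ i)\<^sup>2 + (if i \<in> B then
      s\<^sup>2 * (gradient y i)\<^sup>2 - 2 * s * ((v $ i - us $ i) * gradient y i) else 0))"
    unfolding dist2_def using v block_grad_carrier[OF y, of B]
    by (intro sum.cong refl) (auto simp: block_grad_index[OF y] power2_eq_square algebra_simps)
  also have "\<dots> = dist2 v + (\<Sum>i\<in>B. s\<^sup>2 * (gradient y i)\<^sup>2 - 2 * s * ((v $ i - us $ i) * gradient y i))"
    by (simp add: sum.distrib dist2_def sum_block[OF B])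
  also have "\<dots> = dist2 v - 2 * s * (\<Sum>i\<in>B. (v $ i - us $ i) * gradient y i) + s\<^sup>2 * grad_sq y B"
    by (simp add: sum_subtractf sum_distrib_left grad_sq_def)
  finally show ?thesis .
qed

lemma rule_props:
  assumes "y \<in> carrier_vec m" "B \<in> set (blocks P)"
  shows "rule h y B \<in> carrier_vec m"
    and "f (rule h y B) \<le> f (y - (1 / (root_L_at P (T_seq P (length h)) B)\<^sup>2) \<cdot>\<^sub>v block_grad f B y)"
  using rule anchor assms unfolding admissible_rule_def by auto

text \<open>The one-step estimate for a single block, weighted by its probability. The gain of the
  descent step and the loss of the dual step cancel exactly, since
  $p_B (T + a) / (2 \bar L_B) = a^2 / (2 p_B)$ for $p_B = \sqrt{\bar L_B} / M$ and
  $M^2 a^2 = T + a$.\<close>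

lemma potential_block:
  fixes h :: "nat set list"
  defines "T \<equiv> T_seq P (length h)"
  defines "a \<equiv> incr_at P T"
  assumes B: "B \<in> set (blocks P)" and v: "v \<in> carrier_vec m" and y: "y \<in> carrier_vec m"
    and low: "F y \<le> 5 * Delta_at P T"
  shows "prob_at P T B * potential (T + a) (rule h y B) (v - (a / prob_at P T B) \<cdot>\<^sub>v block_grad f B y)
    \<le> prob_at P T B * ((T + a) * F y + dist2 v / 2)
      - a * (\<Sum>i\<in>B. (v $ i - us $ i) * gradient y i)"
proof -
  define q where "q = grad_sq y B"
  define r where "r = root_L_at P T B"
  define M where "M = M_at P T"
  define p where "p = prob_at P T B"
  define w where "w = (\<Sum>i\<in>B. (v $ i - us $ i) * gradient y i)"
  have T: "0 < T" by (simp add: T_def T_seq_pos)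
  have M: "0 < M" and a: "0 < a" "M\<^sup>2 * a\<^sup>2 = T + a" and pr: "p = r / M"
    using M_pos[OF T] incr[OF T] by (auto simp: M_def a_def p_def r_def prob_at_def)
  show ?thesis
  proof (cases "r = 0")
    case True
    then have "w = 0" unfolding w_def
      using gradient_undrawn[OF T B y low] by (simp add: r_def)
    then show ?thesis using True pr by (simp add: p_def[symmetric] w_def[symmetric])
  next
    case False
    then have r: "0 < r" using root_L_nonneg[OF T B] by (simp add: r_def)
    then have p: "0 < p" using M pr by simp
    have "F (rule h y B) \<le> F (y - (1 / r\<^sup>2) \<cdot>\<^sub>v block_grad f B y)"
      using rule_props(2)[OF y B, of h] by (simp add: gap_eq r_def T_def)
    also have "\<dots> \<le> F y - q / (2 * r\<^sup>2)"
      using block_descent[OF T B y low] r by (simp add: r_def q_def)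
    finally have "(T + a) * F (rule h y B) \<le> (T + a) * (F y - q / (2 * r\<^sup>2))"
      using T a by (intro mult_left_mono) auto
    then have "p * potential (T + a) (rule h y B) (v - (a / p) \<cdot>\<^sub>v block_grad f B y)
      \<le> p * ((T + a) * (F y - q / (2 * r\<^sup>2)) + (dist2 v - 2 * (a / p) * w + (a / p)\<^sup>2 * q) / 2)"
      unfolding potential_def dist2_step[OF v y B] q_def[symmetric] w_def[symmetric]
      using p by (intro mult_left_mono) auto
    also have "\<dots> = p * ((T + a) * F y + dist2 v / 2) - a * w
        + (a\<^sup>2 / p - p * (T + a) / r\<^sup>2) * q / 2"
      using p r by (simp add: field_simps power2_eq_square)
    also have "p * (T + a) / r\<^sup>2 = a\<^sup>2 / p"
      unfolding a(2)[symmetric] pr using r M by (simp add: field_simps power2_eq_square)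
    finally show ?thesis by (simp add: p_def w_def)
  qed
qed

lemma sum_prob: "0 < T \<Longrightarrow> (\<Sum>B\<in>set (blocks P). prob_at P T B) = 1"
  using M_pos[of T] by (simp add: prob_at_def sum_divide_distrib[symmetric] sum_root_L)

lemma bcd_step_eq:
  "bcd_step f P rule (u, v, h) =
    map_pmf (\<lambda>B. (rule h (mix (T_seq P (length h)) (incr_at P (T_seq P (length h))) u v) B,
      v - (incr_at P (T_seq P (length h)) / prob_at P (T_seq P (length h)) B) \<cdot>\<^sub>v
        block_grad f B (mix (T_seq P (length h)) (incr_at P (T_seq P (length h))) u v), h @ [B]))
      (draw_block P (T_seq P (length h)))"
  by (simp add: bcd_step_def mix_def Let_def map_pmf_def)

definition state_potential :: "real vec \<times> real vec \<times> nat set list \<Rightarrow> real" where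
  "state_potential = (\<lambda>(u, v, h). potential (T_seq P (length h)) u v)"

text \<open>Summed over the blocks, the single-block estimates reassemble the full gradient, because
  dividing by $p_B$ makes the dual step unbiased; the tangent inequality then applies.\<close>
lemma potential_step:
  assumes u: "u \<in> carrier_vec m" and v: "v \<in> carrier_vec m"
    and budget: "state_potential (u, v, h) \<le> Pi_budget P"
  shows "measure_pmf.expectation (bcd_step f P rule (u, v, h)) state_potential
    \<le> state_potential (u, v, h)"
proof -
  define T where "T = T_seq P (length h)"
  define a where "a = incr_at P T"
  define y where "y = mix T a u v"
  have T: "0 < T" by (simp add: T_def T_seq_pos)
  have y: "y \<in> carrier_vec m" using u v by (simp add: y_def mix_carrier)
  have low: "F y \<le> 5 * Delta_at P T"
    unfolding y_def a_def using budget by (intro gap_mix_le T u v) (simp add: state_potential_def T_def)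
  have "measure_pmf.expectation (bcd_step f P rule (u, v, h)) state_potential =
    (\<Sum>B\<in>set (blocks P). prob_at P T B *
      potential (T + a) (rule h y B) (v - (a / prob_at P T B) \<cdot>\<^sub>v block_grad f B y))"
    by (simp add: bcd_step_eq expectation_draw_block T_seq_pos state_potential_def T_def a_def y_def)
  also have "\<dots> \<le> (\<Sum>B\<in>set (blocks P). prob_at P T B * ((T + a) * F y + dist2 v / 2)
      - a * (\<Sum>i\<in>B. (v $ i - us $ i) * gradient y i))"
    using potential_block[of _ v y h] v y low by (intro sum_mono) (simp add: T_def a_def)
  also have "\<dots> = (T + a) * F y + dist2 v / 2 - a * slope y (v - us)"
    using v us_carrier
    by (simp add: sum_subtractf sum_distrib_right[symmetric] sum_prob[OF T] sum_distrib_left[symmetric]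
        sum_partition_on[OF partition, symmetric] slope_eq_sum)
  also have "\<dots> \<le> state_potential (u, v, h)"
    using mix_tangents[OF u v us_carrier T, of a] incr(1)[OF T]
    by (simp add: state_potential_def potential_def T_def a_def y_def gap_eq[of us])
  finally show ?thesis .
qed

text \<open>Capping the potential at its budget gives a genuine supermartingale: above the budget,
  where the step may behave badly, the capped ratio already has its largest value 1.\<close>

definition risk :: "real vec \<times> real vec \<times> nat set list \<Rightarrow> real" where
  "risk s = min 1 (state_potential s / Pi_budget P)"

lemma finite_bcd_step: "finite (set_pmf (bcd_step f P rule s))"
  by (cases s) (simp add: bcd_step_eq finite_draw_block T_seq_pos)

lemma risk_step:
  assumes u: "u \<in> carrier_vec m" and v: "v \<in> carrier_vec m"
  shows "measure_pmf.expectation (bcd_step f P rule (u, v, h)) risk \<le> risk (u, v, h)"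
proof (cases "state_potential (u, v, h) \<le> Pi_budget P")
  case True
  have "measure_pmf.expectation (bcd_step f P rule (u, v, h)) risk
    \<le> measure_pmf.expectation (bcd_step f P rule (u, v, h)) (\<lambda>s. state_potential s / Pi_budget P)"
    by (intro expectation_mono_finite finite_bcd_step) (simp add: risk_def)
  also have "\<dots> \<le> state_potential (u, v, h) / Pi_budget P"
    using potential_step[OF u v True] Pi_pos by (simp add: divide_right_mono)
  also have "\<dots> = risk (u, v, h)"
    unfolding risk_def using True Pi_pos by (intro min_absorb2[symmetric]) simp
  finally show ?thesis .
next
  case False
  have "measure_pmf.expectation (bcd_step f P rule (u, v, h)) risk
    \<le> measure_pmf.expectation (bcd_step f P rule (u, v, h)) (\<lambda>_. 1)"
    by (intro expectation_mono_finite finite_bcd_step) (simp add: risk_def)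
  then show ?thesis using False Pi_pos by (simp add: risk_def min_def)
qed

lemma finite_bcd_iterate: "finite (set_pmf (bcd_iterate f P rule k))"
  by (induction k) (auto simp: finite_bcd_step)

lemma bcd_iterate_carrier:
  "(u, v, h) \<in> set_pmf (bcd_iterate f P rule k) \<Longrightarrow>
    u \<in> carrier_vec m \<and> v \<in> carrier_vec m \<and> length h = k"
proof (induction k arbitrary: u v h)
  case 0
  then show ?case using anchor by simp
next
  case (Suc k)
  then obtain u' v' h' where s: "(u', v', h') \<in> set_pmf (bcd_iterate f P rule k)"
    and "(u, v, h) \<in> set_pmf (bcd_step f P rule (u', v', h'))" by auto
  then obtain B where "B \<in> set_pmf (draw_block P (T_seq P (length h')))"
    and eq: "u = rule h' (mix (T_seq P (length h')) (incr_at P (T_seq P (length h'))) u' v') B"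
      "v = v' - (incr_at P (T_seq P (length h')) / prob_at P (T_seq P (length h')) B) \<cdot>\<^sub>v
        block_grad f B (mix (T_seq P (length h')) (incr_at P (T_seq P (length h'))) u' v')"
      "h = h' @ [B]"
    by (auto simp: bcd_step_eq)
  moreover have "B \<in> set (blocks P)"
    using calculation(1) by (rule set_draw_block(1)[OF T_seq_pos])
  ultimately show ?case
    using Suc.IH[OF s] by (auto intro!: rule_props mix_carrier minus_carrier_vec smult_carrier_vec[THEN iffD2]
        block_grad_carrier)
qed

text \<open>The initial value $T_0 = r^2 / (2 \bar\Delta)$ balances the two parts of the potential, which
  is therefore at most $r^2 = \delta \Pi$ at the start.\<close>
lemma risk_iterate: "measure_pmf.expectation (bcd_iterate f P rule k) risk \<le> level P"
proof (induction k)
  case 0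
  have "dist2 (anchor P) = (norm2 (anchor P - us))\<^sup>2"
    using anchor us_carrier
    by (simp add: norm2_def dist2_def scalar_prod_def lessThan_atLeast0 sum_nonneg power2_eq_square)
  also have "\<dots> \<le> (radius P)\<^sup>2"
    using near by (intro power_mono) (auto simp: norm2_def scalar_prod_def sum_nonneg)
  finally have "dist2 (anchor P) \<le> (radius P)\<^sup>2" .
  moreover have "T_init P * F (anchor P) \<le> T_init P * gap_bound P"
    using anchor_gap gap_bound by (intro mult_left_mono) (auto simp: T_init_def)
  moreover have "T_init P * gap_bound P = (radius P)\<^sup>2 / 2"
    using gap_bound by (simp add: T_init_def)
  ultimately have "state_potential (anchor P, anchor P, []) \<le> (radius P)\<^sup>2"
    by (simp add: state_potential_def potential_def)
  then have "risk (anchor P, anchor P, []) \<le> (radius P)\<^sup>2 / Pi_budget P"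
    unfolding risk_def using Pi_pos by (intro min.coboundedI2 divide_right_mono) auto
  also have "\<dots> = level P" using radius level by (simp add: Pi_budget_def)
  finally show ?case by simp
next
  case (Suc k)
  have "measure_pmf.expectation (bcd_iterate f P rule (Suc k)) risk =
    measure_pmf.expectation (bcd_iterate f P rule k)
      (\<lambda>s. measure_pmf.expectation (bcd_step f P rule s) risk)"
    by (simp add: expectation_bind_finite finite_bcd_iterate finite_bcd_step)
  also have "\<dots> \<le> measure_pmf.expectation (bcd_iterate f P rule k) risk"
    using bcd_iterate_carrier risk_step
    by (intro expectation_mono_finite finite_bcd_iterate) (auto intro: risk_step)
  finally show ?case using Suc.IH by simp
qed

text \<open>At the stopping time an inaccurate output forces the potential above its budget, so the
  expected risk dominates the failure probability.\<close>

lemma phase_failure: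
  assumes active: "\<not> returns_anchor P" and target: "0 < target P"
  shows "measure_pmf.expectation (bcd_phase f P rule) (\<lambda>u. if F u \<le> target P then 0 else 1) \<le> level P"
proof -
  let ?N = "n_iter P"
  have "\<exists>N. 1 \<le> N \<and> Pi_budget P / target P \<le> T_seq P N"
    using phase_halts[OF kappa nu C0 radius gap_bound level] by auto
  then have N: "Pi_budget P / target P \<le> T_seq P ?N"
    unfolding n_iter_def by (rule LeastI2_ex) auto
  have "measure_pmf.expectation (bcd_iterate f P rule ?N) (\<lambda>s. if F (fst s) \<le> target P then 0 else 1)
    \<le> measure_pmf.expectation (bcd_iterate f P rule ?N) risk"
  proof (intro expectation_mono_finite finite_bcd_iterate)
    fix s assume s: "s \<in> set_pmf (bcd_iterate f P rule ?N)"
    obtain u v h where suv: "s = (u, v, h)" by (cases s)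
    have uv: "u \<in> carrier_vec m" "v \<in> carrier_vec m" "length h = ?N"
      using bcd_iterate_carrier[of u v h] s suv by auto
    have n: "0 \<le> state_potential s"
      using potential_nonneg[OF T_seq_pos uv(1)] by (simp add: suv state_potential_def)
    show "(if F (fst s) \<le> target P then 0 else 1) \<le> risk s"
    proof (cases "F u \<le> target P")
      case True
      then show ?thesis using n Pi_pos by (simp add: suv risk_def)
    next
      case False
      have "Pi_budget P \<le> T_seq P ?N * target P" using N target by (simp add: field_simps)
      also have "\<dots> \<le> T_seq P ?N * F u" using False T_seq_pos[of ?N] by (intro mult_left_mono) auto
      also have "\<dots> \<le> state_potential s"
        using dist2_nonneg[of v] uv by (simp add: suv state_potential_def potential_def)
      finally show ?thesis using Pi_pos False by (simp add: suv risk_def)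
    qed
  qed
  then show ?thesis using risk_iterate[of ?N] active by (simp add: bcd_phase_def)
qed

lemma finite_bcd_phase: "finite (set_pmf (bcd_phase f P rule))"
  by (simp add: bcd_phase_def finite_bcd_iterate)

text \<open>The best candidate misses the target only if every copy does, and then the anchor still
  bounds its gap.\<close>
lemma restarts_gap:
  assumes active: "\<not> returns_anchor P" and target: "0 < target P"
  shows "measure_pmf.expectation (bcd_restarts f P rule J) F \<le> target P + gap_bound P * level P ^ J"
proof -
  let ?fail = "\<lambda>u. if F u \<le> target P then 0 else 1 :: real"
  let ?R = "\<lambda>J. replicate_pmf J (bcd_phase f P rule)"
  have "measure_pmf.expectation (bcd_restarts f P rule J) F =
    measure_pmf.expectation (?R J) (\<lambda>xs. F (best_of f (anchor P) xs))"
    by (simp add: bcd_restarts_def)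
  also have "\<dots> \<le> measure_pmf.expectation (?R J)
      (\<lambda>xs. target P + gap_bound P * prod_list (map ?fail xs))"
  proof (intro expectation_mono_finite finite_replicate_pmf finite_bcd_phase)
    fix xs
    show "F (best_of f (anchor P) xs) \<le> target P + gap_bound P * prod_list (map ?fail xs)"
    proof (cases "\<exists>u\<in>set xs. F u \<le> target P")
      case True
      then obtain u where u: "u \<in> set xs" "F u \<le> target P" by blast
      then have "F (best_of f (anchor P) xs) \<le> target P"
        using best_of_le(2)[OF u(1), of f "anchor P"] by (simp add: gap_eq)
      moreover have "prod_list (map ?fail xs) = 0" using u by (auto simp: prod_list_zero_iff)
      ultimately show ?thesis by (simp del: prod_list_zero_iff)
    next
      case False
      then have "map ?fail xs = map (\<lambda>_. 1) xs" by auto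
      then have "prod_list (map ?fail xs) = 1" by (simp add: map_replicate_const prod_list_replicate)
      moreover have "F (best_of f (anchor P) xs) \<le> F (anchor P)"
        using best_of_le(1)[of f "anchor P" xs] by (simp add: gap_eq)
      ultimately show ?thesis using anchor_gap target by simp
    qed
  qed
  also have "\<dots> = target P + gap_bound P * measure_pmf.expectation (bcd_phase f P rule) ?fail ^ J"
    by (simp add: expectation_add_finite finite_replicate_pmf finite_bcd_phase
        expectation_prod_replicate)
  also have "\<dots> \<le> target P + gap_bound P * level P ^ J"
    using phase_failure[OF active target] gap_bound
    by (intro add_left_mono mult_left_mono power_mono) (auto intro!: Bochner_Integration.integral_nonneg)
  finally show ?thesis .
qed

end

section \<open>Alias tables\<close>

text \<open>The weight of \<open>l\<close> in an alias table, in units of the slot probability.\<close>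

definition alias_mass :: "nat \<Rightarrow> alias_table \<Rightarrow> nat \<Rightarrow> real" where
  "alias_mass N tab l = (\<Sum>i<N. (if i = l then fst tab i else 0) + (if snd tab i = l then 1 - fst tab i else 0))"

text \<open>What is still missing at \<open>l\<close>: its weight on the work lists minus the unit that its slot holds
  by default.\<close>
definition excess :: "(nat \<times> real) list \<Rightarrow> nat \<Rightarrow> real" where
  "excess xs l = (\<Sum>(i, p)\<leftarrow>xs. if i = l then p - 1 else 0)"

definition alias_ok :: "nat \<Rightarrow> alias_table \<Rightarrow> bool" where
  "alias_ok N tab \<longleftrightarrow> (\<forall>i<N. 0 \<le> fst tab i \<and> fst tab i \<le> 1 \<and> snd tab i < N)"

lemma alias_mass_update:
  assumes "i < N" "fst tab i = 1"
  shows "alias_mass N ((fst tab)(i := p), (snd tab)(i := j)) l =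
    alias_mass N tab l + (if i = l then p - 1 else 0) + (if j = l then 1 - p else 0)"
proof -
  have i: "i \<in> {..<N}" "finite {..<N}" using assms by auto
  have rest: "(\<Sum>x\<in>{..<N} - {i}. (if x = l then ((fst tab)(i := p)) x else 0) +
      (if ((snd tab)(i := j)) x = l then 1 - ((fst tab)(i := p)) x else 0)) =
    (\<Sum>x\<in>{..<N} - {i}. (if x = l then fst tab x else 0) + (if snd tab x = l then 1 - fst tab x else 0))"
    by (intro sum.cong refl) auto
  show ?thesis
    unfolding alias_mass_def sum.remove[OF i(2,1)] fst_conv snd_conv rest using assms(2) by auto
qed

text \<open>The slots still on the work lists are kept with probability 1, and the table already in
  place together with the remaining excesses accounts for the desired weights. When the
  small list is empty, all remaining weights are at least 1 and average to 1, so they equal 1;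
  the large list cannot run out first, for then the remaining weights would average to less.\<close>

lemma vose_correct:
  assumes "distinct (map fst (S @ L))" "fst ` set (S @ L) \<subseteq> {..<N}"
    and "\<forall>(i, p)\<in>set S. 0 \<le> p \<and> p < 1" "\<forall>(j, q)\<in>set L. 1 \<le> q"
    and "(\<Sum>(i, p)\<leftarrow>S @ L. p - 1) = 0" "\<forall>i\<in>fst ` set (S @ L). fst tab i = 1" "alias_ok N tab"
  shows "alias_ok N (fst (vose S L tab)) \<and>
    alias_mass N (fst (vose S L tab)) l = alias_mass N tab l + excess (S @ L) l"
  using assms
proof (induction S L tab rule: vose.induct)
  case (1 i p S j q L tab)
  define q' where "q' = q - (1 - p)"
  define tab' where "tab' = ((fst tab)(i := p), (snd tab)(i := j))"
  have p: "0 \<le> p" "p < 1" "1 \<le> q" and ij: "i < N" "j < N" "i \<noteq> j" and ti: "fst tab i = 1"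
    using 1(3,4,5,6,8) by auto
  have q': "0 \<le> q'" using p by (simp add: q'_def)
  have ok: "alias_ok N tab'"
    unfolding alias_ok_def tab'_def
  proof (intro allI impI)
    fix x assume "x < N"
    then show "0 \<le> fst ((fst tab)(i := p), (snd tab)(i := j)) x \<and>
        fst ((fst tab)(i := p), (snd tab)(i := j)) x \<le> 1 \<and>
        snd ((fst tab)(i := p), (snd tab)(i := j)) x < N"
      using 1(9) p ij by (simp add: alias_ok_def)
  qed
  have mass: "alias_mass N tab' l = alias_mass N tab l + (if i = l then p - 1 else 0)
      + (if j = l then 1 - p else 0)"
    unfolding tab'_def by (rule alias_mass_update[OF ij(1) ti])
  have one: "\<forall>x\<in>fst ` set (S @ (j, q') # L). fst tab' x = 1"
  proof
    fix x assume x: "x \<in> fst ` set (S @ (j, q') # L)"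
    then have "x \<noteq> i" using 1(3) by auto
    moreover have "x \<in> fst ` set (((i, p) # S) @ (j, q) # L)" using x by auto
    ultimately have "fst tab x = 1" using 1(8) by blast
    with \<open>x \<noteq> i\<close> show "fst tab' x = 1" by (simp add: tab'_def)
  qed
  have total: "p - 1 + (q - 1 + ((\<Sum>(i, p)\<leftarrow>S. p - 1) + (\<Sum>(i, p)\<leftarrow>L. p - 1))) = 0"
    using 1(7) by simp
  show ?case
  proof (cases "q' < 1")
    case True
    have "vose ((i, p) # S) ((j, q) # L) tab =
        (fst (vose ((j, q') # S) L tab'), 1 + snd (vose ((j, q') # S) L tab'))"
      using True by (simp add: q'_def tab'_def Let_def split: prod.split)
    moreover have "alias_ok N (fst (vose ((j, q') # S) L tab')) \<and>
      alias_mass N (fst (vose ((j, q') # S) L tab')) l =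
        alias_mass N tab' l + excess (((j, q') # S) @ L) l"
    proof (rule 1(1)[OF q'_def _ True])
      show "tab' = ((fst tab)(i := p), (snd tab)(i := j))" by (rule tab'_def)
      show "distinct (map fst (((j, q') # S) @ L))" using 1(3) by auto
      show "fst ` set (((j, q') # S) @ L) \<subseteq> {..<N}" using 1(4) by auto
      show "\<forall>(i, p)\<in>set ((j, q') # S). 0 \<le> p \<and> p < 1" using 1(5) q' True by simp
      show "\<forall>(j, q)\<in>set L. 1 \<le> q" using 1(6) by simp
      have "(\<Sum>(i, p)\<leftarrow>((j, q') # S) @ L. p - 1) =
          q' - 1 + ((\<Sum>(i, p)\<leftarrow>S. p - 1) + (\<Sum>(i, p)\<leftarrow>L. p - 1))" by simp
      then show "(\<Sum>(i, p)\<leftarrow>((j, q') # S) @ L. p - 1) = 0" using total unfolding q'_def by linarith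
      show "\<forall>i\<in>fst ` set (((j, q') # S) @ L). fst tab' i = 1" using one by auto
      show "alias_ok N tab'" by (rule ok)
    qed
    moreover have "excess (((i, p) # S) @ (j, q) # L) l =
        excess (((j, q') # S) @ L) l + (if i = l then p - 1 else 0) + (if j = l then 1 - p else 0)"
      by (simp add: excess_def q'_def)
    ultimately show ?thesis by (simp add: mass)
  next
    case False
    have "vose ((i, p) # S) ((j, q) # L) tab =
        (fst (vose S ((j, q') # L) tab'), 1 + snd (vose S ((j, q') # L) tab'))"
      using False by (simp add: q'_def tab'_def Let_def split: prod.split)
    moreover have "alias_ok N (fst (vose S ((j, q') # L) tab')) \<and>
      alias_mass N (fst (vose S ((j, q') # L) tab')) l =
        alias_mass N tab' l + excess (S @ ((j, q') # L)) l"
    proof (rule 1(2)[OF q'_def _ False])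
      show "tab' = ((fst tab)(i := p), (snd tab)(i := j))" by (rule tab'_def)
      show "distinct (map fst (S @ (j, q') # L))" using 1(3) by auto
      show "fst ` set (S @ (j, q') # L) \<subseteq> {..<N}" using 1(4) by auto
      show "\<forall>(i, p)\<in>set S. 0 \<le> p \<and> p < 1" using 1(5) by simp
      show "\<forall>(j, q)\<in>set ((j, q') # L). 1 \<le> q" using 1(6) False by simp
      have "(\<Sum>(i, p)\<leftarrow>S @ (j, q') # L. p - 1) =
          (\<Sum>(i, p)\<leftarrow>S. p - 1) + (q' - 1 + (\<Sum>(i, p)\<leftarrow>L. p - 1))" by simp
      then show "(\<Sum>(i, p)\<leftarrow>S @ (j, q') # L. p - 1) = 0" using total unfolding q'_def by linarith
      show "\<forall>i\<in>fst ` set (S @ (j, q') # L). fst tab' i = 1" by (rule one)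
      show "alias_ok N tab'" by (rule ok)
    qed
    moreover have "excess (((i, p) # S) @ (j, q) # L) l =
        excess (S @ (j, q') # L) l + (if i = l then p - 1 else 0) + (if j = l then 1 - p else 0)"
      by (simp add: excess_def q'_def)
    ultimately show ?thesis by (simp add: mass)
  qed
next
  case (2 L tab)
  have "excess L l = 0" if "\<forall>(j, q)\<in>set L. 1 \<le> q" "(\<Sum>(i, p)\<leftarrow>L. p - 1) = 0"
    using that
  proof (induction L)
    case (Cons x L)
    obtain i p where x: "x = (i, p)" by (cases x)
    have "0 \<le> (\<Sum>(i, p)\<leftarrow>L. p - 1)" using Cons(2) by (intro sum_list_nonneg) auto
    moreover have "p - 1 + (\<Sum>(i, p)\<leftarrow>L. p - 1) = 0" using Cons(3) x by simp
    moreover have "1 \<le> p" using Cons(2) x by simp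
    ultimately have "p = 1" "(\<Sum>(i, p)\<leftarrow>L. p - 1) = 0" by linarith+
    then show ?case using Cons(1,2) x by (simp add: excess_def)
  qed (simp add: excess_def)
  from this[OF 2(4)] show ?case using 2(5,7) by simp
next
  case (3 x S tab)
  have neg: "(\<Sum>(i, p)\<leftarrow>xs. p - 1) \<le> 0" if "\<forall>(i, p)\<in>set xs. 0 \<le> p \<and> p < 1"
    for xs :: "(nat \<times> real) list"
    using that by (induction xs) auto
  obtain i p where x: "x = (i, p)" by (cases x)
  have "(\<Sum>(i, p)\<leftarrow>S. p - 1) \<le> 0" by (rule neg) (use 3(3) in auto)
  moreover have "p < 1" using 3(3) x by auto
  ultimately have "(\<Sum>(i, p)\<leftarrow>(x # S) @ []. p - 1) < 0" using x by simp
  then show ?case using 3(5) by simp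
qed

lemma pmf_alias_sample:
  assumes N: "0 < N" and ok: "alias_ok N tab"
  shows "pmf (alias_sample N tab) l = alias_mass N tab l / N"
proof -
  have ne: "{..<N} \<noteq> {}" "finite {..<N}" using N by auto
  have *: "pmf (bernoulli_pmf (fst tab i) \<bind> (\<lambda>keep. return_pmf (if keep then i else snd tab i))) l =
      (if i = l then fst tab i else 0) + (if snd tab i = l then 1 - fst tab i else 0)" if "i < N" for i
    using that ok unfolding pmf_bind alias_ok_def
    by (subst integral_bernoulli_pmf) (auto simp: indicator_def)
  show ?thesis
    unfolding alias_sample_def pmf_bind[of "pmf_of_set {..<N}"] integral_pmf_of_set[OF ne]
    by (simp add: alias_mass_def * )
qed

lemma set_alias_sample:
  assumes "0 < N" "alias_ok N tab"
  shows "set_pmf (alias_sample N tab) \<subseteq> {..<N}"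
proof -
  have "alias_mass N tab l = 0" if "\<not> l < N" for l
    unfolding alias_mass_def using that assms(2) by (intro sum.neutral) (auto simp: alias_ok_def)
  then show ?thesis
    using assms by (force simp: set_pmf_iff pmf_alias_sample)
qed

lemma sum_list_filter_partition:
  fixes g :: "'a \<Rightarrow> real"
  shows "(\<Sum>x\<leftarrow>filter Q xs. g x) + (\<Sum>x\<leftarrow>filter (\<lambda>x. \<not> Q x) xs. g x) = (\<Sum>x\<leftarrow>xs. g x)"
  by (induction xs) auto

lemma alias_build_correct:
  assumes w: "\<And>B. B \<in> set bs \<Longrightarrow> 0 \<le> w B" and C: "C = root_sum bs w" "0 < C" and bs: "distinct bs"
  shows "map_pmf (\<lambda>l. bs ! l) (alias_sample (length bs) (fst (alias_build bs w C))) = block_pmf bs w"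
proof -
  define N where "N = length bs"
  define xs where "xs = map (\<lambda>l. (l, real N * (sqrt (w (bs ! l)) / C))) [0..<N]"
  define S where "S = filter (\<lambda>(l, p). p < 1) xs"
  define L where "L = filter (\<lambda>(l, p). \<not> p < 1) xs"
  define tab :: alias_table where "tab = (\<lambda>_. 1, \<lambda>l. l)"
  have L': "L = filter (\<lambda>x. \<not> (case x of (l, p) \<Rightarrow> p < 1)) xs"
    unfolding L_def by (rule filter_cong) auto
  have build: "fst (alias_build bs w C) = fst (vose S L tab)"
    by (simp add: alias_build_def Let_def N_def S_def L_def xs_def tab_def split: prod.split)
  have N: "0 < N" using C by (cases bs) (auto simp: N_def root_sum_def)
  have total: "(\<Sum>l<N. sqrt (w (bs ! l))) = C"
    using bs by (simp add: C root_sum_def N_def sum.distinct_set_conv_list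
        sum_list_sum_nth lessThan_atLeast0)
  have part: "(\<Sum>x\<leftarrow>S @ L. g x) = (\<Sum>l<N. g (l, real N * (sqrt (w (bs ! l)) / C)))"
    for g :: "nat \<times> real \<Rightarrow> real"
    unfolding map_append sum_list_append S_def L' sum_list_filter_partition
    by (simp add: xs_def comp_def interv_sum_list_conv_sum_set_nat lessThan_atLeast0)
  have dist: "distinct (map fst xs)" by (simp add: xs_def comp_def)
  have vose: "alias_ok N (fst (vose S L tab)) \<and>
    alias_mass N (fst (vose S L tab)) l = alias_mass N tab l + excess (S @ L) l" for l
  proof (rule vose_correct)
    have "distinct (map fst S)" "distinct (map fst L)"
      using dist by (auto simp: S_def L_def distinct_map_filter)
    moreover have "fst ` set S \<inter> fst ` set L = {}"
      by (auto simp: S_def L_def xs_def)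
    ultimately show "distinct (map fst (S @ L))" by simp
    show "fst ` set (S @ L) \<subseteq> {..<N}" by (auto simp: S_def L_def xs_def)
    show "\<forall>(i, p)\<in>set S. 0 \<le> p \<and> p < 1" using w C by (auto simp: S_def xs_def N_def)
    show "\<forall>(j, q)\<in>set L. 1 \<le> q" by (auto simp: L_def)
    show "(\<Sum>(i, p)\<leftarrow>S @ L. p - 1) = 0"
      unfolding part using C
      by (simp add: sum_subtractf sum_distrib_left[symmetric] sum_divide_distrib[symmetric] total)
  qed (auto simp: tab_def alias_ok_def)
  have ok: "alias_ok (length bs) (fst (alias_build bs w C))"
    using vose by (simp add: build N_def)
  have pmf: "pmf (alias_sample N (fst (alias_build bs w C))) l = sqrt (w (bs ! l)) / C" if l: "l < N" for l
  proof -
    have "alias_mass N tab l = (\<Sum>i<N. if i = l then 1 else 0)"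
      unfolding alias_mass_def tab_def by (intro sum.cong refl) auto
    then have "alias_mass N tab l = 1" using l by simp
    moreover have "excess (S @ L) l = real N * (sqrt (w (bs ! l)) / C) - 1"
      using l unfolding excess_def part by simp
    ultimately have "alias_mass N (fst (vose S L tab)) l = real N * (sqrt (w (bs ! l)) / C)"
      using vose[of l] by simp
    then show ?thesis
      using N ok by (simp add: pmf_alias_sample N_def[symmetric] build)
  qed
  show "map_pmf (\<lambda>l. bs ! l) (alias_sample (length bs) (fst (alias_build bs w C))) = block_pmf bs w"
  proof (rule pmf_eqI)
    fix B
    let ?p = "alias_sample N (fst (alias_build bs w C))"
    have sub: "set_pmf ?p \<subseteq> {..<N}" using N ok by (intro set_alias_sample) (auto simp: N_def)
    have "pmf (map_pmf (\<lambda>l. bs ! l) ?p) B = (if B \<in> set bs then sqrt (w B) / C else 0)"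
    proof (cases "B \<in> set bs")
      case True
      then obtain l where l: "l < N" "B = bs ! l" by (auto simp: in_set_conv_nth N_def)
      have "(\<lambda>l. bs ! l) -` {B} \<inter> set_pmf ?p = {l} \<inter> set_pmf ?p"
        using sub bs l by (auto simp: N_def nth_eq_iff_index_eq)
      then have "pmf (map_pmf (\<lambda>l. bs ! l) ?p) B = pmf ?p l"
        unfolding pmf_map by (metis measure_Int_set_pmf measure_pmf_single)
      then show ?thesis using True l by (simp add: pmf)
    next
      case False
      then have "B \<notin> set_pmf (map_pmf (\<lambda>l. bs ! l) ?p)" using sub by (auto simp: N_def)
      then have "pmf (map_pmf (\<lambda>l. bs ! l) ?p) B = 0" by (rule pmf_eq_0_set_pmf[THEN iffD2])
      then show ?thesis using False by (simp only: if_False)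
    qed
    then show "pmf (map_pmf (\<lambda>l. bs ! l) (alias_sample (length bs) (fst (alias_build bs w C)))) B =
        pmf (block_pmf bs w) B"
      using w C by (simp add: pmf_block_pmf N_def)
  qed
qed

lemma vose_cost: "snd (vose S L tab) \<le> length S + length L"
  by (induction S L tab rule: vose.induct) (auto simp: Let_def split: prod.splits)

lemma alias_build_cost: "snd (alias_build bs w C) \<le> 2 * length bs"
proof -
  define xs where "xs = map (\<lambda>l. (l, real (length bs) * (sqrt (w (bs ! l)) / C))) [0..<length bs]"
  have len: "length (filter (\<lambda>(l, p). p < 1) xs) + length (filter (\<lambda>(l, p). \<not> p < 1) xs) = length xs"
    for xs :: "(nat \<times> real) list"
    by (induction xs) auto
  have "snd (alias_build bs w C) = length bs +
    snd (vose (filter (\<lambda>(l, p). p < 1) xs) (filter (\<lambda>(l, p). \<not> p < 1) xs) (\<lambda>_. 1, \<lambda>l. l))"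
    by (simp add: alias_build_def Let_def xs_def split: prod.split)
  also have "\<dots> \<le> length bs + length xs"
    using vose_cost len[of xs] by (metis add_le_cancel_left)
  finally show ?thesis by (simp add: xs_def)
qed

section \<open>Loops over sparse rows\<close>

lemma for_each_fold:
  assumes "\<And>x s. x \<in> set xs \<Longrightarrow> body x s = (g x s, k x)"
  shows "for_each body xs s = (fold g xs s, (\<Sum>x\<leftarrow>xs. 1 + k x))"
  using assms by (induction xs arbitrary: s) auto

lemma for_each_simple:
  assumes "\<And>x s. body x s = (g x s, 0)"
  shows "for_each body xs s = (fold g xs s, length xs)"
  using for_each_fold[of xs body g "\<lambda>_. 0"] assms by (simp add: sum_list_triv)

lemma fold_set_entries:
  "fold (\<lambda>i g. g(i := val i)) is g i = (if i \<in> set is then val i else g i)"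
  by (induction "is" arbitrary: g) auto
lemma fold_add_array:
  fixes s :: "nat \<Rightarrow> real"
  shows "fold (\<lambda>x s. s(key x := s (key x) + val x)) xs s j = s j + (\<Sum>x\<leftarrow>xs. if key x = j then val x else 0)"
  by (induction xs arbitrary: s) auto

lemma nz_row_sum:
  "(\<Sum>x\<leftarrow>nz_row A i. if fst x = j then snd x * y else 0) = (if j < dim_col A then A $$ (i, j) * y else 0)"
proof -
  have "(\<Sum>x\<leftarrow>nz_row A i. if fst x = j then snd x * y else 0) =
    (\<Sum>k\<leftarrow>[0..<dim_col A]. if k = j then A $$ (i, k) * y else 0)"
    unfolding nz_row_def map_map comp_def fst_conv snd_conv
    by (subst sum_list_map_filter) auto
  also have "\<dots> = (\<Sum>k<dim_col A. if k = j then A $$ (i, k) * y else 0)"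
    by (simp add: sum_list_sum_nth lessThan_atLeast0 interv_sum_list_conv_sum_set_nat)
  finally show ?thesis by (simp add: sum.delta)
qed

lemma sum_length_nz_row:
  assumes "finite B" "B \<subseteq> {..<dim_row A}"
  shows "(\<Sum>i\<in>B. length (nz_row A i)) = nnz_rows A B"
proof -
  have "{(i, j). i \<in> B \<and> i < dim_row A \<and> j < dim_col A \<and> A $$ (i, j) \<noteq> 0} =
    (SIGMA i:B. {j. j < dim_col A \<and> A $$ (i, j) \<noteq> 0})" using assms by auto
  moreover have "length (nz_row A i) = card {j. j < dim_col A \<and> A $$ (i, j) \<noteq> 0}" for i
  proof -
    have "length (nz_row A i) = card (set (filter (\<lambda>j. A $$ (i, j) \<noteq> 0) [0..<dim_col A]))"
      by (simp add: nz_row_def distinct_card[symmetric])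
    also have "set (filter (\<lambda>j. A $$ (i, j) \<noteq> 0) [0..<dim_col A]) = {j. j < dim_col A \<and> A $$ (i, j) \<noteq> 0}"
      by auto
    finally show ?thesis .
  qed
  ultimately show ?thesis using assms by (simp add: nnz_rows_def)
qed

lemma transpose_apply_eq:
  "transpose_apply A x = (\<lambda>j. if j < dim_col A then \<Sum>i<dim_row A. A $$ (i, j) * x i else 0,
    dim_col A + dim_row A + nnz A)"
proof -
  define g where "g i s = fold (\<lambda>p s. s(fst p := s (fst p) + snd p * x i)) (nz_row A i) s"
    for i and s :: "nat \<Rightarrow> real"
  have "for_each (\<lambda>(j, a) s. (s(j := s j + a * x i), 0)) (nz_row A i) s =
      (g i s, length (nz_row A i))" for i s
    unfolding g_def
    by (subst for_each_fold[where g = "\<lambda>p s. s(fst p := s (fst p) + snd p * x i)" and k = "\<lambda>_. 0"])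
      (auto simp: sum_list_triv)
  then have "for_each (\<lambda>i. for_each (\<lambda>(j, a) s. (s(j := s j + a * x i), 0)) (nz_row A i))
      [0..<dim_row A] (\<lambda>_. 0) =
    (fold g [0..<dim_row A] (\<lambda>_. 0), \<Sum>i\<leftarrow>[0..<dim_row A]. 1 + length (nz_row A i))"
    by (intro for_each_fold) simp
  moreover have "fold g is s j = s j + (if j < dim_col A then \<Sum>i\<leftarrow>is. A $$ (i, j) * x i else 0)" for "is" s j
    by (induction "is" arbitrary: s) (auto simp: g_def fold_add_array nz_row_sum)
  moreover have "(\<Sum>i\<leftarrow>[0..<dim_row A]. 1 + length (nz_row A i)) = dim_row A + nnz A"
    using sum_length_nz_row[of "{..<dim_row A}" A]
    by (simp add: interv_sum_list_conv_sum_set_nat lessThan_atLeast0 sum_Suc)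
  ultimately show ?thesis
    by (auto simp: transpose_apply_def interv_sum_list_conv_sum_set_nat lessThan_atLeast0)
qed

lemma primal_response_eq:
  assumes A: "A \<in> carrier_mat m n" and u: "u \<in> carrier_vec m"
  shows "j < n \<Longrightarrow> fst (primal_response A c \<gamma> u) j = exp ((col A j \<bullet> u - c $ j) / \<gamma>)"
    and "snd (primal_response A c \<gamma> u) = 3 * n + m + nnz A"
proof -
  define zeta where "zeta = fst (transpose_apply A (\<lambda>i. u $ i))"
  have dims: "dim_col A = n" "dim_row A = m" "dim_vec u = m" using A u by auto
  have loop: "for_each (\<lambda>j x. (x(j := exp ((zeta j - c $ j) / \<gamma>)), 0)) [0..<n] x =
      (fold (\<lambda>j x. x(j := exp ((zeta j - c $ j) / \<gamma>))) [0..<n] x, n)" for x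
    by (subst for_each_fold[where g = "\<lambda>j x. x(j := exp ((zeta j - c $ j) / \<gamma>))" and k = "\<lambda>_. 0"])
      (auto simp: sum_list_triv)
  have eq: "primal_response A c \<gamma> u = (fold (\<lambda>j x. x(j := exp ((zeta j - c $ j) / \<gamma>))) [0..<n] (\<lambda>_. 0),
      (n + m + nnz A) + n + n)"
    unfolding primal_response_def dims loop[symmetric]
    using loop by (simp add: transpose_apply_eq dims zeta_def)
  show "snd (primal_response A c \<gamma> u) = 3 * n + m + nnz A" by (simp add: eq)
  assume j: "j < n"
  have "zeta j = col A j \<bullet> u"
    using j dims by (simp add: zeta_def transpose_apply_eq scalar_prod_def lessThan_atLeast0)
  then show "fst (primal_response A c \<gamma> u) j = exp ((col A j \<bullet> u - c $ j) / \<gamma>)"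
    using j by (simp add: eq fold_set_entries)
qed

lemma for_each_sum:
  fixes h :: "'a \<Rightarrow> real"
  shows "for_each (\<lambda>x s. (s + h x, 0)) xs s = (s + (\<Sum>x\<leftarrow>xs. h x), length xs)"
  by (induction xs arbitrary: s) auto

lemma initialize_eq:
  fixes A :: "real mat" and P :: phase_input
  assumes "distinct (blocks P)"
  defines "su \<equiv> fst (initialize A P)"
  shows "su_zeta su j = (if j < dim_col A then \<Sum>i<dim_row A. A $$ (i, j) * anchor P $ i else 0)"
    and "su_C0 su = C0 P" and "su_C1 su = C1 P"
    and "su_tab0 su = fst (alias_build (blocks P) (kappa P) (C0 P))"
    and "0 < C1 P \<Longrightarrow> su_tab1 su = fst (alias_build (blocks P) (nu P) (C1 P))"
    and "snd (initialize A P) \<le> nnz A + 6 * length (blocks P) + 4 * (dim_row A + dim_col A) + 1"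
proof -
  have C: "for_each (\<lambda>B s. (s + sqrt (w B), 0)) (blocks P) 0 = (root_sum (blocks P) w, length (blocks P))" for w
    using assms(1) by (simp add: for_each_sum root_sum_def sum_list_distinct_conv_sum_set)
  define t1 where "t1 = (if 0 < C1 P then alias_build (blocks P) (nu P) (C1 P) else ((\<lambda>_. 1, \<lambda>l. l), 0))"
  have eq: "initialize A P =
    (\<lparr>su_zeta = fst (transpose_apply A (\<lambda>i. anchor P $ i)), su_C0 = C0 P, su_C1 = C1 P,
       su_tab0 = fst (alias_build (blocks P) (kappa P) (C0 P)), su_tab1 = fst t1\<rparr>,
     snd (transpose_apply A (\<lambda>i. anchor P $ i)) + length (blocks P) + length (blocks P)
      + snd (alias_build (blocks P) (kappa P) (C0 P)) + snd t1 + 1 + 3 * (dim_row A + dim_col A))"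
    unfolding initialize_def C t1_def by (simp add: Let_def split: prod.split)
  show "su_zeta su j = (if j < dim_col A then \<Sum>i<dim_row A. A $$ (i, j) * anchor P $ i else 0)"
    "su_C0 su = C0 P" "su_C1 su = C1 P"
    "su_tab0 su = fst (alias_build (blocks P) (kappa P) (C0 P))"
    "0 < C1 P \<Longrightarrow> su_tab1 su = fst (alias_build (blocks P) (nu P) (C1 P))"
    by (simp_all add: su_def eq transpose_apply_eq t1_def)
  have "snd t1 \<le> 2 * length (blocks P)" by (simp add: t1_def alias_build_cost)
  then show "snd (initialize A P) \<le> nnz A + 6 * length (blocks P) + 4 * (dim_row A + dim_col A) + 1"
    using alias_build_cost[of "blocks P" "kappa P" "C0 P"] by (simp add: eq transpose_apply_eq)
qed

section \<open>The sparse implementation follows the algorithm\<close>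

definition add_column :: "real \<Rightarrow> real \<Rightarrow> nat \<times> real \<Rightarrow> lazy_state \<Rightarrow> lazy_state" where
  "add_column x y p st = st\<lparr>
     ls_zv := (ls_zv st)(fst p := ls_zv st (fst p) + snd p * x),
     ls_zw := (ls_zw st)(fst p := ls_zw st (fst p) + snd p * y),
     ls_seenJ := (ls_seenJ st)(fst p := True),
     ls_J := (if ls_seenJ st (fst p) then ls_J st else fst p # ls_J st)\<rparr>"

lemma add_column_simps [simp]:
  "ls_v (add_column x y p st) = ls_v st" "ls_w (add_column x y p st) = ls_w st"
  "ls_seenI (add_column x y p st) = ls_seenI st" "ls_I (add_column x y p st) = ls_I st"
  "ls_T (add_column x y p st) = ls_T st" "ls_hist (add_column x y p st) = ls_hist st"
  "ls_zv (add_column x y p st) j = ls_zv st j + (if fst p = j then snd p * x else 0)"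
  "ls_zw (add_column x y p st) j = ls_zw st j + (if fst p = j then snd p * y else 0)"
  "ls_seenJ (add_column x y p st) j \<longleftrightarrow> ls_seenJ st j \<or> j = fst p"
  "ls_J (add_column x y p st) = (if ls_seenJ st (fst p) then ls_J st else fst p # ls_J st)"
  by (auto simp: add_column_def)

definition flags_listed :: "(nat \<Rightarrow> bool) \<Rightarrow> nat list \<Rightarrow> bool" where
  "flags_listed seen xs \<longleftrightarrow> distinct xs \<and> set xs = {i. seen i}"

lemma fold_add_column:
  "ls_v (fold (add_column x y) ps st) = ls_v st" "ls_w (fold (add_column x y) ps st) = ls_w st" "ls_seenI (fold (add_column x y) ps st) = ls_seenI st"
  "ls_I (fold (add_column x y) ps st) = ls_I st" "ls_T (fold (add_column x y) ps st) = ls_T st" "ls_hist (fold (add_column x y) ps st) = ls_hist st"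
  "ls_zv (fold (add_column x y) ps st) j = ls_zv st j + (\<Sum>p\<leftarrow>ps. if fst p = j then snd p * x else 0)"
  "ls_zw (fold (add_column x y) ps st) j = ls_zw st j + (\<Sum>p\<leftarrow>ps. if fst p = j then snd p * y else 0)"
  "ls_seenJ (fold (add_column x y) ps st) j \<longleftrightarrow> ls_seenJ st j \<or> j \<in> fst ` set ps"
  by (induction ps arbitrary: st) auto

lemma fold_add_column_J:
  "flags_listed (ls_seenJ st) (ls_J st) \<Longrightarrow> flags_listed (ls_seenJ (fold (add_column x y) ps st)) (ls_J (fold (add_column x y) ps st))"
proof (induction ps arbitrary: st)
  case (Cons p ps)
  have "flags_listed (ls_seenJ (add_column x y p st)) (ls_J (add_column x y p st))"
    using Cons(2) by (auto simp: flags_listed_def)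
  from Cons(1)[OF this] show ?case by simp
qed simp

lemma length_fold_add_column: "length (ls_J (fold (add_column x y) ps st)) \<le> length (ls_J st) + length ps"
proof (induction ps arbitrary: st)
  case (Cons p ps)
  show ?case using Cons[of "add_column x y p st"] by (simp split: if_splits)
qed simp

lemma push_coord_eq:
  "push_coord A i x y st =
    (fold (add_column x y) (nz_row A i)
      (st\<lparr>ls_v := (ls_v st)(i := ls_v st i + x), ls_w := (ls_w st)(i := ls_w st i + y),
         ls_seenI := (ls_seenI st)(i := True),
         ls_I := (if ls_seenI st i then ls_I st else i # ls_I st)\<rparr>), length (nz_row A i))"
  unfolding push_coord_def
  by (subst for_each_fold[where g = "add_column x y" and k = "\<lambda>_. 0"])
    (auto simp: add_column_def sum_list_triv)

lemma sum_update:
  fixes h v :: "nat \<Rightarrow> real"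
  assumes "i < m"
  shows "(\<Sum>k<m. h k * (v(i := v i + x)) k) = (\<Sum>k<m. h k * v k) + h i * x"
proof -
  have "(\<Sum>k<m. h k * (v(i := v i + x)) k) = (\<Sum>k<m. h k * v k + (if k = i then h i * x else 0))"
    by (intro sum.cong refl) (auto simp: algebra_simps)
  then show ?thesis using assms by (simp add: sum.distrib)
qed

lemma nz_row_sum_all:
  "(\<Sum>p\<leftarrow>nz_row A i. snd p * h (fst p)) = (\<Sum>j<dim_col A. A $$ (i, j) * (h j :: real))"
proof -
  have "(\<Sum>p\<leftarrow>nz_row A i. snd p * h (fst p)) = (\<Sum>k\<leftarrow>[0..<dim_col A]. A $$ (i, k) * h k)"
    unfolding nz_row_def map_map comp_def fst_conv snd_conv
    by (subst sum_list_map_filter) auto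
  then show ?thesis by (simp add: interv_sum_list_conv_sum_set_nat lessThan_atLeast0)
qed

lemma lazy_grad_eq:
  fixes b c :: "real vec" and \<gamma> :: real
  defines "E st T' \<zeta> j \<equiv> exp ((\<zeta> j + ls_zv st j + ls_zw st j / T' - c $ j) / \<gamma>)"
  shows "fst (lazy_grad A b c \<gamma> \<zeta> T' Bs st) i =
      (if i \<in> set Bs then - b $ i + (\<Sum>j<dim_col A. A $$ (i, j) * E st T' \<zeta> j) else 0)"
    and "snd (lazy_grad A b c \<gamma> \<zeta> T' Bs st) = (\<Sum>i\<leftarrow>Bs. 1 + length (nz_row A i))"
proof -
  define val where "val i = - b $ i + (\<Sum>j<dim_col A. A $$ (i, j) * E st T' \<zeta> j)" for i
  have acc: "fold (\<lambda>p g. g(i := g i + snd p * e (fst p))) ps g =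
      g(i := g i + (\<Sum>p\<leftarrow>ps. snd p * e (fst p)))" for i ps and g e :: "nat \<Rightarrow> real"
    by (induction ps arbitrary: g) (auto simp: fun_eq_iff)
  have row: "for_each (\<lambda>(j, a) g. (g(i := g i + a * exp ((\<zeta> j + ls_zv st j + ls_zw st j / T' - c $ j) / \<gamma>)), 0))
      (nz_row A i) (g(i := - b $ i)) = (g(i := val i), length (nz_row A i))" for i g
    by (subst for_each_fold[where g = "\<lambda>p g. g(i := g i + snd p * E st T' \<zeta> (fst p))" and k = "\<lambda>_. 0"])
      (auto simp: E_def[symmetric] acc val_def nz_row_sum_all sum_list_triv)
  have "lazy_grad A b c \<gamma> \<zeta> T' Bs st =
      (fold (\<lambda>i g. g(i := val i)) Bs (\<lambda>_. 0), \<Sum>i\<leftarrow>Bs. 1 + length (nz_row A i))"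
    unfolding lazy_grad_def row by (rule for_each_fold) simp
  then show "fst (lazy_grad A b c \<gamma> \<zeta> T' Bs st) i =
      (if i \<in> set Bs then - b $ i + (\<Sum>j<dim_col A. A $$ (i, j) * E st T' \<zeta> j) else 0)"
    "snd (lazy_grad A b c \<gamma> \<zeta> T' Bs st) = (\<Sum>i\<leftarrow>Bs. 1 + length (nz_row A i))"
    by (simp_all add: fold_set_entries val_def)
qed

text \<open>The part of the invariant that concerns the arrays: the projections are those of the
  stored vectors, and everything nonzero is listed exactly once for the reset.\<close>

definition arrays_ok :: "real mat \<Rightarrow> lazy_state \<Rightarrow> bool" where
  "arrays_ok A st \<longleftrightarrow>
    (\<forall>j<dim_col A. ls_zv st j = (\<Sum>i<dim_row A. A $$ (i, j) * ls_v st i) \<and>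
       ls_zw st j = (\<Sum>i<dim_row A. A $$ (i, j) * ls_w st i)) \<and>
    flags_listed (ls_seenI st) (ls_I st) \<and> flags_listed (ls_seenJ st) (ls_J st) \<and>
    set (ls_I st) \<subseteq> {..<dim_row A} \<and> set (ls_J st) \<subseteq> {..<dim_col A} \<and>
    (\<forall>i. \<not> ls_seenI st i \<longrightarrow> ls_v st i = 0 \<and> ls_w st i = 0) \<and>
    (\<forall>j. \<not> ls_seenJ st j \<longrightarrow> ls_zv st j = 0 \<and> ls_zw st j = 0)"

lemma push_coord_ok:
  fixes A :: "real mat" and x y :: real
  assumes ok: "arrays_ok A st" and i: "i < dim_row A"
  defines "st' \<equiv> fst (push_coord A i x y st)"
  shows "arrays_ok A st'"
    and "ls_v st' = (ls_v st)(i := ls_v st i + x)" and "ls_w st' = (ls_w st)(i := ls_w st i + y)"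
    and "ls_T st' = ls_T st" and "ls_hist st' = ls_hist st"
    and "length (ls_I st') \<le> Suc (length (ls_I st))"
    and "length (ls_J st') \<le> length (ls_J st) + length (nz_row A i)"
proof -
  let ?st = "st\<lparr>ls_v := (ls_v st)(i := ls_v st i + x), ls_w := (ls_w st)(i := ls_w st i + y),
         ls_seenI := (ls_seenI st)(i := True),
         ls_I := (if ls_seenI st i then ls_I st else i # ls_I st)\<rparr>"
  have st': "st' = fold (add_column x y) (nz_row A i) ?st"
    by (simp add: st'_def push_coord_eq)
  note props = fold_add_column[of x y "nz_row A i" ?st, folded st']
  show v: "ls_v st' = (ls_v st)(i := ls_v st i + x)" and w: "ls_w st' = (ls_w st)(i := ls_w st i + y)"
    "ls_T st' = ls_T st" "ls_hist st' = ls_hist st"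
    "length (ls_I st') \<le> Suc (length (ls_I st))"
    using props(1,2,4,5,6) by simp_all
  show "length (ls_J st') \<le> length (ls_J st) + length (nz_row A i)" using length_fold_add_column[of x y "nz_row A i" ?st] by (simp add: st')
  have z: "ls_zv st' j = ls_zv st j + (if j < dim_col A then A $$ (i, j) * x else 0)"
    "ls_zw st' j = ls_zw st j + (if j < dim_col A then A $$ (i, j) * y else 0)" for j
    using props(7,8)[of j] by (simp_all add: nz_row_sum)
  have sJ: "ls_seenJ st' j \<longleftrightarrow> ls_seenJ st j \<or> j \<in> fst ` set (nz_row A i)" for j
    using props(9)[of j] by simp
  have row: "fst ` set (nz_row A i) = {j. j < dim_col A \<and> A $$ (i, j) \<noteq> 0}"
    by (auto simp: nz_row_def image_image)
  have J: "flags_listed (ls_seenJ st') (ls_J st')"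
    unfolding st' by (rule fold_add_column_J) (use ok in \<open>simp add: arrays_ok_def\<close>)
  have I: "flags_listed (ls_seenI st') (ls_I st')"
    using ok props(3,4) by (auto simp: arrays_ok_def flags_listed_def)
  have "set (ls_J st) \<subseteq> {..<dim_col A}" "set (ls_J st) = {j. ls_seenJ st j}"
    using ok unfolding arrays_ok_def flags_listed_def by blast+
  moreover have "set (ls_J st') = {j. ls_seenJ st' j}" using J by (simp add: flags_listed_def)
  ultimately have Jsub: "set (ls_J st') \<subseteq> {..<dim_col A}" using row by (auto simp: sJ)
  have Isub: "set (ls_I st') \<subseteq> {..<dim_row A}"
    using ok props(4) i by (auto simp: arrays_ok_def)
  have vz: "ls_v st' k = 0 \<and> ls_w st' k = 0" if "\<not> ls_seenI st' k" for k
    using that ok props(3) by (auto simp: v w(1) arrays_ok_def split: if_splits)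
  have zz: "ls_zv st' j = 0 \<and> ls_zw st' j = 0" if "\<not> ls_seenJ st' j" for j
    using that ok row by (auto simp: z sJ arrays_ok_def)
  have zs: "ls_zv st' j = (\<Sum>i<dim_row A. A $$ (i, j) * ls_v st' i) \<and>
      ls_zw st' j = (\<Sum>i<dim_row A. A $$ (i, j) * ls_w st' i)" if "j < dim_col A" for j
    using that ok sum_update[OF i, of "\<lambda>i. A $$ (i, j)" "ls_v st" x]
      sum_update[OF i, of "\<lambda>i. A $$ (i, j)" "ls_w st" y]
    by (simp add: z v w(1) arrays_ok_def)
  show "arrays_ok A st'" unfolding arrays_ok_def using zs I J Jsub Isub vz zz by blast
qed

lemma push_block_ok:
  fixes A :: "real mat" and X Y :: "nat \<Rightarrow> real"
  assumes "arrays_ok A st" "set Bs \<subseteq> {..<dim_row A}" "distinct Bs"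
  defines "r \<equiv> for_each (\<lambda>i. push_coord A i (X i) (Y i)) Bs st"
  shows "arrays_ok A (fst r)"
    and "ls_v (fst r) i = ls_v st i + (if i \<in> set Bs then X i else 0)"
    and "ls_w (fst r) i = ls_w st i + (if i \<in> set Bs then Y i else 0)"
    and "ls_T (fst r) = ls_T st" and "ls_hist (fst r) = ls_hist st"
    and "length (ls_I (fst r)) \<le> length (ls_I st) + length Bs"
    and "length (ls_J (fst r)) \<le> length (ls_J st) + (\<Sum>i\<leftarrow>Bs. length (nz_row A i))"
    and "snd r = (\<Sum>i\<leftarrow>Bs. 1 + length (nz_row A i))"
proof -
  have eq: "for_each (\<lambda>i. push_coord A i (X i) (Y i)) Bs st =
      (fold (\<lambda>i st. fst (push_coord A i (X i) (Y i) st)) Bs st, \<Sum>i\<leftarrow>Bs. 1 + length (nz_row A i))"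
    for Bs st
    by (rule for_each_fold) (simp add: push_coord_eq)
  then show "snd r = (\<Sum>i\<leftarrow>Bs. 1 + length (nz_row A i))" by (simp add: r_def)
  define S where "S Bs st = fold (\<lambda>i st. fst (push_coord A i (X i) (Y i) st)) Bs st" for Bs st
  have "arrays_ok A (S Bs st) \<and>
    (\<forall>i. ls_v (S Bs st) i = ls_v st i + (if i \<in> set Bs then X i else 0)) \<and>
    (\<forall>i. ls_w (S Bs st) i = ls_w st i + (if i \<in> set Bs then Y i else 0)) \<and>
    ls_T (S Bs st) = ls_T st \<and> ls_hist (S Bs st) = ls_hist st \<and>
    length (ls_I (S Bs st)) \<le> length (ls_I st) + length Bs \<and>
    length (ls_J (S Bs st)) \<le> length (ls_J st) + (\<Sum>i\<leftarrow>Bs. length (nz_row A i))"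
    using assms(1-3)
  proof (induction Bs arbitrary: st)
    case Nil
    then show ?case by (simp add: S_def)
  next
    case (Cons k Bs)
    have k: "k < dim_row A" using Cons(3) by simp
    define st' where "st' = fst (push_coord A k (X k) (Y k) st)"
    note p = push_coord_ok[OF Cons(2) k, of "X k" "Y k", folded st'_def]
    have S: "S (k # Bs) st = S Bs st'" by (simp add: S_def st'_def)
    note IH = Cons(1)[OF p(1)]
    show ?case unfolding S using IH Cons(3,4) p(2-7) by auto
  qed
  then show "arrays_ok A (fst r)"
    "ls_v (fst r) i = ls_v st i + (if i \<in> set Bs then X i else 0)"
    "ls_w (fst r) i = ls_w st i + (if i \<in> set Bs then Y i else 0)"
    "ls_T (fst r) = ls_T st" "ls_hist (fst r) = ls_hist st"
    "length (ls_I (fst r)) \<le> length (ls_I st) + length Bs"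
    "length (ls_J (fst r)) \<le> length (ls_J st) + (\<Sum>i\<leftarrow>Bs. length (nz_row A i))"
    by (simp_all add: r_def eq S_def)
qed

lemma sum_list_block_cost:
  assumes "B \<subseteq> {..<dim_row A}"
  shows "(\<Sum>i\<leftarrow>sorted_list_of_set B. 1 + length (nz_row A i)) = block_cost A B"
    and "(\<Sum>i\<leftarrow>sorted_list_of_set B. length (nz_row A i)) = nnz_rows A B"
proof -
  have fin: "finite B" using assms by (rule finite_subset) simp
  have "(\<Sum>i\<leftarrow>sorted_list_of_set B. g i) = (\<Sum>i\<in>B. g i)" for g :: "nat \<Rightarrow> nat"
    using fin by (simp add: sum_list_distinct_conv_sum_set)
  then show "(\<Sum>i\<leftarrow>sorted_list_of_set B. 1 + length (nz_row A i)) = block_cost A B"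
    "(\<Sum>i\<leftarrow>sorted_list_of_set B. length (nz_row A i)) = nnz_rows A B"
    using sum_length_nz_row[OF fin assms] by (simp_all add: block_cost_def sum_Suc)
qed

locale lazy_phase = sumexp_phase A b c \<gamma> m n P us rule
  for A b c \<gamma> m n P us rule +
  fixes pc :: "nat set list \<Rightarrow> nat set \<Rightarrow> nat" and K :: nat
  assumes distinct_blocks: "distinct (blocks P)"
    and pc: "\<And>h B. B \<in> set (blocks P) \<Longrightarrow> pc h B \<le> K * block_cost A B"
begin

abbreviation "su \<equiv> fst (initialize A P)"
abbreviation "update \<equiv> lazy_update A b c \<gamma> P rule pc su"
abbreviation "lstep \<equiv> lazy_step A b c \<gamma> P rule pc su"
abbreviation "iterate \<equiv> lazy_iterate A b c \<gamma> P rule pc su"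

text \<open>From $w_k = T_k (u_k - v_k)$.\<close>
definition u_of :: "lazy_state \<Rightarrow> real vec" where
  "u_of st = vec m (\<lambda>i. anchor P $ i + ls_v st i + ls_w st i / ls_T st)"

definition v_of :: "lazy_state \<Rightarrow> real vec" where
  "v_of st = vec m (\<lambda>i. anchor P $ i + ls_v st i)"

definition represented :: "lazy_state \<Rightarrow> real vec \<times> real vec \<times> nat set list" where
  "represented st = (u_of st, v_of st, ls_hist st)"

definition consistent :: "lazy_state \<Rightarrow> bool" where
  "consistent st \<longleftrightarrow> arrays_ok A st \<and> ls_T st = T_seq P (length (ls_hist st))"

definition footprint :: "lazy_state \<Rightarrow> nat" where
  "footprint st = length (ls_I st) + length (ls_J st)"

lemma dim_anchor [simp]: "dim_vec (anchor P) = m"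
  using anchor by simp

lemma col_represented:
  assumes "arrays_ok A st" "j < n"
  shows "col A j \<bullet> vec m (\<lambda>i. anchor P $ i + ls_v st i + ls_w st i / T) =
    su_zeta su j + ls_zv st j + ls_zw st j / T"
proof -
  have "col A j \<bullet> vec m (\<lambda>i. anchor P $ i + ls_v st i + ls_w st i / T) =
      (\<Sum>i<m. A $$ (i, j) * (anchor P $ i + ls_v st i + ls_w st i / T))"
    using assms(2) by (subst col_sum) auto
  also have "\<dots> = (\<Sum>i<m. A $$ (i, j) * anchor P $ i) + (\<Sum>i<m. A $$ (i, j) * ls_v st i)
      + (\<Sum>i<m. A $$ (i, j) * ls_w st i) / T"
    by (simp add: distrib_left sum.distrib sum_divide_distrib)
  finally show ?thesis
    using assms initialize_eq(1)[OF distinct_blocks, of A j] by (simp add: arrays_ok_def)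
qed

lemma admissible_off_block:
  assumes "y \<in> carrier_vec m" "B \<in> set (blocks P)" "i < m" "i \<notin> B"
  shows "rule h y B $ i = y $ i"
  using rule assms by (auto simp: admissible_rule_def)

text \<open>One update performs the step of the algorithm on the represented point. Off the block the
  new point equals $y$ by admissibility, so only the coordinates of the block move.\<close>

lemma update_correct:
  assumes st: "consistent st" and B: "B \<in> set (blocks P)"
  defines "T \<equiv> T_seq P (length (ls_hist st))"
  defines "a \<equiv> incr_at P T"
  defines "y \<equiv> mix T a (u_of st) (v_of st)"
  shows "consistent (fst (update st B))"
    and "represented (fst (update st B)) =
      (rule (ls_hist st) y B, v_of st - (a / prob_at P T B) \<cdot>\<^sub>v block_grad f B y, ls_hist st @ [B])"
    and "snd (update st B) = 1 + 2 * block_cost A B + pc (ls_hist st) B"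
    and "footprint (fst (update st B)) \<le> footprint st + block_cost A B"
proof -
  have ok: "arrays_ok A st" and lsT: "ls_T st = T" using st by (auto simp: consistent_def T_def)
  have T: "0 < T" by (simp add: T_def T_seq_pos)
  have a: "0 < a" using incr[OF T] by (simp add: a_def)
  have Bm: "B \<subseteq> {..<dim_row A}" using block_subset[OF B] by simp
  have finB: "finite B" using Bm by (rule finite_subset) simp
  define Bs where "Bs = sorted_list_of_set B"
  have setBs: "set Bs = B" "distinct Bs" using finB by (auto simp: Bs_def)
  define \<xi> where "\<xi> = a / prob_at P T B"
  define y' where "y' = vec m (\<lambda>i. anchor P $ i + ls_v st i + ls_w st i / (T + a))"
  have M: "su_C0 su + sqrt (5 * (Pi_budget P / T)) * su_C1 su = M_at P T"
    by (simp add: initialize_eq(2,3)[OF distinct_blocks] M_at_def Delta_at_def)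
  have a_eq: "(1 + sqrt (1 + 4 * (M_at P T)\<^sup>2 * T)) / (2 * (M_at P T)\<^sup>2) = a"
    using incr_at_eq(1)[OF M_pos[OF T]] T by (simp add: a_def)
  have xi: "a / ((sqrt (kappa P B) + sqrt (5 * nu P B * (Pi_budget P / T))) / M_at P T) = \<xi>"
    by (simp add: \<xi>_def prob_at_def root_L_at_def Delta_at_def)
  have y_eq: "y' = y"
  proof (rule eq_vecI)
    fix i assume "i < dim_vec y"
    then have i: "i < m" by (simp add: y_def mix_def v_of_def)
    then have "y $ i = (T * (anchor P $ i + ls_v st i + ls_w st i / T) + a * (anchor P $ i + ls_v st i)) / (T + a)"
      unfolding y_def by (subst mix_index) (auto simp: u_of_def v_of_def lsT)
    also have "\<dots> = ((T + a) * (anchor P $ i + ls_v st i) + ls_w st i) / (T + a)"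
      using T by (simp add: algebra_simps)
    also have "\<dots> = y' $ i" using i T a by (simp add: y'_def add_divide_distrib)
    finally show "y' $ i = y $ i" by simp
  qed (simp add: y'_def y_def mix_def v_of_def)
  have y: "y \<in> carrier_vec m" unfolding y_eq[symmetric] by (simp add: y'_def)
  define g where "g = fst (lazy_grad A b c \<gamma> (su_zeta su) (T + a) Bs st)"
  have g: "g i = gradient y i" if "i \<in> B" for i
    using that unfolding g_def lazy_grad_eq gradient_def
    by (auto simp: setBs response_def y_eq[symmetric] y'_def col_represented[OF ok] intro!: sum.cong)
  have kg: "snd (lazy_grad A b c \<gamma> (su_zeta su) (T + a) Bs st) = block_cost A B"
    unfolding lazy_grad_eq Bs_def by (rule sum_list_block_cost(1)[OF Bm])
  have gk: "lazy_grad A b c \<gamma> (su_zeta su) (T + a) Bs st = (g, block_cost A B)"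
    by (simp add: g_def kg prod_eq_iff)
  define u where "u = rule (ls_hist st) y B"
  have u: "u \<in> carrier_vec m" unfolding u_def by (rule rule_props(1)[OF y B])
  define r where "r = for_each (\<lambda>i. push_coord A i (- \<xi> * g i) ((T + a) * (\<xi> * g i + (u $ i - y $ i)))) Bs st"
  have upd: "update st B = ((fst r)\<lparr>ls_T := T + a, ls_hist := ls_hist st @ [B]\<rparr>,
      1 + block_cost A B + pc (ls_hist st) B + snd r)"
    unfolding lazy_update_def Let_def lsT M a_eq xi Bs_def[symmetric] dim_anchor y'_def[symmetric]
      y_eq u_def[symmetric] gk prod.case r_def[symmetric]
    by (simp add: case_prod_beta)
  have "set Bs \<subseteq> {..<dim_row A}" using setBs Bm by simp
  note p = push_block_ok[OF ok this setBs(2), of "\<lambda>i. - \<xi> * g i"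
      "\<lambda>i. (T + a) * (\<xi> * g i + (u $ i - y $ i))", folded r_def]
  have kr: "snd r = block_cost A B"
    unfolding p(8) Bs_def by (rule sum_list_block_cost(1)[OF Bm])
  show "snd (update st B) = 1 + 2 * block_cost A B + pc (ls_hist st) B"
    unfolding upd by (simp add: kr)
  have "length Bs = card B" using setBs by (simp add: distinct_card[symmetric])
  then show "footprint (fst (update st B)) \<le> footprint st + block_cost A B"
    unfolding upd using p(6,7) sum_list_block_cost(2)[OF Bm]
    by (simp add: footprint_def block_cost_def Bs_def)
  show "consistent (fst (update st B))"
    unfolding upd using p(1) by (simp add: consistent_def arrays_ok_def T_def a_def)
  have "u_of (fst (update st B)) = u"
  proof (rule eq_vecI)
    fix i assume "i < dim_vec u"
    then have i: "i < m" using u by simp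
    have "y $ i = anchor P $ i + ls_v st i + ls_w st i / (T + a)"
      using i by (simp add: y_eq[symmetric] y'_def)
    moreover have "u $ i = y $ i" if "i \<notin> B"
      unfolding u_def by (rule admissible_off_block[OF y B i that])
    ultimately show "u_of (fst (update st B)) $ i = u $ i"
      using i T a unfolding upd by (simp add: u_of_def p(2,3) setBs add_divide_distrib)
  qed (use u in \<open>simp add: u_of_def\<close>)
  moreover have "v_of (fst (update st B)) = v_of st - \<xi> \<cdot>\<^sub>v block_grad f B y"
    unfolding upd using block_grad_carrier[OF y, of B]
    by (intro eq_vecI) (auto simp: v_of_def p(2) setBs g block_grad_index[OF y])
  ultimately show "represented (fst (update st B)) =
      (rule (ls_hist st) y B, v_of st - (a / prob_at P T B) \<cdot>\<^sub>v block_grad f B y, ls_hist st @ [B])"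
    by (simp add: represented_def u_def \<xi>_def upd)
qed

text \<open>Tossing the coin and then reading the corresponding alias table draws the block from the
  law of the algorithm. If all $\nu_B$ vanish, the weights of the second table cannot be
  normalized, but then the coin selects the first table with probability 1.\<close>

lemma lstep_eq:
  assumes st: "consistent st"
  shows "lstep (st, W) = map_pmf (\<lambda>B. (fst (update st B), W + 1 + snd (update st B)))
    (draw_block P (T_seq P (length (ls_hist st))))"
proof -
  define T where "T = T_seq P (length (ls_hist st))"
  have T: "0 < T" by (simp add: T_def T_seq_pos)
  have lsT: "ls_T st = T" using st by (simp add: consistent_def T_def)
  have M: "su_C0 su + sqrt (5 * (Pi_budget P / T)) * su_C1 su = M_at P T"
    by (simp add: initialize_eq(2,3)[OF distinct_blocks] M_at_def Delta_at_def)
  define G where "G = (\<lambda>B. (fst (update st B), W + 1 + snd (update st B)))"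
  have branch: "map_pmf (\<lambda>l. blocks P ! l) (alias_sample (length (blocks P)) (if coin then su_tab0 su else su_tab1 su))
    = (if coin then block_pmf (blocks P) (kappa P) else block_pmf (blocks P) (nu P))"
    if coin: "coin \<in> set_pmf (bernoulli_pmf (C0 P / M_at P T))" for coin
  proof (cases coin)
    case True
    then show ?thesis
      using alias_build_correct[OF kappa refl C0 distinct_blocks]
      by (simp add: initialize_eq(4)[OF distinct_blocks])
  next
    case False
    have "C0 P / M_at P T \<noteq> 1"
    proof
      assume "C0 P / M_at P T = 1"
      then have "pmf (bernoulli_pmf (C0 P / M_at P T)) False = 0" by simp
      then show False using coin False by (simp add: set_pmf_iff)
    qed
    then have "C1 P \<noteq> 0" using C0 by (auto simp: M_at_def)
    then have "0 < C1 P" using C1 by simp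
    then show ?thesis
      using False alias_build_correct[OF nu refl _ distinct_blocks]
      by (simp add: initialize_eq(5)[OF distinct_blocks])
  qed
  have "lstep (st, W) = bernoulli_pmf (C0 P / M_at P T) \<bind>
    (\<lambda>coin. map_pmf G (map_pmf (\<lambda>l. blocks P ! l)
      (alias_sample (length (blocks P)) (if coin then su_tab0 su else su_tab1 su))))"
    unfolding lazy_step_def prod.case lsT M
    unfolding initialize_eq(2)[OF distinct_blocks]
    by (simp add: G_def map_pmf_def bind_assoc_pmf bind_return_pmf Let_def case_prod_beta)
  also have "\<dots> = bernoulli_pmf (C0 P / M_at P T) \<bind>
    (\<lambda>coin. map_pmf G (if coin then block_pmf (blocks P) (kappa P) else block_pmf (blocks P) (nu P)))"
    by (intro bind_pmf_cong refl) (simp only: branch)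
  also have "\<dots> = map_pmf G (draw_block P T)"
    by (simp add: draw_block_def map_bind_pmf)
  finally show ?thesis unfolding G_def T_def .
qed

lemma lstep_represented:
  assumes st: "consistent st"
  shows "map_pmf (\<lambda>s. represented (fst s)) (lstep (st, W)) = bcd_step f P rule (represented st)"
  unfolding lstep_eq[OF st] represented_def[of st] bcd_step_eq map_pmf_comp fst_conv
  using update_correct(2)[OF st] set_draw_block(1)[OF T_seq_pos]
  by (intro map_pmf_cong refl) auto

lemma lazy_init_consistent: "consistent (lazy_init P)"
  by (simp add: consistent_def arrays_ok_def flags_listed_def lazy_init_def)

lemma lazy_init_represented: "represented (lazy_init P) = (anchor P, anchor P, [])"
  using anchor by (auto simp: represented_def u_of_def v_of_def lazy_init_def intro!: eq_vecI)

lemma iterate_consistent: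
  "s \<in> set_pmf (iterate k (lazy_init P, W)) \<Longrightarrow> consistent (fst s) \<and> length (ls_hist (fst s)) = k"
proof (induction k arbitrary: s)
  case 0
  then show ?case using lazy_init_consistent by (simp add: lazy_init_def)
next
  case (Suc k)
  then obtain st W' where s': "(st, W') \<in> set_pmf (iterate k (lazy_init P, W))"
    and s: "s \<in> set_pmf (lstep (st, W'))" by auto
  have st: "consistent st" "length (ls_hist st) = k" using Suc.IH[OF s'] by auto
  from s obtain B where "B \<in> set_pmf (draw_block P (T_seq P (length (ls_hist st))))"
    and "fst s = fst (update st B)"
    unfolding lstep_eq[OF st(1)] by auto
  then have B: "B \<in> set (blocks P)" "fst s = fst (update st B)"
    using set_draw_block(1)[OF T_seq_pos] by auto
  have "represented (fst (update st B)) = (u_of (fst s), v_of (fst s), ls_hist (fst s))"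
    by (simp add: B represented_def)
  then have "ls_hist (fst s) = ls_hist st @ [B]"
    using update_correct(2)[OF st(1) B(1)] by simp
  then show ?case using update_correct(1)[OF st(1) B(1)] B st by simp
qed

lemma iterate_represented:
  "map_pmf (\<lambda>s. represented (fst s)) (iterate k (lazy_init P, W)) = bcd_iterate f P rule k"
proof (induction k)
  case (Suc k)
  have "map_pmf (\<lambda>s. represented (fst s)) (iterate (Suc k) (lazy_init P, W)) =
    iterate k (lazy_init P, W) \<bind> (\<lambda>s. map_pmf (\<lambda>s. represented (fst s)) (lstep s))"
    by (simp add: map_bind_pmf)
  also have "\<dots> = iterate k (lazy_init P, W) \<bind> (\<lambda>s. bcd_step f P rule (represented (fst s)))"
  proof (intro bind_pmf_cong refl)
    fix s assume "s \<in> set_pmf (iterate k (lazy_init P, W))"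
    then have "consistent (fst s)" using iterate_consistent by blast
    then show "map_pmf (\<lambda>s. represented (fst s)) (lstep s) = bcd_step f P rule (represented (fst s))"
      using lstep_represented[of "fst s" "snd s"] by simp
  qed
  also have "\<dots> = bcd_iterate f P rule (Suc k)"
    by (simp add: Suc.IH[symmetric] bind_map_pmf)
  finally show ?case .
qed (simp add: lazy_init_represented)

end

section \<open>Phase ends, best candidates and repetitions\<close>

lemma fold_clear:
  "fold (\<lambda>i st. st\<lparr>ls_v := (ls_v st)(i := 0), ls_w := (ls_w st)(i := 0),
      ls_seenI := (ls_seenI st)(i := False)\<rparr>) is st =
    st\<lparr>ls_v := (\<lambda>i. if i \<in> set is then 0 else ls_v st i),
       ls_w := (\<lambda>i. if i \<in> set is then 0 else ls_w st i),
       ls_seenI := (\<lambda>i. if i \<in> set is then False else ls_seenI st i)\<rparr>"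
  "fold (\<lambda>j st. st\<lparr>ls_zv := (ls_zv st)(j := 0), ls_zw := (ls_zw st)(j := 0),
      ls_seenJ := (ls_seenJ st)(j := False)\<rparr>) js st =
    st\<lparr>ls_zv := (\<lambda>i. if i \<in> set js then 0 else ls_zv st i),
       ls_zw := (\<lambda>i. if i \<in> set js then 0 else ls_zw st i),
       ls_seenJ := (\<lambda>i. if i \<in> set js then False else ls_seenJ st i)\<rparr>"
proof -
  show "fold (\<lambda>i st. st\<lparr>ls_v := (ls_v st)(i := 0), ls_w := (ls_w st)(i := 0),
      ls_seenI := (ls_seenI st)(i := False)\<rparr>) is st =
    st\<lparr>ls_v := (\<lambda>i. if i \<in> set is then 0 else ls_v st i),
       ls_w := (\<lambda>i. if i \<in> set is then 0 else ls_w st i),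
       ls_seenI := (\<lambda>i. if i \<in> set is then False else ls_seenI st i)\<rparr>"
  proof (induction "is" arbitrary: st)
    case (Cons i "is")
    show ?case unfolding fold.simps comp_apply Cons
      by (rule lazy_state.equality; auto simp: fun_eq_iff)
  qed simp
  show "fold (\<lambda>j st. st\<lparr>ls_zv := (ls_zv st)(j := 0), ls_zw := (ls_zw st)(j := 0),
      ls_seenJ := (ls_seenJ st)(j := False)\<rparr>) js st =
    st\<lparr>ls_zv := (\<lambda>i. if i \<in> set js then 0 else ls_zv st i),
       ls_zw := (\<lambda>i. if i \<in> set js then 0 else ls_zw st i),
       ls_seenJ := (\<lambda>i. if i \<in> set js then False else ls_seenJ st i)\<rparr>"
  proof (induction js arbitrary: st)
    case (Cons j js)
    show ?case unfolding fold.simps comp_apply Cons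
      by (rule lazy_state.equality; auto simp: fun_eq_iff)
  qed simp
qed

lemma fold_cons: "fold (\<lambda>i xs. (i, d i) # xs) is xs = rev (map (\<lambda>i. (i, d i)) is) @ xs"
  by (induction "is" arbitrary: xs) auto

lemma map_of_entries:
  "map_of (rev (map (\<lambda>i. (i, d i)) is)) i = (if i \<in> set is then Some (d i) else None)"
proof (cases "i \<in> set is")
  case True
  have "map_of (rev (map (\<lambda>i. (i, d i)) is)) i \<noteq> None"
    using True by (subst map_of_eq_None_iff) (auto simp: image_image)
  then obtain y where y: "map_of (rev (map (\<lambda>i. (i, d i)) is)) i = Some y" by auto
  then have "(i, y) \<in> set (rev (map (\<lambda>i. (i, d i)) is))" by (rule map_of_SomeD)
  then show ?thesis using y True by auto
next
  case False
  then show ?thesis by (subst map_of_eq_None_iff[THEN iffD2]) (auto simp: image_image)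
qed

definition stored :: "nat list \<Rightarrow> nat list \<Rightarrow> (nat \<Rightarrow> real) \<Rightarrow> (nat \<Rightarrow> real) \<Rightarrow> real \<Rightarrow> candidate" where
  "stored is js du dz s = (s, rev (map (\<lambda>i. (i, du i)) is), rev (map (\<lambda>j. (j, dz j)) js))"

lemma candidate_point_init: "candidate_point z (0, [], []) = z"
  by (intro eq_vecI) (auto simp: candidate_point_def)

text \<open>The visited lists contain every nonzero entry, so clearing only the listed ones restores the
  zero arrays of the initial state.\<close>
lemma phase_end_eq:
  fixes b c \<gamma> P su st best
  defines "du i \<equiv> ls_v st i + ls_w st i / ls_T st"
  defines "dz j \<equiv> ls_zv st j + ls_zw st j / ls_T st"
  defines "diff \<equiv> - (\<Sum>i\<leftarrow>ls_I st. b $ i * du i) + (\<Sum>j\<leftarrow>ls_J st. \<gamma> *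
    (exp ((su_zeta su j + dz j - c $ j) / \<gamma>) - exp ((su_zeta su j - c $ j) / \<gamma>)))"
  shows "snd (fst (phase_end b c \<gamma> P su st best)) =
      (if diff < fst best then stored (ls_I st) (ls_J st) du dz diff else best)"
    and "snd (phase_end b c \<gamma> P su st best) =
      1 + 2 * (length (ls_I st) + length (ls_J st)) +
      (if diff < fst best then length (ls_I st) + length (ls_J st) else 0)"
    and "arrays_ok A st \<Longrightarrow> fst (fst (phase_end b c \<gamma> P su st best)) = lazy_init P"
proof -
  have s1: "for_each (\<lambda>i s. (s - b $ i * du i, 0)) (ls_I st) 0 =
      (- (\<Sum>i\<leftarrow>ls_I st. b $ i * du i), length (ls_I st))"
    using for_each_sum[of "\<lambda>i. - (b $ i * du i)" "ls_I st" 0] by (simp add: uminus_sum_list_map comp_def)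
  have s2: "for_each (\<lambda>j s. (s + \<gamma> * (exp ((su_zeta su j + dz j - c $ j) / \<gamma>)
        - exp ((su_zeta su j - c $ j) / \<gamma>)), 0)) (ls_J st) (- (\<Sum>i\<leftarrow>ls_I st. b $ i * du i)) =
      (diff, length (ls_J st))"
    unfolding for_each_sum diff_def ..
  have xs: "for_each (\<lambda>i xs. ((i, d i) # xs, 0)) is [] = (rev (map (\<lambda>i. (i, d i)) is), length is)"
    for d :: "nat \<Rightarrow> real" and "is"
    by (subst for_each_simple[where g = "\<lambda>i xs. (i, d i) # xs"]) (auto simp: fold_cons)
  note clear = for_each_simple[where g = "\<lambda>i st. st\<lparr>ls_v := (ls_v st)(i := 0), ls_w := (ls_w st)(i := 0),
      ls_seenI := (ls_seenI st)(i := False)\<rparr>", OF refl]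
    for_each_simple[where g = "\<lambda>j st. st\<lparr>ls_zv := (ls_zv st)(j := 0), ls_zw := (ls_zw st)(j := 0),
      ls_seenJ := (ls_seenJ st)(j := False)\<rparr>", OF refl]
  have eq: "phase_end b c \<gamma> P su st best =
    ((st\<lparr>ls_v := (\<lambda>i. if i \<in> set (ls_I st) then 0 else ls_v st i),
       ls_w := (\<lambda>i. if i \<in> set (ls_I st) then 0 else ls_w st i),
       ls_seenI := (\<lambda>i. if i \<in> set (ls_I st) then False else ls_seenI st i),
       ls_zv := (\<lambda>i. if i \<in> set (ls_J st) then 0 else ls_zv st i),
       ls_zw := (\<lambda>i. if i \<in> set (ls_J st) then 0 else ls_zw st i),
       ls_seenJ := (\<lambda>i. if i \<in> set (ls_J st) then False else ls_seenJ st i),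
       ls_I := [], ls_J := [], ls_T := T_init P, ls_hist := []\<rparr>,
      if diff < fst best then stored (ls_I st) (ls_J st) du dz diff else best),
     1 + length (ls_I st) + length (ls_J st)
      + (if diff < fst best then length (ls_I st) + length (ls_J st) else 0)
      + length (ls_I st) + length (ls_J st))"
    unfolding phase_end_def Let_def du_def[symmetric] dz_def[symmetric] s1 prod.case s2 xs clear fold_clear
    by (simp add: stored_def) (rule lazy_state.equality; simp add: fun_eq_iff)
  show "snd (fst (phase_end b c \<gamma> P su st best)) =
      (if diff < fst best then stored (ls_I st) (ls_J st) du dz diff else best)"
    by (simp add: eq)
  show "snd (phase_end b c \<gamma> P su st best) =
      1 + 2 * (length (ls_I st) + length (ls_J st)) +
      (if diff < fst best then length (ls_I st) + length (ls_J st) else 0)"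
    by (simp add: eq)
  show "fst (fst (phase_end b c \<gamma> P su st best)) = lazy_init P" if "arrays_ok A st"
    unfolding eq using that
    by (auto simp: arrays_ok_def flags_listed_def lazy_init_def fun_eq_iff intro!: lazy_state.equality)
qed

lemma card_block_pos:
  fixes m :: nat
  assumes "partition_on {..<m} Bs" "B \<in> Bs"
  shows "1 \<le> card B"
proof -
  from assms have "B \<subseteq> {..<m}" "B \<noteq> {}" by (auto simp: partition_on_def)
  moreover from this(1) have "finite B" by (rule finite_subset) simp
  ultimately show ?thesis by (simp add: Suc_le_eq card_gt_0_iff)
qed

lemma block_cost_pos: "partition_on {..<m} Bs \<Longrightarrow> B \<in> Bs \<Longrightarrow> 1 \<le> block_cost A B"
  using card_block_pos[of m Bs B] by (simp add: block_cost_def)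

lemma root_sum_le_weighted:
  assumes "partition_on {..<m} (set bs)" and w: "\<And>B. B \<in> set bs \<Longrightarrow> 0 \<le> w B"
  shows "root_sum bs w \<le> (\<Sum>B\<in>set bs. real (block_cost A B) * sqrt (w B))"
  unfolding root_sum_def
proof (rule sum_mono)
  fix B assume B: "B \<in> set bs"
  have "1 * sqrt (w B) \<le> real (block_cost A B) * sqrt (w B)"
    using block_cost_pos[OF assms(1) B, of A] w[OF B] by (intro mult_right_mono) auto
  then show "sqrt (w B) \<le> real (block_cost A B) * sqrt (w B)" by simp
qed

context lazy_phase
begin

text \<open>A stored candidate carries the exact difference of its objective from the anchor's, so
  comparing the stored numbers is comparing objectives.\<close>

definition candidate_ok :: "candidate \<Rightarrow> bool" where
  "candidate_ok best \<longleftrightarrow> fst best = f (candidate_point (anchor P) best) - f (anchor P)"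

definition better :: "real vec \<Rightarrow> real vec \<Rightarrow> real vec" where
  "better best u = (if f u < f best then u else best)"

lemma phase_end_correct:
  assumes st: "consistent st" and best: "candidate_ok best"
  defines "r \<equiv> phase_end b c \<gamma> P su st best"
  shows "fst (fst r) = lazy_init P"
    and "candidate_ok (snd (fst r))"
    and "candidate_point (anchor P) (snd (fst r)) = better (candidate_point (anchor P) best) (u_of st)"
    and "snd r \<le> 1 + 3 * footprint st"
proof -
  define du where "du i = ls_v st i + ls_w st i / ls_T st" for i
  define dz where "dz j = ls_zv st j + ls_zw st j / ls_T st" for j
  define diff where "diff = - (\<Sum>i\<leftarrow>ls_I st. b $ i * du i) + (\<Sum>j\<leftarrow>ls_J st. \<gamma> *
    (exp ((su_zeta su j + dz j - c $ j) / \<gamma>) - exp ((su_zeta su j - c $ j) / \<gamma>)))"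
  have ok: "arrays_ok A st" using st by (simp add: consistent_def)
  note eq = phase_end_eq[where b = b and c = c and \<gamma> = \<gamma> and P = P and su = su and st = st
      and best = best, folded du_def dz_def, folded diff_def]
  show "fst (fst r) = lazy_init P" unfolding r_def by (rule eq(3)[OF ok])
  show "snd r \<le> 1 + 3 * footprint st" unfolding r_def eq(2) footprint_def by simp
  have I: "distinct (ls_I st)" "set (ls_I st) \<subseteq> {..<m}" "\<And>i. i \<notin> set (ls_I st) \<Longrightarrow> du i = 0"
    using ok by (auto simp: arrays_ok_def flags_listed_def du_def)
  have J: "distinct (ls_J st)" "set (ls_J st) \<subseteq> {..<n}" "\<And>j. j \<notin> set (ls_J st) \<Longrightarrow> dz j = 0"
    using ok by (auto simp: arrays_ok_def flags_listed_def dz_def)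
  have u: "u_of st \<in> carrier_vec m" by (simp add: u_of_def)
  have "(\<Sum>i\<leftarrow>ls_I st. b $ i * du i) = (\<Sum>i\<in>set (ls_I st). b $ i * du i)"
    using I by (simp add: sum_list_distinct_conv_sum_set)
  also have "\<dots> = (\<Sum>i<m. b $ i * du i)"
    using I by (intro sum.mono_neutral_left) auto
  also have "\<dots> = b \<bullet> u_of st - b \<bullet> anchor P"
    using anchor by (simp add: scalar_prod_def u_of_def du_def lessThan_atLeast0 sum_subtractf[symmetric]
        algebra_simps)
  finally have bI: "(\<Sum>i\<leftarrow>ls_I st. b $ i * du i) = b \<bullet> u_of st - b \<bullet> anchor P" .
  have zeta: "su_zeta su j = col A j \<bullet> anchor P" if "j < n" for j
    using that col_sum[OF anchor that] initialize_eq(1)[OF distinct_blocks, of A j] by simp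
  have "(\<Sum>j\<leftarrow>ls_J st. \<gamma> * (exp ((su_zeta su j + dz j - c $ j) / \<gamma>) - exp ((su_zeta su j - c $ j) / \<gamma>)))
    = (\<Sum>j\<in>set (ls_J st). \<gamma> * (exp ((su_zeta su j + dz j - c $ j) / \<gamma>) - exp ((su_zeta su j - c $ j) / \<gamma>)))"
    using J by (simp add: sum_list_distinct_conv_sum_set)
  also have "\<dots> = (\<Sum>j<n. \<gamma> * (exp ((su_zeta su j + dz j - c $ j) / \<gamma>) - exp ((su_zeta su j - c $ j) / \<gamma>)))"
    using J by (intro sum.mono_neutral_left) auto
  also have "\<dots> = (\<Sum>j<n. \<gamma> * (exp ((col A j \<bullet> u_of st - c $ j) / \<gamma>) - exp ((col A j \<bullet> anchor P - c $ j) / \<gamma>)))"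
  proof (intro sum.cong refl)
    fix j assume "j \<in> {..<n}"
    then have j: "j < n" by simp
    have "col A j \<bullet> u_of st = su_zeta su j + dz j"
      unfolding u_of_def col_represented[OF ok j] by (simp add: dz_def)
    then show "\<gamma> * (exp ((su_zeta su j + dz j - c $ j) / \<gamma>) - exp ((su_zeta su j - c $ j) / \<gamma>)) =
      \<gamma> * (exp ((col A j \<bullet> u_of st - c $ j) / \<gamma>) - exp ((col A j \<bullet> anchor P - c $ j) / \<gamma>))"
      by (simp add: zeta[OF j])
  qed
  finally have diff: "diff = f (u_of st) - f (anchor P)"
    unfolding diff_def bI
    by (simp add: sumexp_def right_diff_distrib sum_subtractf sum_distrib_left)
  have point: "candidate_point (anchor P) (stored (ls_I st) (ls_J st) du dz diff) = u_of st"
    using I(3) by (intro eq_vecI)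
      (auto simp: candidate_point_def stored_def map_of_entries u_of_def du_def)
  have cmp: "diff < fst best \<longleftrightarrow> f (u_of st) < f (candidate_point (anchor P) best)"
    using best by (auto simp: diff candidate_ok_def)
  show "candidate_point (anchor P) (snd (fst r)) = better (candidate_point (anchor P) best) (u_of st)"
    unfolding r_def eq(1) using cmp by (simp add: better_def point)
  show "candidate_ok (snd (fst r))"
    unfolding r_def eq(1) using best point by (simp add: candidate_ok_def diff) (simp add: stored_def)
qed

abbreviation "restarts \<equiv> lazy_restarts A b c \<gamma> P rule pc su"
abbreviation "N \<equiv> n_iter P"

lemma candidate_ok_init: "candidate_ok (0, [], [])"
  by (simp add: candidate_ok_def candidate_point_init)

lemma restarts_Suc:
  assumes "\<not> returns_anchor P"
  shows "restarts (Suc J) = restarts J \<bind> (\<lambda>(st, best, W).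
    map_pmf (\<lambda>(st', W'). (fst (fst (phase_end b c \<gamma> P su st' best)), snd (fst (phase_end b c \<gamma> P su st' best)),
      W' + snd (phase_end b c \<gamma> P su st' best))) (iterate N (st, W + 1)))"
  using assms by (auto simp: map_pmf_def case_prod_beta Let_def intro!: bind_pmf_cong)

lemma restarts_invariant:
  assumes "\<not> returns_anchor P"
  shows "(st, best, W) \<in> set_pmf (restarts J) \<Longrightarrow> st = lazy_init P \<and> candidate_ok best"
proof (induction J arbitrary: st best W)
  case 0
  then show ?case by (simp add: candidate_ok_init)
next
  case (Suc J)
  from Suc.prems obtain st0 best0 W0 st' W' where
    s0: "(st0, best0, W0) \<in> set_pmf (restarts J)"
    and it: "(st', W') \<in> set_pmf (iterate N (st0, W0 + 1))"
    and eq: "st = fst (fst (phase_end b c \<gamma> P su st' best0))"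
      "best = snd (fst (phase_end b c \<gamma> P su st' best0))"
    unfolding restarts_Suc[OF assms] by auto
  have "st0 = lazy_init P" "candidate_ok best0" using Suc.IH[OF s0] by auto
  moreover from it have "consistent st'" using iterate_consistent \<open>st0 = lazy_init P\<close> by fastforce
  ultimately show ?case using phase_end_correct(1,2) eq by auto
qed

lemma best_of_snoc: "best_of f z (xs @ [u]) = better (best_of f z xs) u"
  by (simp add: best_of_def better_def)

lemma replicate_pmf_snoc:
  "replicate_pmf (Suc J) p = replicate_pmf J p \<bind> (\<lambda>xs. map_pmf (\<lambda>x. xs @ [x]) p)"
  using replicate_pmf_distrib[of J 1 p]
  by (simp add: map_pmf_def bind_assoc_pmf bind_return_pmf)

text \<open>Every repetition starts from the same cleared state, so the candidates are independent
  outputs of a phase, compared in the order in which they arrive.\<close>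
lemma restarts_best:
  assumes active: "\<not> returns_anchor P"
  shows "map_pmf (\<lambda>(st, best, W). candidate_point (anchor P) best) (restarts J) = bcd_restarts f P rule J"
proof (induction J)
  case 0
  show ?case by (simp add: bcd_restarts_def best_of_def candidate_point_init)
next
  case (Suc J)
  have step: "map_pmf (\<lambda>(st', W'). candidate_point (anchor P) (snd (fst (phase_end b c \<gamma> P su st' best))))
      (iterate N (lazy_init P, W)) =
    map_pmf (better (candidate_point (anchor P) best)) (bcd_phase f P rule)"
    if "candidate_ok best" for best W
  proof -
    have "map_pmf (\<lambda>(st', W'). candidate_point (anchor P) (snd (fst (phase_end b c \<gamma> P su st' best))))
        (iterate N (lazy_init P, W)) =
      map_pmf (\<lambda>s. better (candidate_point (anchor P) best) (fst (represented (fst s))))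
        (iterate N (lazy_init P, W))"
      using iterate_consistent phase_end_correct(3)[OF _ that]
      by (intro map_pmf_cong refl) (auto simp: represented_def)
    also have "\<dots> = map_pmf (better (candidate_point (anchor P) best)) (bcd_phase f P rule)"
      using active unfolding bcd_phase_def iterate_represented[symmetric, of _ W] by (simp add: map_pmf_comp)
    finally show ?thesis .
  qed
  have "map_pmf (\<lambda>(st, best, W). candidate_point (anchor P) best) (restarts (Suc J)) =
    restarts J \<bind> (\<lambda>(st, best, W). map_pmf (better (candidate_point (anchor P) best)) (bcd_phase f P rule))"
    unfolding restarts_Suc[OF active] map_bind_pmf
  proof (intro bind_pmf_cong refl)
    fix s assume s: "s \<in> set_pmf (restarts J)"
    obtain st best W where eq: "s = (st, best, W)" by (cases s)
    have inv: "st = lazy_init P" "candidate_ok best"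
      using restarts_invariant[OF active] s eq by auto
    show "map_pmf (\<lambda>(st, best, W). candidate_point (anchor P) best) (case s of (st, best, W) \<Rightarrow>
        map_pmf (\<lambda>(st', W'). (fst (fst (phase_end b c \<gamma> P su st' best)), snd (fst (phase_end b c \<gamma> P su st' best)),
          W' + snd (phase_end b c \<gamma> P su st' best))) (iterate N (st, W + 1))) =
      (case s of (st, best, W) \<Rightarrow> map_pmf (better (candidate_point (anchor P) best)) (bcd_phase f P rule))"
      using step[OF inv(2), of "W + 1"] by (simp add: eq inv(1) map_pmf_comp split_def)
  qed
  also have "\<dots> = map_pmf (\<lambda>(st, best, W). candidate_point (anchor P) best) (restarts J) \<bind>
      (\<lambda>x. map_pmf (better x) (bcd_phase f P rule))"
    by (simp add: bind_map_pmf split_def)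
  also have "\<dots> = bcd_restarts f P rule (Suc J)"
    unfolding Suc.IH bcd_restarts_def replicate_pmf_snoc
    by (simp add: bind_map_pmf map_bind_pmf map_pmf_comp best_of_snoc)
  finally show ?case .
qed

section \<open>Expected work in terms of the sampled blocks\<close>

definition mean_cost :: "real \<Rightarrow> real" where
  "mean_cost T = (\<Sum>B\<in>set (blocks P). prob_at P T B * real (block_cost A B))"

text \<open>The visited lists are paid for when they grow: the work so far plus three units per listed
  entry, which cover the comparison, the storage and the reset at the end of the phase,
  increases by at most a multiple of the cost of the sampled block.\<close>

definition charged :: "lazy_state \<times> nat \<Rightarrow> real" where
  "charged s = real (snd s) + 3 * real (footprint (fst s))"

lemma lstep_charged:
  assumes st: "consistent st"
  shows "measure_pmf.expectation (lstep (st, W)) charged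
    \<le> charged (st, W) + real (K + 7) * mean_cost (T_seq P (length (ls_hist st)))"
proof -
  let ?T = "T_seq P (length (ls_hist st))"
  have "measure_pmf.expectation (lstep (st, W)) charged =
    (\<Sum>B\<in>set (blocks P). prob_at P ?T B * charged (fst (update st B), W + 1 + snd (update st B)))"
    by (simp add: lstep_eq[OF st] expectation_draw_block T_seq_pos)
  also have "\<dots> \<le> (\<Sum>B\<in>set (blocks P). prob_at P ?T B * (charged (st, W) + real (K + 7) * real (block_cost A B)))"
  proof (intro sum_mono mult_left_mono)
    fix B assume B: "B \<in> set (blocks P)"
    show "0 \<le> prob_at P ?T B"
      unfolding prob_at_def by (intro divide_nonneg_pos root_L_nonneg M_pos T_seq_pos B)
    have "W + 1 + snd (update st B) + 3 * footprint (fst (update st B))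
        \<le> W + 3 * footprint st + (K + 7) * block_cost A B"
      using update_correct(3,4)[OF st B] pc[OF B, of "ls_hist st"] block_cost_pos[OF partition B, of A]
      by (simp add: algebra_simps)
    then have "real (W + 1 + snd (update st B) + 3 * footprint (fst (update st B)))
        \<le> real (W + 3 * footprint st + (K + 7) * block_cost A B)" by (rule of_nat_mono)
    then show "charged (fst (update st B), W + 1 + snd (update st B))
        \<le> charged (st, W) + real (K + 7) * real (block_cost A B)"
      by (simp add: charged_def algebra_simps)
  qed
  also have "\<dots> = (\<Sum>B\<in>set (blocks P). prob_at P ?T B * charged (st, W)) +
      (\<Sum>B\<in>set (blocks P). real (K + 7) * (prob_at P ?T B * real (block_cost A B)))"
    unfolding sum.distrib[symmetric]
    by (intro sum.cong refl) (simp only: distrib_left mult.left_commute)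
  also have "\<dots> = charged (st, W) + real (K + 7) * mean_cost ?T"
    by (simp only: sum_distrib_right[symmetric] sum_distrib_left[symmetric] sum_prob[OF T_seq_pos]
        mean_cost_def mult_1)
  finally show ?thesis .
qed

lemma finite_lstep: "consistent st \<Longrightarrow> finite (set_pmf (lstep (st, W)))"
  by (simp add: lstep_eq finite_draw_block T_seq_pos)

lemma finite_iterate: "finite (set_pmf (iterate k (lazy_init P, W)))"
proof (induction k)
  case (Suc k)
  have "finite (set_pmf (lstep s))" if "s \<in> set_pmf (iterate k (lazy_init P, W))" for s
    using finite_lstep[of "fst s" "snd s"] iterate_consistent[OF that] by simp
  then show ?case using Suc by simp
qed simp

lemma iterate_charged:
  "measure_pmf.expectation (iterate k (lazy_init P, W)) charged
    \<le> real W + real (K + 7) * (\<Sum>i<k. mean_cost (T_seq P i))"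
proof (induction k)
  case 0
  show ?case by (simp add: charged_def footprint_def lazy_init_def)
next
  case (Suc k)
  let ?p = "iterate k (lazy_init P, W)"
  have c: "consistent (fst s)" "length (ls_hist (fst s)) = k" if "s \<in> set_pmf ?p" for s
    using iterate_consistent[OF that] by auto
  have "measure_pmf.expectation (iterate (Suc k) (lazy_init P, W)) charged =
    measure_pmf.expectation ?p (\<lambda>s. measure_pmf.expectation (lstep s) charged)"
  proof -
    have "finite (set_pmf (lstep s))" if "s \<in> set_pmf ?p" for s
      using finite_lstep[OF c(1)[OF that], of "snd s"] by simp
    then show ?thesis by (simp add: expectation_bind_finite finite_iterate)
  qed
  also have "\<dots> \<le> measure_pmf.expectation ?p (\<lambda>s. charged s + real (K + 7) * mean_cost (T_seq P k))"
  proof (intro expectation_mono_finite finite_iterate)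
    fix s assume s: "s \<in> set_pmf ?p"
    show "measure_pmf.expectation (lstep s) charged \<le> charged s + real (K + 7) * mean_cost (T_seq P k)"
      using lstep_charged[OF c(1)[OF s], of "snd s"] c(2)[OF s] by simp
  qed
  also have "\<dots> = measure_pmf.expectation ?p charged + real (K + 7) * mean_cost (T_seq P k)"
    by (simp add: expectation_add_finite finite_iterate)
  finally show ?case using Suc.IH by (simp add: algebra_simps)
qed

lemma finite_restarts:
  assumes active: "\<not> returns_anchor P"
  shows "finite (set_pmf (restarts J))"
proof (induction J)
  case (Suc J)
  have "finite (set_pmf (iterate N (st, W + 1)))" if "(st, best, W) \<in> set_pmf (restarts J)" for st best W
    using restarts_invariant[OF active that] finite_iterate by simp
  then show ?case using Suc unfolding restarts_Suc[OF active] by auto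
qed simp

lemma restarts_work:
  assumes active: "\<not> returns_anchor P"
  shows "measure_pmf.expectation (restarts J) (\<lambda>(st, best, W). real W)
    \<le> real J * (2 + real (K + 7) * (\<Sum>i<N. mean_cost (T_seq P i)))"
proof (induction J)
  case (Suc J)
  let ?c = "2 + real (K + 7) * (\<Sum>i<N. mean_cost (T_seq P i))"
  let ?end = "\<lambda>best (st', W'). (fst (fst (phase_end b c \<gamma> P su st' best)), snd (fst (phase_end b c \<gamma> P su st' best)),
      W' + snd (phase_end b c \<gamma> P su st' best))"
  have fin: "finite (set_pmf (case s of (st, best, W) \<Rightarrow> map_pmf (?end best) (iterate N (st, W + 1))))"
    if "s \<in> set_pmf (restarts J)" for s
    using restarts_invariant[OF active] that finite_iterate by (cases s) auto
  have "measure_pmf.expectation (restarts (Suc J)) (\<lambda>(st, best, W). real W) =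
    measure_pmf.expectation (restarts J) (\<lambda>s. measure_pmf.expectation
      (case s of (st, best, W) \<Rightarrow> map_pmf (?end best) (iterate N (st, W + 1))) (\<lambda>(st, best, W). real W))"
    unfolding restarts_Suc[OF active]
    by (intro expectation_bind_finite finite_restarts[OF active] fin)
  also have "\<dots> \<le> measure_pmf.expectation (restarts J) (\<lambda>s. (case s of (st, best, W) \<Rightarrow> real W) + ?c)"
  proof (intro expectation_mono_finite finite_restarts[OF active])
    fix s assume s: "s \<in> set_pmf (restarts J)"
    obtain st best W where eq: "s = (st, best, W)" by (cases s)
    have inv: "st = lazy_init P" "candidate_ok best"
      using restarts_invariant[OF active] s eq by auto
    have "measure_pmf.expectation (map_pmf (?end best) (iterate N (lazy_init P, W + 1))) (\<lambda>(st, best, W). real W)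
      = measure_pmf.expectation (iterate N (lazy_init P, W + 1))
        (\<lambda>s. real (snd s) + real (snd (phase_end b c \<gamma> P su (fst s) best)))"
      by (simp add: case_prod_beta)
    also have "\<dots> \<le> measure_pmf.expectation (iterate N (lazy_init P, W + 1)) (\<lambda>s. charged s + 1)"
    proof (intro expectation_mono_finite finite_iterate)
      fix s assume "s \<in> set_pmf (iterate N (lazy_init P, W + 1))"
      then have "consistent (fst s)" using iterate_consistent by blast
      from phase_end_correct(4)[OF this inv(2)]
      have "real (snd (phase_end b c \<gamma> P su (fst s) best)) \<le> real (1 + 3 * footprint (fst s))"
        by (rule of_nat_mono)
      then show "real (snd s) + real (snd (phase_end b c \<gamma> P su (fst s) best)) \<le> charged s + 1"
        by (simp add: charged_def)
    qed
    also have "\<dots> = measure_pmf.expectation (iterate N (lazy_init P, W + 1)) charged + 1"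
      by (simp add: expectation_add_finite finite_iterate)
    also have "\<dots> \<le> real W + ?c"
      using iterate_charged[of N "W + 1"] by simp
    finally show "measure_pmf.expectation (case s of (st, best, W) \<Rightarrow> map_pmf (?end best) (iterate N (st, W + 1)))
        (\<lambda>(st, best, W). real W) \<le> (case s of (st, best, W) \<Rightarrow> real W) + ?c"
      by (simp add: eq inv(1))
  qed
  also have "\<dots> = measure_pmf.expectation (restarts J) (\<lambda>(st, best, W). real W) + ?c"
    by (simp add: expectation_add_finite finite_restarts[OF active])
  finally show ?case using Suc.IH by (simp add: algebra_simps)
qed simp

end

section \<open>Summing the step sizes\<close>

context phase
begin

lemma M_incr: "0 < T \<Longrightarrow> M_at P T * incr_at P T = sqrt (T + incr_at P T)"
  using incr[of T] M_pos[of T] by (intro real_sqrt_unique[symmetric]) (auto simp: power_mult_distrib)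

lemma T_seq_mono: "i \<le> j \<Longrightarrow> T_seq P i \<le> T_seq P j"
  by (rule lift_Suc_mono_le[of "T_seq P"]) (use incr(1)[OF T_seq_pos] in \<open>simp_all add: less_imp_le\<close>)

text \<open>Since $1 / M_k = (T_{k+1} - T_k) / \sqrt{T_{k+1}}$, the sum is a lower Riemann sum of
  $\int dT / \sqrt T$.\<close>

lemma sum_inverse_M: "(\<Sum>i<k. 1 / M_at P (T_seq P i)) \<le> 2 * sqrt (T_seq P k)"
proof (induction k)
  case 0
  show ?case using T_seq_pos[of 0] by simp
next
  case (Suc k)
  define T where "T = T_seq P k"
  define a where "a = incr_at P T"
  define M where "M = M_at P T"
  have T: "0 < T" by (simp add: T_def T_seq_pos)
  have M: "0 < M" and a: "0 < a" and Ma: "M * a = sqrt (T + a)"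
    using M_pos[OF T] incr[OF T] M_incr[OF T] by (auto simp: M_def a_def)
  have "a = (sqrt (T + a) - sqrt T) * (sqrt (T + a) + sqrt T)"
    using T a by (simp add: algebra_simps)
  also have "\<dots> \<le> (sqrt (T + a) - sqrt T) * (2 * sqrt (T + a))"
    using T a by (intro mult_left_mono) auto
  finally have "a * 1 \<le> a * (M * (2 * (sqrt (T + a) - sqrt T)))"
    unfolding Ma[symmetric] by (simp add: algebra_simps)
  then have "1 \<le> M * (2 * (sqrt (T + a) - sqrt T))"
    using a by (rule mult_left_le_imp_le)
  then have "1 / M \<le> 2 * (sqrt (T + a) - sqrt T)" using M by (simp add: field_simps)
  then show ?case using Suc by (simp add: T_def[symmetric] a_def[symmetric] M_def[symmetric])
qed

text \<open>The contribution of the constants $\nu_B$ to the expected cost of an iteration, per unit of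
  $S_1$.\<close>
definition local_share :: "real \<Rightarrow> real" where
  "local_share T = sqrt (5 * Delta_at P T) / M_at P T"

text \<open>The minimum of the two bounds is $\chi$ up to a constant; it does not depend on the iteration
  because $\Delta_k \le \Delta_0$.\<close>
lemma local_share_le:
  assumes T: "T_init P \<le> T" "0 < T_init P"
  shows "0 < C1 P \<Longrightarrow> local_share T \<le> 1 / C1 P"
    and "local_share T \<le> sqrt (10 * gap_bound P / level P) / C0 P"
proof -
  have T0: "0 < T" using T by simp
  define s where "s = sqrt (5 * Delta_at P T)"
  have s: "0 \<le> s" using Delta_pos[OF T0] by (simp add: s_def)
  have M: "M_at P T = C0 P + s * C1 P" by (simp add: M_at_def s_def)
  show "local_share T \<le> 1 / C1 P" if "0 < C1 P"
    unfolding local_share_def s_def[symmetric] M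
    using that C0 s M_pos[OF T0] unfolding M by (simp add: field_simps)
  have "Delta_at P T \<le> Pi_budget P / T_init P"
    unfolding Delta_at_def using T Pi_pos by (intro divide_left_mono) auto
  also have "\<dots> = 2 * gap_bound P / level P"
    using radius by (simp add: Pi_budget_def T_init_def field_simps)
  finally have "s \<le> sqrt (10 * gap_bound P / level P)" unfolding s_def by simp
  moreover have "C0 P \<le> M_at P T" by (rule M_ge_C0[OF T0])
  ultimately show "local_share T \<le> sqrt (10 * gap_bound P / level P) / C0 P"
    unfolding local_share_def s_def[symmetric] using C0 s by (intro frac_le) linarith+
qed

text \<open>If $M^2 T \ge 1$, the step at most triples \<open>T\<close> and its share is a Riemann term of
  $\int dT / T$. Otherwise \<open>T\<close> at least doubles, which happens only logarithmically often, and
  the uniform bound \<open>X\<close> on a single share is charged to the doubling.\<close>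

lemma local_share_step:
  assumes T: "0 < T" and X: "local_share T \<le> X" "0 \<le> X"
  defines "x \<equiv> (T + incr_at P T) / T"
  shows "local_share T \<le> (2 * sqrt (5 * Pi_budget P) + 2 * X) * ln x"
    and "local_share T \<le> 4 * sqrt (5 * Pi_budget P) + X"
proof -
  define a where "a = incr_at P T"
  define M where "M = M_at P T"
  define p where "p = sqrt (5 * Pi_budget P)"
  have M: "0 < M" and a: "0 < a" and Ma: "M * a = sqrt (T + a)" "M\<^sup>2 * a\<^sup>2 = T + a"
    using M_pos[OF T] incr[OF T] M_incr[OF T] by (auto simp: M_def a_def)
  have p: "0 \<le> p" using Pi_pos by (simp add: p_def)
  have x1: "1 < x" using T a by (simp add: x_def a_def)
  have share: "local_share T = p * ((a / (T + a)) * sqrt x)"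
  proof -
    have "local_share T = p / sqrt T / M"
      by (simp add: local_share_def Delta_at_def p_def M_def real_sqrt_divide)
    also have "\<dots> = p / sqrt T * (a / sqrt (T + a))"
      unfolding Ma(1)[symmetric] using a by simp
    also have "a / sqrt (T + a) = (a / (T + a)) * sqrt (T + a)"
    proof -
      define q where "q = sqrt (T + a)"
      have "0 < q" "T + a = q * q" using T a by (auto simp: q_def)
      then show ?thesis unfolding q_def[symmetric] by simp
    qed
    finally show ?thesis by (simp add: x_def a_def real_sqrt_divide)
  qed
  have ln_lower: "a / (T + a) \<le> ln x"
  proof -
    have "ln (1 / x) \<le> 1 / x - 1" using x1 by (intro ln_le_minus_one) simp
    moreover have "1 - 1 / x = a / (T + a)" using T a by (simp add: x_def a_def field_simps)
    ultimately show ?thesis using x1 by (simp add: ln_div)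
  qed
  have "local_share T \<le> (2 * p + 2 * X) * ln x \<and> local_share T \<le> 4 * p + X"
  proof (cases "1 \<le> M\<^sup>2 * T")
    case True
    have "a \<le> 2 * T"
    proof (rule ccontr)
      assume big: "\<not> a \<le> 2 * T"
      have "a * (M\<^sup>2 * a) = T + a" using Ma(2) by (simp add: power2_eq_square algebra_simps)
      moreover have "a * (M\<^sup>2 * (2 * T)) \<le> a * (M\<^sup>2 * a)"
        using big a M by (intro mult_left_mono) auto
      moreover have "a * 2 \<le> a * (M\<^sup>2 * (2 * T))"
        using True a by (intro mult_left_mono) auto
      ultimately show False using big T by linarith
    qed
    \<comment> \<open>On \<open>x \<le> 3\<close> both \<open>sqrt x\<close> and \<open>ln x\<close> are at most 2, which gives the constants.\<close>
    then have x3: "x \<le> 3" using T by (simp add: x_def a_def field_simps)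
    have "sqrt x \<le> sqrt 4" using x3 by (intro real_sqrt_le_mono) simp
    then have sx: "sqrt x \<le> 2" by simp
    have "(a / (T + a)) * sqrt x \<le> ln x * 2"
      using ln_lower sx a T x1 by (intro mult_mono) auto
    then have 1: "local_share T \<le> p * (ln x * 2)" unfolding share using p by (rule mult_left_mono)
    have "ln x \<le> 2" using ln_le_minus_one[of x] x1 x3 by simp
    then have "p * (ln x * 2) \<le> p * (2 * 2)" using p by (intro mult_left_mono) auto
    moreover have "0 \<le> X * ln x" using X x1 by simp
    ultimately show ?thesis using 1 X by (simp add: algebra_simps)
  next
    case False
    have "T \<le> a"
    proof (rule ccontr)
      assume "\<not> T \<le> a"
      then have "a * (M\<^sup>2 * a) \<le> a * (M\<^sup>2 * T)" using a M by (intro mult_left_mono) auto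
      also have "\<dots> \<le> a * 1" using False a by (intro mult_left_mono) auto
      finally show False using Ma(2) T by (simp add: power2_eq_square algebra_simps)
    qed
    then have "2 \<le> x" using T by (simp add: x_def a_def field_simps)
    have "1 / 2 \<le> ln x"
    proof -
      have "ln (1 / x) \<le> 1 / x - 1" using x1 by (intro ln_le_minus_one) simp
      moreover have "1 / x \<le> 1 / 2" using \<open>2 \<le> x\<close> by (simp add: field_simps)
      moreover have "ln (1 / x) = - ln x" using x1 by (simp add: ln_div)
      ultimately show ?thesis by linarith
    qed
    then have "X * 1 \<le> X * (2 * ln x)" using X by (intro mult_left_mono) auto
    moreover have "0 \<le> p * ln x" using p x1 by simp
    ultimately show ?thesis using X p by (simp add: algebra_simps)
  qed
  then show "local_share T \<le> (2 * sqrt (5 * Pi_budget P) + 2 * X) * ln x"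
    "local_share T \<le> 4 * sqrt (5 * Pi_budget P) + X" by (simp_all add: p_def)
qed

lemma T_before_halt:
  assumes "0 < target P"
  shows "1 \<le> n_iter P" and "i < n_iter P \<Longrightarrow> 1 \<le> i \<Longrightarrow> T_seq P i < Pi_budget P / target P"
proof -
  have ex: "\<exists>N. 1 \<le> N \<and> Pi_budget P / target P \<le> T_seq P N"
    using phase_halts[OF kappa nu C0 radius gap_bound level] by auto
  then show "1 \<le> n_iter P" unfolding n_iter_def by (rule LeastI2_ex) auto
  show "T_seq P i < Pi_budget P / target P" if "i < n_iter P" "1 \<le> i"
    using not_less_Least[of i "\<lambda>N. 1 \<le> N \<and> Pi_budget P / target P \<le> T_seq P N"] that
    unfolding n_iter_def by auto
qed

text \<open>The last step may overshoot the stopping level by far, so it is bounded on its own.\<close>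

lemma phase_sums:
  assumes target: "0 < target P"
  shows "(\<Sum>i<n_iter P. 1 / M_at P (T_seq P i)) \<le> 2 * sqrt (Pi_budget P / target P) + 1 / C0 P"
    and "\<lbrakk>\<And>k. local_share (T_seq P k) \<le> X; 0 \<le> X; target P * T_init P \<le> Pi_budget P\<rbrakk> \<Longrightarrow>
      (\<Sum>i<n_iter P. local_share (T_seq P i)) \<le>
        (2 * sqrt (5 * Pi_budget P) + 2 * X) * (ln (Pi_budget P / (target P * T_init P)) + 2)"
proof -
  obtain k where k: "n_iter P = Suc k" using T_before_halt(1)[OF target] by (cases "n_iter P") auto
  have Tk: "k = 0 \<or> T_seq P k < Pi_budget P / target P"
    using T_before_halt(2)[OF target, of k] k by (cases k) auto
  have "(\<Sum>i<k. 1 / M_at P (T_seq P i)) \<le> 2 * sqrt (Pi_budget P / target P)"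
  proof (cases "k = 0")
    case True
    then show ?thesis using Pi_pos target by simp
  next
    case False
    then have "sqrt (T_seq P k) \<le> sqrt (Pi_budget P / target P)" using Tk by simp
    then show ?thesis using sum_inverse_M[of k] by linarith
  qed
  moreover have "1 / M_at P (T_seq P k) \<le> 1 / C0 P"
    using M_ge_C0[OF T_seq_pos] C0 by (intro divide_left_mono) (auto simp: M_pos T_seq_pos)
  ultimately show "(\<Sum>i<n_iter P. 1 / M_at P (T_seq P i)) \<le> 2 * sqrt (Pi_budget P / target P) + 1 / C0 P"
    by (simp add: k)
  assume X: "\<And>k. local_share (T_seq P k) \<le> X" "0 \<le> X" and start: "target P * T_init P \<le> Pi_budget P"
  define p where "p = sqrt (5 * Pi_budget P)"
  have p: "0 \<le> p" using Pi_pos by (simp add: p_def)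
  have T0: "0 < T_init P" using T_seq_pos[of 0] by simp
  have "(\<Sum>i<j. local_share (T_seq P i)) \<le> (2 * p + 2 * X) * ln (T_seq P j / T_init P)" for j
  proof (induction j)
    case (Suc j)
    have "local_share (T_seq P j) \<le> (2 * p + 2 * X) * ln (T_seq P (Suc j) / T_seq P j)"
      using local_share_step(1)[OF T_seq_pos X(1,2), of j] by (simp add: p_def)
    moreover have "ln (T_seq P (Suc j) / T_init P) = ln (T_seq P (Suc j) / T_seq P j) + ln (T_seq P j / T_init P)"
      using T_seq_pos[of j] T_seq_pos[of "Suc j"] T0 by (simp add: ln_div)
    ultimately show ?case using Suc unfolding sum.lessThan_Suc by (simp only: distrib_left)
  qed (use T0 in simp)
  moreover have "ln (T_seq P k / T_init P) \<le> ln (Pi_budget P / (target P * T_init P))"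
  proof (cases "k = 0")
    case True
    then show ?thesis using T0 start target by simp
  next
    case False
    then have "T_seq P k / T_init P \<le> Pi_budget P / target P / T_init P"
      using Tk T0 by (intro divide_right_mono) auto
    then show ?thesis using T_seq_pos[of k] T0 by (intro ln_mono) auto
  qed
  then have "(2 * p + 2 * X) * ln (T_seq P k / T_init P) \<le>
      (2 * p + 2 * X) * ln (Pi_budget P / (target P * T_init P))"
    using p X by (intro mult_left_mono) auto
  ultimately have "(\<Sum>i<k. local_share (T_seq P i)) \<le>
      (2 * p + 2 * X) * ln (Pi_budget P / (target P * T_init P))" by (rule order_trans)
  moreover have "local_share (T_seq P k) \<le> 4 * p + X"
    using local_share_step(2)[OF T_seq_pos X(1,2), of k] by (simp add: p_def)
  ultimately show "(\<Sum>i<n_iter P. local_share (T_seq P i)) \<le>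
      (2 * sqrt (5 * Pi_budget P) + 2 * X) * (ln (Pi_budget P / (target P * T_init P)) + 2)"
    using X p by (simp add: k p_def[symmetric] distrib_left)
qed

end

context lazy_phase
begin

abbreviation "S0 \<equiv> \<Sum>B\<in>set (blocks P). real (block_cost A B) * sqrt (kappa P B)"
abbreviation "S1 \<equiv> \<Sum>B\<in>set (blocks P). real (block_cost A B) * sqrt (nu P B)"

lemma mean_cost_eq:
  assumes "0 < T"
  shows "mean_cost T = S0 * (1 / M_at P T) + S1 * local_share T"
proof -
  have "mean_cost T = (\<Sum>B\<in>set (blocks P). real (block_cost A B) * sqrt (kappa P B) * (1 / M_at P T)
      + real (block_cost A B) * sqrt (nu P B) * local_share T)"
    unfolding mean_cost_def prob_at_def root_L_at_def local_share_def
    by (intro sum.cong refl) (simp add: real_sqrt_mult add_divide_distrib distrib_left mult_ac)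
  then show ?thesis by (simp only: sum.distrib sum_distrib_right)
qed

lemma S_nonneg: "0 \<le> S0" "0 \<le> S1"
  using kappa nu by (auto intro!: sum_nonneg)

lemma S0_ge_C0: "C0 P \<le> S0"
  by (rule root_sum_le_weighted[OF partition kappa])

lemma S1_zero: "\<not> 0 < C1 P \<Longrightarrow> S1 = 0"
proof -
  assume "\<not> 0 < C1 P"
  then have "C1 P = 0" using C1 by simp
  then have "\<forall>B\<in>set (blocks P). sqrt (nu P B) = 0"
    unfolding root_sum_def using nu by (subst (asm) sum_nonneg_eq_0_iff) auto
  then show "S1 = 0" by simp
qed

lemma phase_cost:
  assumes target: "0 < target P" and start: "target P * T_init P \<le> Pi_budget P"
  defines "X \<equiv> (if 0 < C1 P then min (sqrt (10 * gap_bound P / level P) / C0 P) (1 / C1 P) else 0)"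
  shows "(\<Sum>i<n_iter P. mean_cost (T_seq P i)) \<le>
    S0 * (2 * sqrt (Pi_budget P / target P) + 1 / C0 P) +
    S1 * ((2 * sqrt (5 * Pi_budget P) + 2 * X) * (ln (Pi_budget P / (target P * T_init P)) + 2))"
proof -
  have T: "T_init P \<le> T_seq P k" "0 < T_init P" for k
    using T_seq_mono[of 0 k] T_seq_pos[of 0] by auto
  have "S1 * (\<Sum>i<n_iter P. local_share (T_seq P i)) \<le>
    S1 * ((2 * sqrt (5 * Pi_budget P) + 2 * X) * (ln (Pi_budget P / (target P * T_init P)) + 2))"
  proof (cases "0 < C1 P")
    case True
    have "local_share (T_seq P k) \<le> X" for k
      using True local_share_le[OF T] by (simp add: X_def)
    moreover have "0 \<le> X" using True C0 gap_bound level by (simp add: X_def)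
    ultimately show ?thesis
      using start by (intro mult_left_mono phase_sums(2)[OF target] S_nonneg) auto
  next
    case False
    then have "S1 = 0" by (rule S1_zero)
    then show ?thesis by (simp only: mult_zero_left order_refl)
  qed
  moreover have "S0 * (\<Sum>i<n_iter P. 1 / M_at P (T_seq P i)) \<le> S0 * (2 * sqrt (Pi_budget P / target P) + 1 / C0 P)"
    by (intro mult_left_mono phase_sums(1)[OF target] S_nonneg)
  moreover have "(\<Sum>i<n_iter P. mean_cost (T_seq P i)) =
      S0 * (\<Sum>i<n_iter P. 1 / M_at P (T_seq P i)) + S1 * (\<Sum>i<n_iter P. local_share (T_seq P i))"
    by (simp only: mean_cost_eq[OF T_seq_pos] sum.distrib sum_distrib_left)
  ultimately show ?thesis by linarith
qed

end

section \<open>Assembling the bounds\<close>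

text \<open>A zero radius makes the anchor a minimizer. The phases then return it at once, and each
  repetition costs two units.\<close>
lemma inactive_restarts: "returns_anchor P \<Longrightarrow> bcd_restarts f P rule J = return_pmf (anchor P)"
proof -
  assume "returns_anchor P"
  then have phase: "bcd_phase f P rule = return_pmf (anchor P)" by (simp add: bcd_phase_def)
  have "replicate_pmf J (return_pmf z) = return_pmf (replicate J z)" for z :: "real vec"
    by (induction J) (simp_all add: bind_return_pmf)
  moreover have "best_of f z (replicate J z) = z" for z
    unfolding best_of_def by (induction J) auto
  ultimately show ?thesis by (simp add: bcd_restarts_def phase)
qed

lemma inactive_lazy_restarts:
  assumes "returns_anchor P"
  shows "lazy_restarts A b c \<gamma> P rule pc su J = return_pmf (lazy_init P, (0, [], []), 2 * J)"
proof (induction J)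
  case (Suc J)
  have ok: "arrays_ok A (lazy_init P)"
    by (simp add: arrays_ok_def flags_listed_def lazy_init_def)
  note pe = phase_end_eq[where b = b and c = c and \<gamma> = \<gamma> and P = P and su = su
      and st = "lazy_init P" and best = "(0, [], [])"]
  have "snd (fst (phase_end b c \<gamma> P su (lazy_init P) (0, [], []))) = (0, [], [])"
    unfolding pe(1) by (simp add: lazy_init_def)
  moreover have "snd (phase_end b c \<gamma> P su (lazy_init P) (0, [], [])) = 1"
    unfolding pe(2) by (simp add: lazy_init_def)
  ultimately have "phase_end b c \<gamma> P su (lazy_init P) (0, [], []) = ((lazy_init P, (0, [], [])), 1)"
    using pe(3)[OF ok] by (simp add: prod_eq_iff)
  then show ?case using assms Suc by (simp add: bind_return_pmf)
qed simp

lemma card_blocks_le: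
  assumes "partition_on {..<m} Bs"
  shows "card Bs \<le> m"
proof -
  have "1 \<le> real (card B)" if "B \<in> Bs" for B
    using card_block_pos[OF assms that] by simp
  then have "(\<Sum>B\<in>Bs. 1) \<le> (\<Sum>B\<in>Bs. real (card B))" by (intro sum_mono)
  also have "\<dots> = real m" using sum_partition_on[OF assms, of "\<lambda>_. 1"] by simp
  finally show ?thesis by simp
qed

text \<open>The number of copies is chosen so that $3^J \ge 2 \bar\Delta / \varepsilon$.\<close>
lemma copies_bounds:
  fixes \<Delta> \<epsilon> :: real
  assumes "0 < \<epsilon>" "\<epsilon> < \<Delta>"
  defines "J \<equiv> nat \<lceil>ln (2 * \<Delta> / \<epsilon>) / ln 3\<rceil>"
  shows "\<Delta> * (1 / 3) ^ J \<le> \<epsilon> / 2" and "real J \<le> 2 * (1 + ln (\<Delta> / \<epsilon>))"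
proof -
  have ratio: "1 < \<Delta> / \<epsilon>" using assms by simp
  have split: "ln (2 * \<Delta> / \<epsilon>) = ln 2 + ln (\<Delta> / \<epsilon>)"
    using assms(1,2) ln_mult[of 2 "\<Delta> / \<epsilon>"] by simp
  have L: "0 < ln (\<Delta> / \<epsilon>)" using ratio by simp
  have ln2: "0 < ln (2 :: real)" "ln (2 :: real) \<le> 1" using ln_le_minus_one[of 2] by auto
  have ln3: "1 \<le> ln (3 :: real)" using exp_le by (subst ln_ge_iff) auto
  have J: "real J = of_int \<lceil>ln (2 * \<Delta> / \<epsilon>) / ln 3\<rceil>"
  proof -
    have "0 \<le> ln (2 * \<Delta> / \<epsilon>) / ln 3" using L ln2 ln3 unfolding split by simp
    then show ?thesis unfolding J_def by (subst of_nat_nat) linarith+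
  qed
  have "ln (2 * \<Delta> / \<epsilon>) / ln 3 \<le> real J" unfolding J by (rule le_of_int_ceiling)
  then have "ln (2 * \<Delta> / \<epsilon>) \<le> real J * ln 3" using ln3 by (simp add: field_simps)
  also have "\<dots> = ln (3 ^ J)" by (simp add: ln_realpow)
  finally have "2 * \<Delta> / \<epsilon> \<le> 3 ^ J" using assms by (subst (asm) ln_le_cancel_iff) auto
  then show "\<Delta> * (1 / 3) ^ J \<le> \<epsilon> / 2" using assms by (simp add: power_divide field_simps)
  have "real J \<le> ln (2 * \<Delta> / \<epsilon>) / ln 3 + 1" unfolding J by linarith
  moreover have "(ln 2 + ln (\<Delta> / \<epsilon>)) / ln 3 \<le> (ln 2 + ln (\<Delta> / \<epsilon>)) / 1"
    using ln3 L ln2 by (intro divide_left_mono) auto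
  ultimately show "real J \<le> 2 * (1 + ln (\<Delta> / \<epsilon>))" using ln2 L unfolding split by simp
qed

context lazy_phase
begin

text \<open>The logarithm enters once through the number of copies and once through the growth of
  \<open>T\<close> within a phase, by a factor of about $12 \bar\Delta / \varepsilon$; constant parts of the work
  are absorbed because $S_0 \ge C_0$.\<close>

lemma restarts_work_log_sq:
  assumes eps: "0 < \<epsilon>" "\<epsilon> < gap_bound P" and lv: "level P = 1 / 3" and tg: "target P = \<epsilon> / 2"
  defines "L \<equiv> ln (gap_bound P / \<epsilon>)"
  defines "\<chi> \<equiv> (if 0 < C1 P then min (sqrt (2 * gap_bound P) / C0 P) (1 / C1 P) else 0)"
  defines "G \<equiv> S0 / C0 P + radius P * S0 / sqrt \<epsilon> + radius P * S1 + \<chi> * S1"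
  assumes J: "real J \<le> 2 * (1 + L)"
  shows "measure_pmf.expectation (restarts J) (\<lambda>(st, best, W). real W)
    \<le> (4 + 208 * (real K + 7)) * (1 + L) ^ 2 * G"
proof -
  let ?r = "radius P"
  define X where "X = (if 0 < C1 P then min (sqrt (10 * gap_bound P / level P) / C0 P) (1 / C1 P) else 0)"
  have active: "\<not> returns_anchor P"
    using C0 radius gap_bound eps tg by (simp add: returns_anchor_def)
  have L: "0 \<le> L" using eps by (simp add: L_def)
  have chi: "0 \<le> \<chi>" using C0 gap_bound by (simp add: \<chi>_def)
  have S: "0 \<le> S0" "0 \<le> S1" by (rule S_nonneg)+
  have "1 \<le> S0 / C0 P" using S0_ge_C0 C0 by simp
  then have G: "1 \<le> G" "0 \<le> ?r * S0 / sqrt \<epsilon>" "0 \<le> ?r * S1" "0 \<le> \<chi> * S1" "0 \<le> S0 / C0 P"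
    using S chi radius eps unfolding G_def by (auto intro!: add_increasing2)
  have Pi: "Pi_budget P = 3 * ?r\<^sup>2" by (simp add: Pi_budget_def lv)
  have ratio: "Pi_budget P / (target P * T_init P) = 12 * (gap_bound P / \<epsilon>)"
    using radius gap_bound eps by (simp add: Pi tg T_init_def field_simps)
  have start: "target P * T_init P \<le> Pi_budget P"
  proof -
    have "\<epsilon> * ?r\<^sup>2 \<le> 12 * gap_bound P * ?r\<^sup>2" using eps by (intro mult_right_mono) auto
    then show ?thesis using gap_bound by (simp add: Pi tg T_init_def field_simps)
  qed
  \<comment> \<open>The constants absorb \<open>sqrt 6 \<le> 5 / 2\<close>, from $\Pi / \varepsilon' = 6 r^2 / \varepsilon$, and
    \<open>sqrt 15 \<le> 4\<close>, from $5 \Pi = 15 r^2$ and from $\Delta_0 = 6 \bar\Delta$.\<close>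
  have root1: "sqrt (Pi_budget P / target P) \<le> 5 / 2 * (?r / sqrt \<epsilon>)"
  proof (rule real_le_lsqrt)
    have "Pi_budget P / target P = 6 * (?r\<^sup>2 / \<epsilon>)" by (simp add: Pi tg)
    also have "\<dots> \<le> (25 / 4) * (?r\<^sup>2 / \<epsilon>)" using eps by (intro mult_right_mono) auto
    also have "\<dots> = (5 / 2 * (?r / sqrt \<epsilon>))\<^sup>2"
      using eps by (simp add: power_mult_distrib power_divide)
    finally show "Pi_budget P / target P \<le> (5 / 2 * (?r / sqrt \<epsilon>))\<^sup>2" .
  qed (use radius eps in auto)
  have root2: "sqrt (5 * Pi_budget P) \<le> 4 * ?r"
  proof (rule real_le_lsqrt)
    show "5 * Pi_budget P \<le> (4 * ?r)\<^sup>2" by (simp add: Pi power_mult_distrib)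
  qed (use radius in auto)
  have X: "X \<le> 4 * \<chi>"
  proof (cases "0 < C1 P")
    case True
    have "sqrt (10 * gap_bound P / level P) \<le> sqrt (4\<^sup>2 * (2 * gap_bound P))"
      using gap_bound by (intro real_sqrt_le_mono) (simp add: lv)
    also have "\<dots> = 4 * sqrt (2 * gap_bound P)" unfolding real_sqrt_mult[of "4\<^sup>2"] by simp
    finally have "sqrt (10 * gap_bound P / level P) / C0 P \<le> 4 * (sqrt (2 * gap_bound P) / C0 P)"
      using C0 by (simp add: divide_right_mono)
    moreover have "1 / C1 P \<le> 4 * (1 / C1 P)" using True by (simp add: field_simps)
    ultimately show ?thesis using True by (simp add: X_def \<chi>_def min_def)
  qed (simp add: X_def \<chi>_def)
  have X0: "0 \<le> X" using C0 gap_bound level by (simp add: X_def)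
  have "ln (12 * (gap_bound P / \<epsilon>)) = ln 12 + L"
    unfolding L_def using eps by (subst ln_mult) auto
  moreover have "ln (12 :: real) \<le> 11" using ln_le_minus_one[of 12] by simp
  ultimately have ln: "ln (12 * (gap_bound P / \<epsilon>)) + 2 \<le> 13 * (1 + L)" using L by simp
  have "0 \<le> ln (12 * (gap_bound P / \<epsilon>)) + 2"
    using eps by (intro add_nonneg_nonneg ln_ge_zero) (auto simp: field_simps)
  then have "(2 * sqrt (5 * Pi_budget P) + 2 * X) * (ln (12 * (gap_bound P / \<epsilon>)) + 2)
      \<le> (8 * ?r + 8 * \<chi>) * (13 * (1 + L))"
    using root2 X X0 ln radius chi by (intro mult_mono) auto
  then have "S1 * ((2 * sqrt (5 * Pi_budget P) + 2 * X) * (ln (12 * (gap_bound P / \<epsilon>)) + 2))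
      \<le> S1 * ((8 * ?r + 8 * \<chi>) * (13 * (1 + L)))"
    using S by (intro mult_left_mono)
  moreover have "S0 * (2 * sqrt (Pi_budget P / target P) + 1 / C0 P) \<le> S0 * (5 * (?r / sqrt \<epsilon>) + 1 / C0 P)"
    using root1 S by (intro mult_left_mono) auto
  moreover have "(\<Sum>i<N. mean_cost (T_seq P i)) \<le> S0 * (2 * sqrt (Pi_budget P / target P) + 1 / C0 P) +
      S1 * ((2 * sqrt (5 * Pi_budget P) + 2 * X) * (ln (12 * (gap_bound P / \<epsilon>)) + 2))"
    using phase_cost[OF _ start] eps unfolding X_def[symmetric] ratio by (simp add: tg)
  ultimately have "(\<Sum>i<N. mean_cost (T_seq P i)) \<le>
      S0 * (5 * (?r / sqrt \<epsilon>) + 1 / C0 P) + S1 * ((8 * ?r + 8 * \<chi>) * (13 * (1 + L)))"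
    by linarith
  also have "\<dots> = S0 / C0 P + 5 * (?r * S0 / sqrt \<epsilon>) + 104 * (1 + L) * (?r * S1 + \<chi> * S1)"
    by (simp add: algebra_simps)
  also have "\<dots> \<le> 104 * (1 + L) * (S0 / C0 P) + 104 * (1 + L) * (?r * S0 / sqrt \<epsilon>)
      + 104 * (1 + L) * (?r * S1 + \<chi> * S1)"
  proof (intro add_mono order_refl)
    show "S0 / C0 P \<le> 104 * (1 + L) * (S0 / C0 P)"
      using mult_right_mono[of 1 "104 * (1 + L)", OF _ G(5)] L by simp
    show "5 * (?r * S0 / sqrt \<epsilon>) \<le> 104 * (1 + L) * (?r * S0 / sqrt \<epsilon>)"
      by (rule mult_right_mono[OF _ G(2)]) (use L in simp)
  qed
  also have "\<dots> = 104 * (1 + L) * G" by (simp add: G_def algebra_simps)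
  finally have mean: "(\<Sum>i<N. mean_cost (T_seq P i)) \<le> 104 * (1 + L) * G" .
  have "measure_pmf.expectation (restarts J) (\<lambda>(st, best, W). real W)
    \<le> real J * (2 + real (K + 7) * (\<Sum>i<N. mean_cost (T_seq P i)))"
    by (rule restarts_work[OF active])
  also have "\<dots> \<le> real J * (2 * ((1 + L) * G) + (real K + 7) * (104 * (1 + L) * G))"
  proof (intro mult_left_mono add_mono)
    have "1 * 1 \<le> (1 + L) * G" using L G by (intro mult_mono) auto
    then show "2 \<le> 2 * ((1 + L) * G)" by simp
  qed (use mean in auto)
  also have "\<dots> \<le> 2 * (1 + L) * (2 * ((1 + L) * G) + (real K + 7) * (104 * (1 + L) * G))"
    using J L G by (intro mult_right_mono) auto
  also have "\<dots> = (4 + 208 * (real K + 7)) * (1 + L) ^ 2 * G"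
    by (simp add: power2_eq_square algebra_simps)
  finally show ?thesis .
qed

end

theorem theorem4p3:
  fixes K :: nat
  shows "\<exists>(Const :: real) (p :: nat).
    \<forall>(m :: nat) (n :: nat) (A :: real mat) (b :: real vec) (c :: real vec) (\<gamma> :: real)
     (bs :: nat set list) (\<kappa> :: nat set \<Rightarrow> real) (\<nu> :: nat set \<Rightarrow> real)
     (z :: real vec) (\<Delta> :: real) (r :: real) (\<epsilon> :: real)
     (rule :: rule) (pc :: nat set list \<Rightarrow> nat set \<Rightarrow> nat).
    let f = sumexp A b c \<gamma>;
        F = gap m f;
        P = \<lparr>blocks = bs, kappa = \<kappa>, nu = \<nu>, anchor = z, gap_bound = \<Delta>, radius = r,
             level = 1 / 3, target = \<epsilon> / 2\<rparr>;
        J = nat \<lceil>ln (2 * \<Delta> / \<epsilon>) / ln 3\<rceil>;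
        S0 = (\<Sum>B\<in>set bs. real (block_cost A B) * sqrt (\<kappa> B));
        S1 = (\<Sum>B\<in>set bs. real (block_cost A B) * sqrt (\<nu> B));
        \<chi> = (if 0 < C1 P then min (sqrt (2 * \<Delta>) / C0 P) (1 / C1 P) else 0)
    in
      A \<in> carrier_mat m n \<and> b \<in> carrier_vec m \<and> c \<in> carrier_vec n \<and> 0 < \<gamma> \<and>
      (\<exists>q\<in>carrier_vec m. A\<^sup>T *\<^sub>v q = vec n (\<lambda>_. 1) \<and> q \<bullet> b = 1) \<and>
      (\<exists>x\<in>carrier_vec n. (\<forall>j<n. 0 < x $ j) \<and> A *\<^sub>v x = b) \<and>
      distinct bs \<and> partition_on {..<m} (set bs) \<and>
      (\<forall>B\<in>set bs. 0 \<le> \<kappa> B \<and> 0 \<le> \<nu> B) \<and>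
      (\<forall>u\<in>carrier_vec m. \<forall>B\<in>set bs.
         loewner_on B (\<lambda>i j. 0) (hessian f u) \<and>
         loewner_on B (hessian f u) (\<lambda>i j. if i = j then \<kappa> B + \<nu> B * F u else 0)) \<and>
      0 < C0 P \<and> z \<in> carrier_vec m \<and> F z \<le> \<Delta> \<and>
      (\<exists>us. is_arg_min f (\<lambda>u. u \<in> carrier_vec m) us \<and> norm2 (z - us) \<le> r) \<and>
      0 < \<epsilon> \<and> \<epsilon> < \<Delta> \<and>
      admissible_rule f P rule \<and>
      (\<forall>h. \<forall>B\<in>set bs. pc h B \<le> K * block_cost A B)
      \<longrightarrow>
      measure_pmf.expectation (bcd_restarts f P rule J) F \<le> \<epsilon> \<and>
      map_pmf fst (lazy_run A b c \<gamma> P rule pc J) = bcd_restarts f P rule J \<and>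
      measure_pmf.expectation (lazy_run A b c \<gamma> P rule pc J) (\<lambda>(u, W). real W)
        \<le> Const * (1 + ln (\<Delta> / \<epsilon>)) ^ p *
          (S0 / C0 P + r * S0 / sqrt \<epsilon> + r * S1 + \<chi> * S1) \<and>
      real (snd (initialize A P)) \<le> Const * real (nnz A + m + n) \<and>
      (\<forall>u\<in>carrier_vec m.
         (\<forall>j<n. fst (primal_response A c \<gamma> u) j = exp ((col A j \<bullet> u - c $ j) / \<gamma>)) \<and>
         real (snd (primal_response A c \<gamma> u)) \<le> Const * real (nnz A + m + n))"
proof (rule exI[of _ "4 + 208 * (real K + 7)"], rule exI[of _ 2], intro allI, unfold Let_def, rule impI,
    goal_cases)
  case (1 m n A b c \<gamma> bs \<kappa> \<nu> z \<Delta> r \<epsilon> rule pc)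
  define P where "P = \<lparr>blocks = bs, kappa = \<kappa>, nu = \<nu>, anchor = z, gap_bound = \<Delta>, radius = r,
             level = 1 / 3, target = \<epsilon> / 2\<rparr>"
  define f where "f = sumexp A b c \<gamma>"
  define J where "J = nat \<lceil>ln (2 * \<Delta> / \<epsilon>) / ln 3\<rceil>"
  define Const where "Const = 4 + 208 * (real K + 7)"
  define L where "L = ln (\<Delta> / \<epsilon>)"
  define S0 where "S0 = (\<Sum>B\<in>set bs. real (block_cost A B) * sqrt (\<kappa> B))"
  define S1 where "S1 = (\<Sum>B\<in>set bs. real (block_cost A B) * sqrt (\<nu> B))"
  define \<chi> where "\<chi> = (if 0 < C1 P then min (sqrt (2 * \<Delta>) / C0 P) (1 / C1 P) else 0)"
  have P: "blocks P = bs" "kappa P = \<kappa>" "nu P = \<nu>" "anchor P = z" "gap_bound P = \<Delta>" "radius P = r"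
    "level P = 1 / 3" "target P = \<epsilon> / 2"
    by (simp_all add: P_def)
  note H = 1[folded P_def, folded f_def]
  have A: "A \<in> carrier_mat m n" and b: "b \<in> carrier_vec m" and c: "c \<in> carrier_vec n" and \<gamma>: "0 < \<gamma>"
    and bs: "distinct bs" "partition_on {..<m} (set bs)"
    and kn: "\<And>B. B \<in> set bs \<Longrightarrow> 0 \<le> \<kappa> B" "\<And>B. B \<in> set bs \<Longrightarrow> 0 \<le> \<nu> B"
    and hess: "\<And>u B. u \<in> carrier_vec m \<Longrightarrow> B \<in> set bs \<Longrightarrow>
      loewner_on B (hessian f u) (\<lambda>i j. if i = j then \<kappa> B + \<nu> B * gap m f u else 0)"
    and C0: "0 < C0 P" and z: "z \<in> carrier_vec m" and Fz: "gap m f z \<le> \<Delta>"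
    and \<epsilon>: "0 < \<epsilon>" "\<epsilon> < \<Delta>" and rule: "admissible_rule f P rule"
    and pc: "\<And>h B. B \<in> set bs \<Longrightarrow> pc h B \<le> K * block_cost A B"
    using H by blast+
  obtain us where us: "is_arg_min f (\<lambda>u. u \<in> carrier_vec m) us" and near: "norm2 (z - us) \<le> r"
    using H by blast
  have dims: "dim_row A = m" "dim_col A = n" using A by auto
  have L: "0 \<le> L" using \<epsilon> by (simp add: L_def)
  have J: "\<Delta> * (1 / 3) ^ J \<le> \<epsilon> / 2" "real J \<le> 2 * (1 + L)"
    unfolding J_def L_def by (rule copies_bounds[OF \<epsilon>])+
  have Const: "11 \<le> Const" by (simp add: Const_def)
  have work: "measure_pmf.expectation (lazy_run A b c \<gamma> P rule pc J) (\<lambda>(u, W). real W) =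
      measure_pmf.expectation (lazy_restarts A b c \<gamma> P rule pc (fst (initialize A P)) J)
        (\<lambda>(st, best, W). real W)"
    by (simp add: lazy_run_def split_def)
  have law: "map_pmf fst (lazy_run A b c \<gamma> P rule pc J) =
      map_pmf (\<lambda>(st, best, W). candidate_point z best)
        (lazy_restarts A b c \<gamma> P rule pc (fst (initialize A P)) J)"
    by (simp add: lazy_run_def map_pmf_comp split_def P)
  have init: "real (snd (initialize A P)) \<le> Const * real (nnz A + m + n)"
  proof -
    have "length bs \<le> m" using card_blocks_le[OF bs(2)] bs(1) by (simp add: distinct_card)
    moreover have "bs \<noteq> []" using C0 by (auto simp: root_sum_def P)
    ultimately have "snd (initialize A P) \<le> 11 * (nnz A + m + n)"
      using initialize_eq(6)[of P A] bs(1) by (cases bs) (auto simp: P dims)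
    then have "real (snd (initialize A P)) \<le> 11 * real (nnz A + m + n)"
      using of_nat_mono[of "snd (initialize A P)" "11 * (nnz A + m + n)"] by simp
    also have "\<dots> \<le> Const * real (nnz A + m + n)" using Const by (intro mult_right_mono) auto
    finally show ?thesis .
  qed
  have resp: "(\<forall>j<n. fst (primal_response A c \<gamma> u) j = exp ((col A j \<bullet> u - c $ j) / \<gamma>)) \<and>
      real (snd (primal_response A c \<gamma> u)) \<le> Const * real (nnz A + m + n)"
    if u: "u \<in> carrier_vec m" for u
  proof -
    have "real (snd (primal_response A c \<gamma> u)) \<le> 11 * real (nnz A + m + n)"
      by (simp add: primal_response_eq(2)[OF A u])
    also have "\<dots> \<le> Const * real (nnz A + m + n)" using Const by (intro mult_right_mono) auto
    finally show ?thesis using primal_response_eq(1)[OF A u] by blast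
  qed
  have main: "measure_pmf.expectation (bcd_restarts f P rule J) (gap m f) \<le> \<epsilon> \<and>
      map_pmf fst (lazy_run A b c \<gamma> P rule pc J) = bcd_restarts f P rule J \<and>
      measure_pmf.expectation (lazy_run A b c \<gamma> P rule pc J) (\<lambda>(u, W). real W)
        \<le> Const * (1 + L) ^ 2 * (S0 / C0 P + r * S0 / sqrt \<epsilon> + r * S1 + \<chi> * S1)"
  proof (cases "r = 0")
    case False
    have "0 \<le> norm2 (z - us)" by (simp add: norm2_def scalar_prod_def sum_nonneg)
    then have r: "0 < r" using near False by linarith
    have "loewner_on B (hessian f u) (\<lambda>i j. if i = j then kappa P B + nu P B * gap m f u else 0)"
      if "u \<in> carrier_vec m" "B \<in> set bs" for u B
      unfolding P by (rule hess[OF that])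
    then interpret lazy_phase A b c \<gamma> m n P us rule pc K
      using A b c \<gamma> bs kn C0 z Fz us near \<epsilon> rule pc r unfolding f_def
      by unfold_locales (auto simp: P)
    have active: "\<not> returns_anchor P" using C0 r \<epsilon> by (simp add: returns_anchor_def P)
    have "measure_pmf.expectation (bcd_restarts f P rule J) (gap m f) \<le> \<epsilon> / 2 + \<Delta> * (1 / 3) ^ J"
      using restarts_gap[OF active, of J] \<epsilon> by (simp add: P f_def)
    moreover have "map_pmf (\<lambda>(st, best, W). candidate_point z best)
        (lazy_restarts A b c \<gamma> P rule pc (fst (initialize A P)) J) = bcd_restarts f P rule J"
      using restarts_best[OF active, of J] by (simp add: P f_def)
    moreover have "measure_pmf.expectation (lazy_restarts A b c \<gamma> P rule pc (fst (initialize A P)) J)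
        (\<lambda>(st, best, W). real W)
        \<le> Const * (1 + L) ^ 2 * (S0 / C0 P + r * S0 / sqrt \<epsilon> + r * S1 + \<chi> * S1)"
      using restarts_work_log_sq[of \<epsilon> J] \<epsilon> J(2)
      unfolding P Const_def L_def S0_def S1_def \<chi>_def by simp
    ultimately show ?thesis using J(1) by (simp add: work law)
  next
    case True
    then have inactive: "returns_anchor P" by (simp add: returns_anchor_def P)
    have us': "us \<in> carrier_vec m" using us by (simp add: is_arg_min_def)
    have "(z - us) \<bullet> (z - us) \<le> 0" using near True by (simp add: norm2_def)
    then have "(\<Sum>i<m. (z $ i - us $ i)\<^sup>2) \<le> 0"
      using z us' by (simp add: scalar_prod_def lessThan_atLeast0 power2_eq_square)
    then have "(\<Sum>i<m. (z $ i - us $ i)\<^sup>2) = 0" by (intro antisym sum_nonneg) auto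
    then have "z = us" using z us' by (intro eq_vecI) (auto simp: sum_nonneg_eq_0_iff)
    have gap: "gap m f z = 0" using gap_eq_diff[OF us] \<open>z = us\<close> by simp
    have lazy: "lazy_restarts A b c \<gamma> P rule pc (fst (initialize A P)) J =
        return_pmf (lazy_init P, (0, [], []), 2 * J)" by (rule inactive_lazy_restarts[OF inactive])
    have "1 \<le> S0 / C0 P"
      using root_sum_le_weighted[OF bs(2) kn(1), where A = A] C0 by (simp add: S0_def P)
    moreover have "0 \<le> \<chi> * S1"
      using C0 \<epsilon> kn(2) by (auto simp: \<chi>_def S1_def intro!: mult_nonneg_nonneg sum_nonneg)
    ultimately have G: "1 \<le> S0 / C0 P + r * S0 / sqrt \<epsilon> + r * S1 + \<chi> * S1" using True by simp
    have "2 * real J \<le> 4 * (1 + L) * 1" using J(2) by simp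
    also have "\<dots> \<le> 4 * (1 + L) * (1 + L)" using L by (intro mult_left_mono) auto
    also have "\<dots> \<le> Const * (1 + L) ^ 2"
      using Const mult_right_mono[of 4 Const "(1 + L)\<^sup>2"]
      by (simp only: power2_eq_square mult.assoc zero_le_square)
    also have "Const * (1 + L) ^ 2 = Const * (1 + L) ^ 2 * 1" by simp
    also have "\<dots> \<le> Const * (1 + L) ^ 2 * (S0 / C0 P + r * S0 / sqrt \<epsilon> + r * S1 + \<chi> * S1)"
      using G Const by (intro mult_left_mono) auto
    finally show ?thesis
      using gap \<epsilon> by (simp add: work law lazy inactive_restarts[OF inactive] candidate_point_init P)
  qed
  from main init resp show ?case
    unfolding f_def P_def[symmetric] J_def L_def S0_def S1_def \<chi>_def Const_def by blast
qed

end
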